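(* Let $G$ be an abelian group with no elements of order $2$, and let $A,B$ be finite multisets of $G$. Write $\mu := \mu_A-\mu_B$. Then the following are equivalent: (i) $\mathrm{FS}(A)=\mathrm{FS}(B)+s$ for some $s\in G$. (ii) $\mu\in V(G)$. (iii) There is a sequence of multisets $A=E_0,E_1,E_2,\dots,E_m=B$ of $G$ such that each $E_i$ can be transformed into $E_{i+1}$ by applying one of the two types of moves defined in the context. Moreover, for each $i$ we have $\mathrm{FS}(E_{i+1})=\mathrm{FS}(E_i)+s_i$ for some $s_i\in G$.
   Context: All multisets are finite. The multiplicity function $\mu_S:G\to\mathbb{N}$ of a finite multiset $S$ of $G$ assigns to $g$ its multiplicity in $S$. Unions add multiplicities, $S\setminus T$ (for $T\subseteq S$) subtracts them, and inclusion is with multiplicity. For a finite multiset $A$ of an abelian group $G$, $\sum A$ is the sum of its elements with multiplicity, and $\mathrm{FS}(A):=\{\sum A' : A'\subseteq A\}$ is the multiset of its $2^{|A|}$ subset sums (repeated elements of $A$ are treated as distinguishable, so one sum per sub-collection). $S+s$ denotes the translate of the multiset $S$ by $s$. For an odd integer $n\ge 3$, let $k\ge 1$ be the smallest integer such that $2^k\equiv 1$ or $2^k\equiv -1 \pmod n$, and set $U_n:=\{1,2,4,\dots,2^{k-1}\}\subseteq \mathbb{Z}/n\mathbb{Z}$. Moves on a finite multiset $A$ of $G$ (an abelian group with no elements of order $2$): (1) for an element $g\in A$, replace $g$ with $-g$, i.e. $A$ becomes $(A\setminus\{g\})\cup\{-g\}$; (2) for an odd integer $n\ge 3$, $\alpha,\beta\in(\mathbb{Z}/n\mathbb{Z})^\times$,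 and an injective group homomorphism $\iota:\mathbb{Z}/n\mathbb{Z}\to G$ with $\iota(\alpha U_n)\subseteq A$, replace the subset $\iota(\alpha U_n)$ of $A$ by $\iota(\beta U_n)$, i.e. $A$ becomes $(A\setminus\iota(\alpha U_n))\cup\iota(\beta U_n)$. $V(G)$ is the $\mathbb{Z}$-module of all functions $\mu:G\to\mathbb{Z}$ with finite support such that $\mu(g)+\mu(-g)=\mu(2g)+\mu(-2g)$ for all $g\in G$, and $\sum_{g\in H}\mu(g)=0$ for all subgroups $H\le G$. *)

theory Defs
  imports "HOL-Library.Multiset" "HOL-Number_Theory.Residues"
begin

text \<open>
  The ambient abelian group \<open>G\<close> is a type of class \<open>ab_group_add\<close>.  The cyclic group
  \<open>\<int>/n\<int>\<close> is the additive part of \<^term>\<open>residue_ring n\<close>, i.e. the residues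
  \<open>0, \<dots>, n - 1\<close> with arithmetic modulo \<open>n\<close>.
\<close>

definition no_order_two :: "'a::ab_group_add itself \<Rightarrow> bool" where
  "no_order_two _ \<longleftrightarrow> (\<forall>g::'a. g + g = 0 \<longrightarrow> g = 0)"

definition add_subgroup :: "'a::ab_group_add set \<Rightarrow> bool" where
  "add_subgroup H \<longleftrightarrow> 0 \<in> H \<and> (\<forall>x\<in>H. \<forall>y\<in>H. x + y \<in> H) \<and> (\<forall>x\<in>H. - x \<in> H)"

text \<open>
  The pairs \<open>(a, i)\<close> with \<open>i < count A a\<close> make the occurrences of \<open>a\<close> in \<open>A\<close>
  distinguishable, so that each of the \<open>2 ^ size A\<close> sub-collections contributes one sum.
\<close>

definition occurrences :: "'a multiset \<Rightarrow> ('a \<times> nat) set" where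
  "occurrences A = (SIGMA a:set_mset A. {..<count A a})"

definition FS :: "'a::ab_group_add multiset \<Rightarrow> 'a multiset" where
  "FS A = image_mset (\<lambda>T. \<Sum>(a, i)\<in>T. a) (mset_set (Pow (occurrences A)))"

definition translate :: "'a::ab_group_add multiset \<Rightarrow> 'a \<Rightarrow> 'a multiset" where
  "translate S s = image_mset (\<lambda>x. x + s) S"

definition U_length :: "int \<Rightarrow> nat" where
  "U_length n = (LEAST k. k \<ge> 1 \<and> ([2 ^ k = 1] (mod n) \<or> [2 ^ k = - 1] (mod n)))"

definition U :: "int \<Rightarrow> int set" where
  "U n = (\<lambda>i. 2 ^ i mod n) ` {..<U_length n}"

definition residue_scale :: "int \<Rightarrow> int \<Rightarrow> int set \<Rightarrow> int set" where
  "residue_scale n \<alpha> S = (\<lambda>u. \<alpha> \<otimes>\<^bsub>residue_ring n\<^esub> u) ` S"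

text \<open>Only the values of \<open>\<iota>\<close> on the carrier \<open>{0..n - 1}\<close> matter.\<close>

definition inj_residue_hom :: "int \<Rightarrow> (int \<Rightarrow> 'a::ab_group_add) \<Rightarrow> bool" where
  "inj_residue_hom n \<iota> \<longleftrightarrow>
     (\<forall>x\<in>carrier (residue_ring n). \<forall>y\<in>carrier (residue_ring n).
        \<iota> (x \<oplus>\<^bsub>residue_ring n\<^esub> y) = \<iota> x + \<iota> y) \<and>
     inj_on \<iota> (carrier (residue_ring n))"

definition move1 :: "'a::ab_group_add multiset \<Rightarrow> 'a multiset \<Rightarrow> bool" where
  "move1 A A' \<longleftrightarrow> (\<exists>g. g \<in># A \<and> A' = (A - {#g#}) + {#- g#})"

definition move2 :: "'a::ab_group_add multiset \<Rightarrow> 'a multiset \<Rightarrow> bool" where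
  "move2 A A' \<longleftrightarrow>
     (\<exists>n \<alpha> \<beta>. \<exists>\<iota> :: int \<Rightarrow> 'a.
        odd n \<and> n \<ge> 3 \<and> \<alpha> \<in> Units (residue_ring n) \<and> \<beta> \<in> Units (residue_ring n) \<and>
        inj_residue_hom n \<iota> \<and>
        mset_set (\<iota> ` residue_scale n \<alpha> (U n)) \<subseteq># A \<and>
        A' = (A - mset_set (\<iota> ` residue_scale n \<alpha> (U n)))
              + mset_set (\<iota> ` residue_scale n \<beta> (U n)))"

text \<open>
  The sum over a possibly infinite subgroup \<open>H\<close> is taken over the finitely many elements
  of \<open>H\<close> in the support; a plain \<^const>\<open>sum\<close> over an infinite \<open>H\<close> would be \<open>0\<close>.
\<close>

definition V :: "('a::ab_group_add \<Rightarrow> int) set" where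
  "V = {\<mu>. finite {g. \<mu> g \<noteq> 0} \<and>
           (\<forall>g. \<mu> g + \<mu> (- g) = \<mu> (g + g) + \<mu> (- (g + g))) \<and>
           (\<forall>H. add_subgroup H \<longrightarrow> (\<Sum>g\<in>{g \<in> H. \<mu> g \<noteq> 0}. \<mu> g) = 0)}"

end

theory Submission
  imports Defs "HOL-Analysis.Analysis" "HOL-Number_Theory.Number_Theory"
begin

text \<open>
  The hard implication is that the multiset of subset sums determines \<open>\<mu>\<close> up to \<open>V\<close>.  Let
  \<open>f g = \<mu> g + \<mu> (- g)\<close>.  Applying a character \<open>\<phi>\<close> of odd order to
  \<open>\<Prod>\<^sub>A (1 + x\<^sup>a) = x\<^sup>s \<Prod>\<^sub>B (1 + x\<^sup>b)\<close> and taking logarithms of absolute values gives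
  \<open>\<Sum> f g ln \<bar>1 + \<phi> g\<bar> = 0\<close>.  Expanding the logarithm, \<open>v m = \<Sum> f g (\<phi> g)\<^sup>m\<close> is a function on \<open>\<int>/N\<close>
  (\<open>N\<close> odd) all of whose dilates satisfy \<open>\<Sum> (-1)\<^sup>m\<^sup>+\<^sup>1 v (d m) / m = 0\<close> in the sense of Abel.  Removing the
  primes dividing \<open>N\<close> by a sieve leaves a relation on the units modulo \<open>N\<close>.  A nonzero
  dilation-invariant space of functions on the units contains a Dirichlet character \<open>\<psi>\<close>, whose alternating sum is
  \<open>(1 - \<psi> 2) L(1, \<psi>)\<close>; so \<open>L(1, \<psi>) \<noteq> 0\<close> forces \<open>v 2 = v 1\<close>, and the trivial character, for which
  the sum is a nonzero multiple of \<open>ln 2\<close>, gives \<open>\<Sum> v j = 0\<close> over the units \<open>j\<close>.  Independence of characters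
  turns the first relation into \<open>f (2 g) = f g\<close> and the second into the vanishing of \<open>f\<close> on subgroups.

  Conversely, if \<open>f \<noteq> 0\<close> then \<open>f\<close> takes both signs on the generators of some finite cyclic group; after
  some sign changes a move of the second type decreases \<open>\<Sum> \<bar>f\<bar>\<close>.  When \<open>f = 0\<close>, sign changes suffice.
\<close>

section \<open>Dirichlet characters\<close>

text \<open>Passing to absolute values removes the factor \<open>\<phi> s\<close> and avoids
  branches of the logarithm; the price is that \<open>g\<close> and \<open>- g\<close> become
  indistinguishable, so the argument sees only \<open>f\<close>. Odd order matters twice: it keeps
  -1 out of the values of \<open>\<phi>\<close>, so that no \<open>1 + \<phi> g\<close> vanishes,
  and it makes 2 a unit modulo \<open>N\<close>. A group without elements of order 2 still has
  enough such characters to separate points. The order of the two relations matters. A priori the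
  support of \<open>f\<close> may contain elements of infinite order, so \<open>N\<close> can only
  be chosen for one character at a time. This suffices for \<open>f (2 g) = f g\<close>, which
  together with finite support forces torsion; only then does a single \<open>N\<close> serve all
  characters, as the relation for subgroups requires. Nonvanishing of \<open>L(1, \<psi>)\<close>
  splits according to whether the square of \<open>\<psi>\<close> is trivial: if it is, its series
  has a pole at 1 and the 3-4-1 inequality yields nothing. In the converse, that a move keeps the
  difference in \<open>V\<close> is not computed: a move translates the subset sums, and the hard
  implication applies.\<close>

lemmas nat_cong_def = unique_euclidean_semiring_class.cong_def[where 'a = nat]

section \<open>Summation by parts and Dirichlet's test\<close>

lemma inverse_Suc_tendsto_0: "(\<lambda>m. 1 / real (Suc m)) \<longlonglongrightarrow> 0"
  using LIMSEQ_inverse_real_of_nat by (simp only: inverse_eq_divide)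

lemma summation_by_parts:
  fixes a b :: "nat \<Rightarrow> 'a::comm_ring"
  shows "(\<Sum>m<n. a m * b m) =
    (\<Sum>m<n. a m) * b n + (\<Sum>m<n. (\<Sum>i<Suc m. a i) * (b m - b (Suc m)))"
  by (induction n) (simp_all add: algebra_simps)

text \<open>The boundary term of the summation by parts vanishes because the partial sums are
  bounded and \<open>b\<close> tends to 0. Bounded variation is assumed instead of monotonicity
  because \<open>dirichlet_series_small\<close> uses a difference of two decreasing sequences, and
  it is the total variation of that difference which is small.\<close>

lemma Dirichlet_test:
  fixes a :: "nat \<Rightarrow> complex" and b :: "nat \<Rightarrow> real"
  assumes C: "\<And>n. norm (\<Sum>m<n. a m) \<le> C" and b0: "b \<longlonglongrightarrow> 0"
    and var: "summable (\<lambda>m. \<bar>b m - b (Suc m)\<bar>)"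
  shows "summable (\<lambda>m. a m * of_real (b m))"
    and "norm (\<Sum>m. a m * of_real (b m)) \<le> C * (\<Sum>m. \<bar>b m - b (Suc m)\<bar>)"
proof -
  let ?S = "\<lambda>n. \<Sum>m<n. a m" and ?d = "\<lambda>m. b m - b (Suc m)"
  let ?t = "\<lambda>m. ?S (Suc m) * of_real (?d m)"
  have "C \<ge> 0" using C[of 0] by simp
  have bd: "norm (?t m) \<le> C * \<bar>?d m\<bar>" for m
    unfolding norm_mult norm_of_real using C[of "Suc m"] by (intro mult_right_mono) auto
  have sn: "summable (\<lambda>m. norm (?t m))"
    using bd by (intro summable_comparison_test'[OF summable_mult[OF var, of C], of 0]) auto
  have lim0: "(\<lambda>n. ?S n * of_real (b n)) \<longlonglongrightarrow> 0"
  proof (rule tendsto_norm_zero_cancel, rule tendsto_sandwich[of "\<lambda>_. 0" _ _ "\<lambda>n. C * \<bar>b n\<bar>"])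
    show "\<forall>\<^sub>F n in sequentially. norm (?S n * of_real (b n)) \<le> C * \<bar>b n\<bar>"
      unfolding norm_mult norm_of_real using C by (intro always_eventually allI mult_right_mono) auto
    show "(\<lambda>n. C * \<bar>b n\<bar>) \<longlonglongrightarrow> 0"
      using tendsto_mult[OF tendsto_const tendsto_rabs[OF b0], of C] by simp
  qed auto
  have part: "(\<Sum>m<n. a m * of_real (b m)) = ?S n * of_real (b n) + (\<Sum>m<n. ?t m)" for n
    using summation_by_parts[of a "\<lambda>m. of_real (b m)" n] by simp
  have "(\<lambda>n. \<Sum>m<n. a m * of_real (b m)) \<longlonglongrightarrow> 0 + (\<Sum>m. ?t m)"
    unfolding part by (intro tendsto_add lim0 summable_LIMSEQ summable_norm_cancel[OF sn])
  hence sums: "(\<lambda>m. a m * of_real (b m)) sums (\<Sum>m. ?t m)"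
    by (simp add: sums_def)
  thus "summable (\<lambda>m. a m * of_real (b m))" by (rule sums_summable)
  have "norm (\<Sum>m. ?t m) \<le> (\<Sum>m. norm (?t m))" by (rule summable_norm[OF sn])
  also have "\<dots> \<le> (\<Sum>m. C * \<bar>?d m\<bar>)" by (intro suminf_le bd sn summable_mult var)
  also have "\<dots> = C * (\<Sum>m. \<bar>?d m\<bar>)" by (rule suminf_mult[OF var])
  finally show "norm (\<Sum>m. a m * of_real (b m)) \<le> C * (\<Sum>m. \<bar>b m - b (Suc m)\<bar>)"
    using sums by (simp add: sums_iff)
qed

lemma Dirichlet_test_decseq:
  fixes a :: "nat \<Rightarrow> complex" and b :: "nat \<Rightarrow> real"
  assumes C: "\<And>n. norm (\<Sum>m<n. a m) \<le> C" and b0: "b \<longlonglongrightarrow> 0" and "decseq b"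
  shows "summable (\<lambda>m. a m * of_real (b m))"
    and "norm (\<Sum>m. a m * of_real (b m)) \<le> C * b 0"
proof -
  have "(\<lambda>m. b m - b (Suc m)) sums (b 0 - 0)" by (rule telescope_sums'[OF b0])
  moreover have "\<bar>b m - b (Suc m)\<bar> = b m - b (Suc m)" for m
    using \<open>decseq b\<close> by (simp add: decseq_Suc_iff)
  ultimately have s: "(\<lambda>m. \<bar>b m - b (Suc m)\<bar>) sums b 0" by simp
  show "summable (\<lambda>m. a m * of_real (b m))" "norm (\<Sum>m. a m * of_real (b m)) \<le> C * b 0"
    using Dirichlet_test[OF C b0 sums_summable[OF s]] s by (simp_all add: sums_iff)
qed

text \<open>A character lives on all of \<open>nat\<close>, extended by 0 to the non-units. Modulus
  1 is allowed, and there \<open>\<psi> 0 = 1\<close>; hence \<open>\<psi> 0 = 0\<close> appears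
  only for nontrivial characters.\<close>

locale dirichlet_character =
  fixes N :: nat and \<psi> :: "nat \<Rightarrow> complex"
  assumes N_pos: "N > 0"
    and periodic: "\<psi> (m + N) = \<psi> m"
    and mult: "\<psi> (m * n) = \<psi> m * \<psi> n"
    and nonzero_iff: "\<psi> m \<noteq> 0 \<longleftrightarrow> coprime m N"
begin

lemma at_1 [simp]: "\<psi> (Suc 0) = 1"
  using mult[of 1 1] nonzero_iff[of 1] by simp

lemma power: "\<psi> (m ^ k) = \<psi> m ^ k"
  by (induction k) (simp_all add: mult)

lemma periodic_mult: "\<psi> (m + k * N) = \<psi> m"
proof (induction k)
  case (Suc k)
  have "m + Suc k * N = (m + k * N) + N" by simp
  with Suc show ?case by (metis periodic)
qed auto

lemma mod_eq: "\<psi> (m mod N) = \<psi> m"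
  using periodic_mult[of "m mod N" "m div N"] by simp

lemma cong: "[m = n] (mod N) \<Longrightarrow> \<psi> m = \<psi> n"
  by (metis mod_eq nat_cong_def)

lemma norm_eq_1: "coprime m N \<Longrightarrow> norm (\<psi> m) = 1"
proof -
  assume "coprime m N"
  hence "\<psi> m ^ totient N = 1"
    using cong[OF euler_theorem[of m N]] by (simp add: power)
  hence "norm (\<psi> m) ^ totient N = 1" by (metis norm_one norm_power)
  thus ?thesis using N_pos power_eq_imp_eq_base[of "norm (\<psi> m)" "totient N" 1] by simp
qed

lemma norm_le_1: "norm (\<psi> m) \<le> 1"
  using norm_eq_1[of m] nonzero_iff[of m] by (cases "coprime m N") auto

lemma power_character: "k > 0 \<Longrightarrow> dirichlet_character N (\<lambda>m. \<psi> m ^ k)"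
  by unfold_locales (use N_pos periodic mult nonzero_iff in \<open>auto simp: power_mult_distrib\<close>)

text \<open>Multiplication by the unit \<open>j\<close> permutes the residues, so the sum equals
  \<open>\<psi> j\<close> times itself.\<close>

lemma sum_period_eq_0:
  assumes j: "coprime j N" "\<psi> j \<noteq> 1"
  shows "(\<Sum>m<N. \<psi> m) = 0"
proof -
  have bij: "bij_betw (\<lambda>m. j * m mod N) {..<N} {..<N}"
  proof -
    have "inj_on (\<lambda>m. j * m mod N) {..<N}"
    proof (rule inj_onI)
      fix x y assume xy: "x \<in> {..<N}" "y \<in> {..<N}" "j * x mod N = j * y mod N"
      hence "[x = y] (mod N)" using cong_mult_lcancel_nat[OF j(1)] by (simp add: nat_cong_def)
      thus "x = y" using xy by (simp add: nat_cong_def)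
    qed
    thus ?thesis
      using N_pos by (intro bij_betw_imageI endo_inj_surj) auto
  qed
  have "(\<Sum>m<N. \<psi> m) = (\<Sum>m<N. \<psi> (j * m mod N))"
    by (rule sum.reindex_bij_betw[OF bij, symmetric])
  also have "\<dots> = \<psi> j * (\<Sum>m<N. \<psi> m)"
    by (simp add: mod_eq mult sum_distrib_left)
  finally show ?thesis using j(2) by auto
qed

end

locale nontrivial_dirichlet_character = dirichlet_character +
  assumes nontrivial: "\<exists>j. coprime j N \<and> \<psi> j \<noteq> 1"
begin

lemma N_gt_1: "N > 1"
proof (rule ccontr)
  assume "\<not> N > 1"
  hence "N = 1" using N_pos by simp
  hence "\<psi> j = 1" for j using mod_eq[of j] mod_eq[of 1] at_1 by simp
  thus False using nontrivial by simp
qed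

lemma at_0 [simp]: "\<psi> 0 = 0"
  using nonzero_iff[of 0] N_gt_1 by simp

text \<open>Complete periods cancel, leaving fewer than \<open>N\<close> terms of norm at most 1.
  The index starts at 1 to match the later weights \<open>1 / m\<close>; \<open>\<psi> 0 = 0\<close>
  makes the shift harmless.\<close>

lemma sum_bounded: "norm (\<Sum>m<n. \<psi> (Suc m)) \<le> N"
proof -
  obtain j where "coprime j N" "\<psi> j \<noteq> 1" using nontrivial by (elim exE conjE)
  hence p0: "(\<Sum>m<N. \<psi> m) = 0" by (rule sum_period_eq_0)
  have split: "(\<Sum>m<N + k. \<psi> m) = (\<Sum>m<k. \<psi> m)" for k
  proof (induction k)
    case (Suc k)
    thus ?case using periodic[of k] by (simp add: add.commute)
  qed (simp add: p0)
  have mult: "(\<Sum>m<k * N + r. \<psi> m) = (\<Sum>m<r. \<psi> m)" for k r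
  proof (induction k)
    case (Suc k)
    thus ?case using split[of "k * N + r"] by (simp add: add.assoc)
  qed simp
  have "norm (\<Sum>m<Suc n. \<psi> m) = norm (\<Sum>m<Suc n mod N. \<psi> m)"
    using mult[of "Suc n div N" "Suc n mod N"] by (simp only: div_mult_mod_eq)
  also have "\<dots> \<le> (\<Sum>m<Suc n mod N. 1)"
    by (rule sum_norm_le) (rule norm_le_1)
  also have "\<dots> \<le> real N"
    using mod_less_divisor[OF N_pos, of "Suc n"] by simp
  finally have "norm (\<Sum>m<Suc n. \<psi> m) \<le> N" .
  thus ?thesis by (simp only: sum.lessThan_Suc_shift at_0 add_0)
qed

lemma summable_harmonic: "summable (\<lambda>m. \<psi> (Suc m) / of_nat (Suc m))"
proof -
  have "decseq (\<lambda>m. 1 / real (Suc m))" by (intro decseq_SucI frac_le) auto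
  moreover have "(\<lambda>m. 1 / real (Suc m)) \<longlonglongrightarrow> 0"
    by (rule inverse_Suc_tendsto_0)
  ultimately have "summable (\<lambda>m. \<psi> (Suc m) * of_real (1 / real (Suc m)))"
    by (intro Dirichlet_test_decseq(1)[OF sum_bounded])
  thus ?thesis by (simp only: of_real_divide of_real_of_nat_eq of_real_1 times_divide_eq_right mult_1_right)
qed

end

section \<open>Sieving and Euler products\<close>

lemma suminf_coprime_sieve:
  fixes f :: "nat \<Rightarrow> complex"
  assumes mult: "\<And>m n. f (m * n) = f m * f n" and sm: "summable (\<lambda>m. norm (f m))"
    and "f 0 = 0" and "finite Q" "\<And>p. p \<in> Q \<Longrightarrow> prime p"
  shows "(\<Sum>m. if \<forall>p\<in>Q. \<not> p dvd m then f m else 0) = (\<Sum>m. f m) * (\<Prod>p\<in>Q. 1 - f p)"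
  using assms(4,5)
proof (induction Q)
  case (insert p Q)
  have p: "prime p" by (rule insert.prems) simp
  have Q: "\<And>q. q \<in> Q \<Longrightarrow> prime q" by (rule insert.prems) simp
  define g where "g m = (if \<forall>q\<in>Q. \<not> q dvd m then f m else 0)" for m
  have sg: "summable g"
    by (rule summable_norm_cancel, rule summable_comparison_test'[OF sm, of 0]) (auto simp: g_def)
  \<comment> \<open>The primes in \<open>Q\<close> differ from \<open>p\<close>, so divisibility by
    them is unaffected by a factor \<open>p\<close>; hence the multiples of \<open>p\<close>
    contribute \<open>f p\<close> times the whole sieved sum.\<close>
  have gp: "g (p * m) = f p * g m" for m
  proof -
    have "q dvd p * m \<longleftrightarrow> q dvd m" if "q \<in> Q" for q
    proof -
      have "\<not> q dvd p" using primes_dvd_imp_eq[OF Q[OF that] p] insert.hyps(2) that by auto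
      thus ?thesis using prime_dvd_mult_iff[OF Q[OF that]] by blast
    qed
    thus ?thesis by (simp add: g_def mult)
  qed
  have "(\<lambda>m. g (p * m)) sums (f p * suminf g)"
    unfolding gp by (intro sums_mult summable_sums sg)
  moreover have "(\<lambda>m. (\<lambda>m. if p dvd m then g m else 0) (p * m)) sums (f p * suminf g)
     \<longleftrightarrow> (\<lambda>m. if p dvd m then g m else 0) sums (f p * suminf g)"
    using prime_gt_0_nat[OF p] by (intro sums_mono_reindex strict_monoI) auto
  ultimately have "(\<lambda>m. if p dvd m then g m else 0) sums (f p * suminf g)" by simp
  hence "(\<lambda>m. g m - (if p dvd m then g m else 0)) sums (suminf g - f p * suminf g)"
    by (intro sums_diff summable_sums sg)
  moreover have "g m - (if p dvd m then g m else 0) =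
      (if \<forall>q\<in>insert p Q. \<not> q dvd m then f m else 0)" for m
    by (auto simp: g_def)
  ultimately have "(\<lambda>m. if \<forall>q\<in>insert p Q. \<not> q dvd m then f m else 0) sums
      (suminf g - f p * suminf g)"
    by (simp only:)
  hence "(\<Sum>m. if \<forall>q\<in>insert p Q. \<not> q dvd m then f m else 0) =
      suminf g - f p * suminf g"
    by (rule sums_unique[symmetric])
  also have "suminf g = (\<Sum>m. f m) * (\<Prod>p\<in>Q. 1 - f p)"
    unfolding g_def using insert by auto
  finally show ?case using insert.hyps by (simp add: algebra_simps)
qed simp

text \<open>The reciprocal factors multiply the sum, so nothing has to be inverted and no infinite
  product is formed. Once the multiples of all primes up to \<open>P\<close> are removed, only
  \<open>m = 1\<close> survives up to \<open>P\<close>; the rest is bounded by a tail of an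
  absolutely convergent series.\<close>

lemma Euler_product:
  fixes f :: "nat \<Rightarrow> complex"
  assumes mult: "\<And>m n. f (m * n) = f m * f n" and sm: "summable (\<lambda>m. norm (f m))"
    and f0: "f 0 = 0" and f1: "f 1 = 1"
  shows "(\<lambda>P. (\<Sum>m. f m) * (\<Prod>p | prime p \<and> p \<le> P. 1 - f p)) \<longlonglongrightarrow> 1"
proof -
  define g where "g P m = (if \<forall>p\<in>{p. prime p \<and> p \<le> P}. \<not> p dvd m then f m else 0)" for P m
  have sg: "summable (g P)" for P
    by (rule summable_norm_cancel, rule summable_comparison_test'[OF sm, of 0]) (auto simp: g_def)
  have eq: "(\<Sum>m. f m) * (\<Prod>p | prime p \<and> p \<le> P. 1 - f p) = suminf (g P)" for P
    unfolding g_def by (rule suminf_coprime_sieve[OF mult sm f0, symmetric]) auto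
  have small: "g P m = 0" if "m \<noteq> 1" "m \<le> P" for P m
  proof (cases "m = 0")
    case False
    with that obtain p where "prime p" "p dvd m" by (metis prime_factor_nat)
    moreover from this False that have "p \<le> P" by (meson dvd_imp_le le_trans neq0_conv)
    ultimately show ?thesis by (auto simp: g_def)
  qed (simp add: g_def f0)
  have g1: "g P 1 = 1" for P using f1 by (auto simp: g_def)
  have bound: "norm (suminf (g (Suc P)) - 1) \<le> (\<Sum>m. norm (f (m + Suc (Suc P))))" for P
  proof -
    let ?P = "Suc P"
    have "suminf (g ?P) = (\<Sum>m. g ?P (m + Suc ?P)) + (\<Sum>m<Suc ?P. g ?P m)"
      by (rule suminf_split_initial_segment[OF sg])
    also have "(\<Sum>m<Suc ?P. g ?P m) = (\<Sum>m\<in>{1}. g ?P m)"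
      by (intro sum.mono_neutral_right) (auto simp: small)
    finally have "suminf (g ?P) - 1 = (\<Sum>m. g ?P (m + Suc ?P))" using g1 by simp
    also have "norm \<dots> \<le> (\<Sum>m. norm (f (m + Suc ?P)))"
    proof -
      have s1: "summable (\<lambda>m. norm (f (m + Suc ?P)))" by (rule summable_ignore_initial_segment[OF sm])
      have le: "norm (g ?P (m + Suc ?P)) \<le> norm (f (m + Suc ?P))" for m by (auto simp: g_def)
      have s2: "summable (\<lambda>m. norm (g ?P (m + Suc ?P)))"
        using le by (intro summable_comparison_test'[OF s1, of 0]) auto
      show ?thesis using summable_norm[OF s2] suminf_le[OF le s2 s1] by linarith
    qed
    finally show ?thesis .
  qed
  have lim: "(\<lambda>P. \<Sum>m. norm (f (m + Suc (Suc P)))) \<longlonglongrightarrow> 0"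
    using LIMSEQ_ignore_initial_segment[OF suminf_exist_split2[OF sm], of 2]
    by (simp only: add_2_eq_Suc')
  have "(\<lambda>P. suminf (g (Suc P)) - 1) \<longlonglongrightarrow> 0"
  proof (rule Lim_null_comparison[of "\<lambda>P. suminf (g (Suc P)) - 1"
        "\<lambda>P. \<Sum>m. norm (f (m + Suc (Suc P)))" sequentially])
    show "\<forall>\<^sub>F P in sequentially. norm (suminf (g (Suc P)) - 1) \<le> (\<Sum>m. norm (f (m + Suc (Suc P))))"
      by (rule always_eventually, rule allI, rule bound)
  qed (rule lim)
  hence "(\<lambda>P. suminf (g P)) \<longlonglongrightarrow> 1"
    by (rule LIMSEQ_imp_Suc[OF LIM_zero_cancel])
  thus ?thesis by (simp add: eq)
qed

section \<open>Nonvanishing of L-functions at 1\<close>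

text \<open>Real part of the logarithm series; the term \<open>n = 0\<close> is 0 by division by
  zero.\<close>

lemma sums_minus_ln_norm:
  fixes z :: complex
  assumes "norm z < 1"
  shows "(\<lambda>n. Re (z ^ n) / real n) sums (- ln (norm (1 - z)))"
proof -
  have nz: "1 - z \<noteq> 0" using assms by auto
  have "(\<lambda>n. - ((- (- z)) ^ n) / of_nat n) sums ln (1 + (- z))"
    by (rule Ln_series') (simp add: assms)
  from sums_minus[OF sums_Re[OF this]] nz show ?thesis
    by (simp add: Re_divide_of_nat)
qed

text \<open>Minus the logarithm of the left-hand side is a power series in \<open>y\<close> whose
  coefficients are, up to the factor \<open>1 / m\<close>,
  \<open>3 + 4 * c + (2 * c ^ 2 - 1) = 2 * (1 + c) ^ 2\<close> with \<open>c = Re (w ^ m)\<close>,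
  hence nonnegative.\<close>

lemma three_four_one:
  fixes w :: complex and y :: real
  assumes y: "0 \<le> y" "y < 1" and w: "norm w = 1"
  shows "norm (1 - of_real y :: complex) ^ 3 * norm (1 - w * of_real y) ^ 4 * norm (1 - w ^ 2 * of_real y) \<le> 1"
proof -
  let ?l = "\<lambda>z::complex. ln (norm (1 - z))"
  let ?z1 = "w * of_real y" and ?z2 = "w ^ 2 * of_real y"
  have n: "norm (of_real y :: complex) < 1" "norm ?z1 < 1" "norm ?z2 < 1"
    using y w by (auto simp: norm_mult norm_power)
  have nz: "1 - of_real y \<noteq> (0::complex)" "1 - ?z1 \<noteq> 0" "1 - ?z2 \<noteq> 0" using n by auto
  have sums: "(\<lambda>m. 3 * (Re (of_real y ^ m) / real m) + 4 * (Re (?z1 ^ m) / real m) + Re (?z2 ^ m) / real m)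
     sums (3 * (- ?l (of_real y)) + 4 * (- ?l ?z1) + (- ?l ?z2))"
    by (intro sums_add sums_mult sums_minus_ln_norm n)
  have nonneg: "3 * (Re (of_real y ^ m) / real m) + 4 * (Re (?z1 ^ m) / real m) + Re (?z2 ^ m) / real m \<ge> 0" for m
  proof -
    define c where "c = Re (w ^ m)"
    have "(Re (w ^ m))\<^sup>2 + (Im (w ^ m))\<^sup>2 = 1"
      using w by (metis cmod_power2 norm_power power_one)
    hence "Re ((w ^ m) ^ 2) = 2 * c ^ 2 - 1"
      unfolding c_def by (simp add: power2_eq_square)
    moreover have "(w ^ m) ^ 2 = (w ^ 2) ^ m" by (simp add: power_mult[symmetric] mult.commute)
    ultimately have c2: "Re ((w ^ 2) ^ m) = 2 * c ^ 2 - 1" by simp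
    have "3 * (Re (of_real y ^ m) / real m) + 4 * (Re (?z1 ^ m) / real m) + Re (?z2 ^ m) / real m
      = (3 + 4 * c + Re ((w ^ 2) ^ m)) * (y ^ m / real m)"
      unfolding power_mult_distrib of_real_power[symmetric] c_def
      by (simp add: algebra_simps add_divide_distrib)
    also have "3 + 4 * c + Re ((w ^ 2) ^ m) = 2 * (1 + c) ^ 2"
      unfolding c2 by (simp add: power2_eq_square algebra_simps)
    also have "2 * (1 + c) ^ 2 * (y ^ m / real m) \<ge> 0" using y by simp
    finally show ?thesis .
  qed
  have "0 \<le> 3 * (- ?l (of_real y)) + 4 * (- ?l ?z1) + (- ?l ?z2)"
    by (rule sums_le[OF nonneg sums_zero sums])
  hence "ln (norm (1 - of_real y :: complex) ^ 3 * norm (1 - ?z1) ^ 4 * norm (1 - ?z2)) \<le> 0"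
    using nz by (simp add: ln_mult ln_realpow)
  thus ?thesis using nz by (subst (asm) ln_le_zero_iff) auto
qed

context dirichlet_character
begin

text \<open>As \<open>0 powr - s = 0\<close>, the term at \<open>m = 0\<close> vanishes even when
  \<open>\<psi> 0 = 1\<close>, so \<open>Euler_product\<close> covers every character.\<close>

abbreviation dirichlet_term :: "real \<Rightarrow> nat \<Rightarrow> complex" where
  "dirichlet_term s m \<equiv> \<psi> m * of_real (real m powr - s)"

lemma dirichlet_term_mult: "dirichlet_term s (m * n) = dirichlet_term s m * dirichlet_term s n"
  by (simp add: mult powr_mult)

lemma norm_dirichlet_term_le: "norm (dirichlet_term s m) \<le> real m powr - s"
proof -
  have "norm (dirichlet_term s m) \<le> 1 * real m powr - s"
    unfolding norm_mult by (intro mult_mono norm_le_1) auto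
  thus ?thesis by simp
qed

lemma summable_dirichlet_term: "s > 1 \<Longrightarrow> summable (\<lambda>m. norm (dirichlet_term s m))"
proof (rule summable_comparison_test'[of "\<lambda>m. real m powr - s" 0])
  show "summable (\<lambda>m. real m powr - s)" if "s > 1" using that by (simp add: summable_real_powr_iff)
  show "norm (norm (dirichlet_term s m)) \<le> real m powr - s" for m
    using norm_dirichlet_term_le[of m s] by simp
qed

text \<open>The norm of \<open>\<psi>\<close> is the principal character modulo \<open>N\<close>; it
  supplies the first of the three series below.\<close>

lemma trivial_character: "dirichlet_character N (\<lambda>m. of_real (norm (\<psi> m)))"
  by unfold_locales (use N_pos periodic mult nonzero_iff in \<open>auto simp: norm_mult\<close>)

lemma Euler_product_dirichlet:
  assumes "s > 1"
  shows "(\<lambda>P. suminf (dirichlet_term s) * (\<Prod>p | prime p \<and> p \<le> P. 1 - dirichlet_term s p)) \<longlonglongrightarrow> 1"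
  by (rule Euler_product[OF dirichlet_term_mult summable_dirichlet_term[OF assms]]) simp_all

text \<open>\<open>three_four_one\<close> bounds the combined factor at each prime by 1 (at primes
  dividing \<open>N\<close> all three factors are 1). So the truncated quantities, which tend to 1,
  never exceed the product of the full series.\<close>

lemma three_four_one_dirichlet:
  assumes s: "s > 1"
  shows "1 \<le> norm (\<Sum>m. of_real (norm (\<psi> m)) * of_real (real m powr - s) :: complex) ^ 3 *
    norm (\<Sum>m. \<psi> m * of_real (real m powr - s)) ^ 4 *
    norm (\<Sum>m. \<psi> m ^ 2 * of_real (real m powr - s))" (is "1 \<le> norm ?F0 ^ 3 * norm ?F1 ^ 4 * norm ?F2")
proof -
  interpret c0: dirichlet_character N "\<lambda>m. of_real (norm (\<psi> m))" by (rule trivial_character)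
  interpret c2: dirichlet_character N "\<lambda>m. \<psi> m ^ 2" by (rule power_character) simp
  define q where "q P = {p::nat. prime p \<and> p \<le> P}" for P
  define A0 where "A0 P = ?F0 * (\<Prod>p\<in>q P. 1 - c0.dirichlet_term s p)" for P
  define A1 where "A1 P = ?F1 * (\<Prod>p\<in>q P. 1 - dirichlet_term s p)" for P
  define A2 where "A2 P = ?F2 * (\<Prod>p\<in>q P. 1 - c2.dirichlet_term s p)" for P
  have "A0 \<longlonglongrightarrow> 1" "A1 \<longlonglongrightarrow> 1" "A2 \<longlonglongrightarrow> 1"
    unfolding A0_def A1_def A2_def q_def
    by (rule c0.Euler_product_dirichlet[OF s] Euler_product_dirichlet[OF s] c2.Euler_product_dirichlet[OF s])+
  hence lim: "(\<lambda>P. norm (A0 P) ^ 3 * norm (A1 P) ^ 4 * norm (A2 P)) \<longlonglongrightarrow> norm (1::complex) ^ 3 * norm (1::complex) ^ 4 * norm (1::complex)"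
    by (intro tendsto_mult tendsto_power tendsto_norm)
  have le: "norm (A0 P) ^ 3 * norm (A1 P) ^ 4 * norm (A2 P) \<le> norm ?F0 ^ 3 * norm ?F1 ^ 4 * norm ?F2" for P
  proof -
    let ?t = "\<lambda>p. norm (1 - c0.dirichlet_term s p) ^ 3 * norm (1 - dirichlet_term s p) ^ 4 * norm (1 - c2.dirichlet_term s p)"
    have "?t p \<le> 1" if "p \<in> q P" for p
    proof (cases "\<psi> p = 0")
      case False
      hence n1: "norm (\<psi> p) = 1" using nonzero_iff norm_eq_1 by blast
      have "p \<ge> 2" using that by (simp add: q_def prime_ge_2_nat)
      hence "real p powr - s < 1" using s powr_less_one[of "real p" "- s"] by simp
      from three_four_one[OF _ this n1] show ?thesis by (simp add: n1)
    qed simp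
    hence "(\<Prod>p\<in>q P. ?t p) \<le> 1" by (intro prod_le_1) auto
    hence "(norm ?F0 ^ 3 * norm ?F1 ^ 4 * norm ?F2) * (\<Prod>p\<in>q P. ?t p) \<le> (norm ?F0 ^ 3 * norm ?F1 ^ 4 * norm ?F2) * 1"
      by (intro mult_left_mono) auto
    moreover have "norm (A0 P) ^ 3 * norm (A1 P) ^ 4 * norm (A2 P) =
      (norm ?F0 ^ 3 * norm ?F1 ^ 4 * norm ?F2) * (\<Prod>p\<in>q P. ?t p)"
      unfolding A0_def A1_def A2_def norm_mult prod_norm[symmetric] prod.distrib prod_power_distrib power_mult_distrib
      by (simp only: mult_ac)
    ultimately show ?thesis by simp
  qed
  show ?thesis using LIMSEQ_le_const2[OF lim] le by auto
qed

end

section \<open>Bounds as s decreases to 1, and complex characters\<close>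

lemma powr_difference_bounds:
  fixes m :: nat and \<delta> :: real
  assumes "0 < \<delta>"
  shows "real (Suc (Suc m)) powr - (1 + \<delta>) \<le>
    (real (Suc m) powr - \<delta> - real (Suc (Suc m)) powr - \<delta>) / \<delta>"
proof -
  have "\<exists>z. real (Suc m) < z \<and> z < real (Suc (Suc m)) \<and>
     real (Suc (Suc m)) powr - \<delta> - real (Suc m) powr - \<delta> =
     (real (Suc (Suc m)) - real (Suc m)) * (- \<delta> * z powr (- \<delta> - 1))"
    by (rule MVT2) (auto intro!: derivative_eq_intros)
  then obtain z where z: "real (Suc m) < z" "z < real (Suc (Suc m))"
    "real (Suc (Suc m)) powr - \<delta> - real (Suc m) powr - \<delta> = - \<delta> * z powr (- \<delta> - 1)"
    by auto
  have "real (Suc (Suc m)) powr (- \<delta> - 1) \<le> z powr (- \<delta> - 1)"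
    using z assms by (intro powr_mono2') auto
  moreover have "z powr (- \<delta> - 1) = (real (Suc m) powr - \<delta> - real (Suc (Suc m)) powr - \<delta>) / \<delta>"
    using z(3) assms by (simp add: field_simps)
  moreover have "- \<delta> - 1 = - (1 + \<delta>)" by simp
  ultimately show ?thesis by simp
qed

text \<open>Integral comparison in telescoping form. The summand 1 is the term \<open>m = 1\<close>;
  the term \<open>m = 0\<close> is 0.\<close>

lemma zeta_bound:
  fixes \<delta> :: real
  assumes d: "0 < \<delta>"
  shows "(\<Sum>m. real m powr - (1 + \<delta>)) \<le> 1 + 1 / \<delta>"
proof -
  let ?f = "\<lambda>m. real m powr - (1 + \<delta>)"
  have sm: "summable ?f" using d by (simp add: summable_real_powr_iff)
  have "(\<lambda>m. real (Suc m) powr - \<delta>) \<longlonglongrightarrow> 0"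
    using d by (intro LIMSEQ_Suc tendsto_neg_powr filterlim_real_sequentially) auto
  from telescope_sums'[OF this]
  have t: "(\<lambda>m. (real (Suc m) powr - \<delta> - real (Suc (Suc m)) powr - \<delta>) / \<delta>) sums (1 / \<delta>)"
    by (intro sums_divide) simp
  have "(\<Sum>m. ?f (m + 2)) \<le> 1 / \<delta>"
    using powr_difference_bounds[OF d] t summable_ignore_initial_segment[OF sm, of 2]
    by (subst sums_unique[OF t]) (intro suminf_le sums_summable[OF t], auto)
  moreover have "suminf ?f = (\<Sum>m. ?f (m + 2)) + (\<Sum>m<2. ?f m)"
    by (rule suminf_split_initial_segment[OF sm])
  ultimately show ?thesis by (simp add: numeral_2_eq_2)
qed

text \<open>The gain is a factor \<open>\<delta>\<close> against a summable weight. By the mean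
  value theorem the difference is, up to sign,
  \<open>(1 - (1 + \<delta>) * z powr - \<delta>) / z ^ 2\<close>. Here \<open>1 - z powr - \<delta>
  \<le> \<delta> * ln z \<le> 2 * \<delta> * z powr (1/2)\<close>, and the remaining
  \<open>\<delta> * z powr - \<delta>\<close> is at most \<open>\<delta> * z powr (1/2)\<close>:
  hence the constant 3 and the exponent \<open>2 - 1/2\<close>.\<close>

lemma harmonic_powr_variation:
  fixes m :: nat and \<delta> :: real
  assumes d: "0 < \<delta>" 
  defines "b \<equiv> \<lambda>n. real (Suc n) powr - (1 + \<delta>) - 1 / real (Suc n)"
  shows "\<bar>b m - b (Suc m)\<bar> \<le> 3 * \<delta> * real (Suc m) powr - (3/2)"
proof -
  let ?g = "\<lambda>x::real. x powr - (1 + \<delta>) - 1 / x"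
  let ?g' = "\<lambda>x::real. - (1 + \<delta>) * x powr (- (1 + \<delta>) - 1) + 1 / x ^ 2"
  have "\<exists>z. real (Suc m) < z \<and> z < real (Suc (Suc m)) \<and>
     ?g (real (Suc (Suc m))) - ?g (real (Suc m)) = (real (Suc (Suc m)) - real (Suc m)) * ?g' z"
    by (rule MVT2) (auto intro!: derivative_eq_intros simp: power2_eq_square)
  then obtain z where z: "real (Suc m) < z" and eq: "b (Suc m) - b m = ?g' z"
    unfolding b_def by auto
  have z1: "z > 1" using z by simp
  have "?g' z = (1 - (1 + \<delta>) * z powr - \<delta>) / z ^ 2"
  proof -
    have "z powr (- (1 + \<delta>) - 1) = z powr - \<delta> / z ^ 2"
    proof -
      have "- (1 + \<delta>) - 1 = - \<delta> - 2" by simp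
      thus ?thesis using z1 by (simp only: powr_diff) simp
    qed
    thus ?thesis by (simp add: algebra_simps add_divide_distrib diff_divide_distrib)
  qed
  moreover have "\<bar>1 - (1 + \<delta>) * z powr - \<delta>\<bar> \<le> 3 * \<delta> * z powr (1/2)"
  proof -
    have le1: "z powr - \<delta> \<le> 1" using z1 d powr_mono[of "- \<delta>" 0 z] by simp
    have ge1: "1 \<le> z powr (1/2)" using z1 by (simp add: ge_one_powr_ge_zero)
    have "ln z = 2 * ln (z powr (1/2))" using z1 by (simp add: ln_powr)
    also have "ln (z powr (1/2)) \<le> z powr (1/2) - 1" using z1 by (intro ln_le_minus_one) simp
    finally have "ln z \<le> 2 * z powr (1/2)" by simp
    moreover have "1 - \<delta> * ln z \<le> z powr - \<delta>"
      using z1 exp_ge_add_one_self[of "- \<delta> * ln z"] by (simp add: powr_def)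
    ultimately have "1 - z powr - \<delta> \<le> \<delta> * (2 * z powr (1/2))"
      using d by (smt (verit) mult_left_mono)
    moreover have "\<delta> * z powr - \<delta> \<le> \<delta> * z powr (1/2)" using d le1 ge1 by (intro mult_left_mono) auto
    moreover have "\<delta> * z powr - \<delta> \<ge> 0" using d by simp
    moreover have "\<delta> * z powr (1/2) \<ge> 0" using d by simp
    ultimately show ?thesis unfolding abs_le_iff using le1
      by (simp add: algebra_simps)
  qed
  ultimately have "\<bar>?g' z\<bar> \<le> 3 * \<delta> * z powr (1/2) / z ^ 2"
    by (simp add: abs_divide divide_right_mono)
  also have "z powr (1/2) / z ^ 2 = z powr - (3/2)"
    using z1 powr_diff[of z "1/2" 2] by simp
  hence "3 * \<delta> * z powr (1/2) / z ^ 2 = 3 * \<delta> * z powr - (3/2)" by (simp only: times_divide_eq_right[symmetric])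
  also have "\<dots> \<le> 3 * \<delta> * real (Suc m) powr - (3/2)"
    using z d by (intro mult_left_mono powr_mono2') auto
  finally show ?thesis using eq by (simp add: abs_minus_commute)
qed

context nontrivial_dirichlet_character
begin

lemma dirichlet_series_Suc:
  assumes "s > 1"
  shows "(\<lambda>m. \<psi> (Suc m) * of_real (real (Suc m) powr - s)) sums (\<Sum>m. dirichlet_term s m)"
proof -
  have "(\<lambda>m. dirichlet_term s m) sums (\<Sum>m. dirichlet_term s m)"
    by (rule summable_sums[OF summable_norm_cancel[OF summable_dirichlet_term[OF assms]]])
  thus ?thesis using sums_Suc_iff[of "\<lambda>m. dirichlet_term s m" "\<Sum>m. dirichlet_term s m"] by simp
qed

text \<open>The point is uniformity down to \<open>s = 1\<close>; absolute convergence alone gives a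
  bound that blows up there.\<close>

lemma dirichlet_series_bounded:
  assumes s: "s > 1"
  shows "norm (\<Sum>m. dirichlet_term s m) \<le> N"
proof -
  have "norm (\<Sum>m. \<psi> (Suc m) * of_real (real (Suc m) powr - s)) \<le> real N * real (Suc 0) powr - s"
  proof (rule Dirichlet_test_decseq(2)[OF sum_bounded])
    show "(\<lambda>m. real (Suc m) powr - s) \<longlonglongrightarrow> 0"
      using s by (intro LIMSEQ_Suc tendsto_neg_powr filterlim_real_sequentially) auto
    show "decseq (\<lambda>m. real (Suc m) powr - s)"
      using s by (intro decseq_SucI powr_mono2') auto
  qed
  thus ?thesis using sums_unique[OF dirichlet_series_Suc[OF s]] by simp
qed

text \<open>Quantifies the zero at 1 without differentiating the series: subtracting the vanishing
  sum of \<open>\<psi> m / m\<close> replaces the weights by differences of total variation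
  \<open>O(\<delta>)\<close>.\<close>

lemma dirichlet_series_small:
  assumes zero: "(\<lambda>m. \<psi> (Suc m) / of_nat (Suc m)) sums 0" and d: "\<delta> > 0"
  shows "norm (\<Sum>m. dirichlet_term (1 + \<delta>) m) \<le>
    real N * (\<Sum>m. 3 * real (Suc m) powr - (3/2)) * \<delta>"
proof -
  let ?b = "\<lambda>n. real (Suc n) powr - (1 + \<delta>) - 1 / real (Suc n)"
  have sm: "summable (\<lambda>m. real (Suc m) powr - (3/2))"
    by (subst summable_Suc_iff) (simp add: summable_real_powr_iff)
  have sm3: "summable (\<lambda>m. 3 * \<delta> * real (Suc m) powr - (3/2))" by (intro summable_mult sm)
  have var: "summable (\<lambda>m. \<bar>?b m - ?b (Suc m)\<bar>)"
    using harmonic_powr_variation[OF d] by (intro summable_comparison_test'[OF sm3, of 0]) auto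
  have "(\<lambda>m. real (Suc m) powr - (1 + \<delta>)) \<longlonglongrightarrow> 0"
    using d by (intro LIMSEQ_Suc tendsto_neg_powr filterlim_real_sequentially) auto
  moreover have "(\<lambda>m. 1 / real (Suc m)) \<longlonglongrightarrow> 0"
    by (rule inverse_Suc_tendsto_0)
  ultimately have lim: "?b \<longlonglongrightarrow> 0" using tendsto_diff by fastforce
  have "(\<lambda>m. \<psi> (Suc m) * of_real (real (Suc m) powr - (1 + \<delta>)) - \<psi> (Suc m) / of_nat (Suc m))
    sums ((\<Sum>m. dirichlet_term (1 + \<delta>) m) - 0)"
    by (intro sums_diff zero dirichlet_series_Suc) (use d in simp)
  moreover have "\<psi> (Suc m) * of_real (real (Suc m) powr - (1 + \<delta>)) - \<psi> (Suc m) / of_nat (Suc m)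
      = \<psi> (Suc m) * of_real (?b m)" for m
    by (simp only: of_real_diff of_real_divide of_real_1 of_real_of_nat_eq right_diff_distrib
      times_divide_eq_right mult_1_right)
  ultimately have "(\<Sum>m. dirichlet_term (1 + \<delta>) m) = (\<Sum>m. \<psi> (Suc m) * of_real (?b m))"
    by (simp only: sums_iff diff_zero)
  hence "norm (\<Sum>m. dirichlet_term (1 + \<delta>) m) \<le> real N * (\<Sum>m. \<bar>?b m - ?b (Suc m)\<bar>)"
    using Dirichlet_test(2)[OF sum_bounded lim var] by (simp only:)
  moreover have "(\<Sum>m. \<bar>?b m - ?b (Suc m)\<bar>) \<le> (\<Sum>m. 3 * \<delta> * real (Suc m) powr - (3/2))"
    using harmonic_powr_variation[OF d] by (intro suminf_le var sm3)
  hence "real N * (\<Sum>m. \<bar>?b m - ?b (Suc m)\<bar>) \<le> real N * (\<Sum>m. 3 * \<delta> * real (Suc m) powr - (3/2))"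
    by (rule mult_left_mono) simp
  moreover have "(\<Sum>m. 3 * \<delta> * real (Suc m) powr - (3/2)) = (\<Sum>m. \<delta> * (3 * real (Suc m) powr - (3/2)))"
    by (simp only: mult_ac)
  moreover have "\<dots> = \<delta> * (\<Sum>m. 3 * real (Suc m) powr - (3/2))" by (intro suminf_mult summable_mult sm)
  ultimately show ?thesis by (simp only: mult_ac)
qed

text \<open>A zero at 1 enters the 3-4-1 product with exponent 4, against the pole of the principal
  series with exponent 3, so the product would be \<open>O(\<delta>)\<close> although it is at least
  1. The assumption makes the square of \<open>\<psi>\<close> nontrivial, so the third series stays
  bounded.\<close>

lemma nonvanishing_complex:
  assumes sq: "\<exists>j. coprime j N \<and> \<psi> j ^ 2 \<noteq> 1"
  shows "\<not> (\<lambda>m. \<psi> (Suc m) / of_nat (Suc m)) sums 0"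
proof
  assume zero: "(\<lambda>m. \<psi> (Suc m) / of_nat (Suc m)) sums 0"
  define C where "C = real N * (\<Sum>m. 3 * real (Suc m) powr - (3/2))"
  interpret c0: dirichlet_character N "\<lambda>m. of_real (norm (\<psi> m))" by (rule trivial_character)
  interpret c2: nontrivial_dirichlet_character N "\<lambda>m. \<psi> m ^ 2"
    using sq by (intro nontrivial_dirichlet_character.intro power_character
      nontrivial_dirichlet_character_axioms.intro) auto
  have main: "1 \<le> 8 * C ^ 4 * real N * \<delta>" if d: "0 < \<delta>" "\<delta> \<le> 1" for \<delta>
  proof -
    have s: "1 + \<delta> > 1" using d by simp
    let ?F0 = "\<Sum>m. c0.dirichlet_term (1 + \<delta>) m"
    have "norm ?F0 \<le> (\<Sum>m. norm (c0.dirichlet_term (1 + \<delta>) m))"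
      by (rule summable_norm[OF c0.summable_dirichlet_term[OF s]])
    also have "\<dots> \<le> (\<Sum>m. real m powr - (1 + \<delta>))"
      using s by (intro suminf_le c0.norm_dirichlet_term_le c0.summable_dirichlet_term) (auto simp: summable_real_powr_iff)
    also have "\<dots> \<le> 1 + 1 / \<delta>" by (rule zeta_bound[OF d(1)])
    also have "\<dots> \<le> 2 / \<delta>" using d by (simp add: field_simps)
    finally have F0: "norm ?F0 \<le> 2 / \<delta>" .
    have F1: "norm (\<Sum>m. dirichlet_term (1 + \<delta>) m) \<le> C * \<delta>"
      unfolding C_def by (rule dirichlet_series_small[OF zero d(1)])
    have F2: "norm (\<Sum>m. c2.dirichlet_term (1 + \<delta>) m) \<le> N"
      by (rule c2.dirichlet_series_bounded[OF s])
    have C0: "0 \<le> C" using order_trans[OF norm_ge_zero F1] d by (simp add: zero_le_mult_iff)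
    have "1 \<le> norm ?F0 ^ 3 * norm (\<Sum>m. dirichlet_term (1 + \<delta>) m) ^ 4 *
        norm (\<Sum>m. c2.dirichlet_term (1 + \<delta>) m)"
      by (rule three_four_one_dirichlet[OF s])
    also have "\<dots> \<le> (2 / \<delta>) ^ 3 * (C * \<delta>) ^ 4 * N"
      using d C0
      by (intro mult_mono power_mono F0 F1 F2 mult_nonneg_nonneg zero_le_power) auto
    also have "\<dots> = 8 * C ^ 4 * real N * \<delta>"
      using d by (simp add: field_simps power_numeral_reduce)
    finally show ?thesis .
  qed
  have "((\<lambda>\<delta>. 8 * C ^ 4 * real N * \<delta>) \<longlongrightarrow> 8 * C ^ 4 * real N * 0) (at_right 0)"
    by (intro tendsto_intros)
  moreover have "\<forall>\<^sub>F \<delta> in at_right 0. 1 \<le> 8 * C ^ 4 * real N * \<delta>"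
    using eventually_at_right_real[OF zero_less_one]
    by eventually_elim (auto intro: main)
  ultimately have "1 \<le> 8 * C ^ 4 * real N * 0"
    by (intro tendsto_lowerbound) auto
  thus False by simp
qed

end

section \<open>Lambert series and real characters\<close>

lemma geometric_mean_le_sum_powers:
  fixes y :: real
  assumes "y > 0"
  shows "real n * y ^ (n - 1) \<le> (\<Sum>i<n. (y ^ 2) ^ i)"
proof -
  \<comment> \<open>Pair the exponent \<open>i\<close> with \<open>n - 1 - i\<close> and use the
    inequality of arithmetic and geometric means in each pair.\<close>
  have "2 * (\<Sum>i<n. (y ^ 2) ^ i) = (\<Sum>i<n. (y ^ 2) ^ i) + (\<Sum>i<n. (y ^ 2) ^ (n - Suc i))"
    by (simp only: sum.nat_diff_reindex[of "\<lambda>i. (y ^ 2) ^ i"] mult_2)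
  also have "\<dots> = (\<Sum>i<n. (y ^ 2) ^ i + (y ^ 2) ^ (n - Suc i))" by (rule sum.distrib[symmetric])
  also have "\<dots> \<ge> (\<Sum>i<n. 2 * y ^ (n - 1))"
  proof (rule sum_mono)
    fix i assume "i \<in> {..<n}"
    hence "n - 1 = i + (n - Suc i)" by auto
    hence "y ^ (n - 1) = y ^ i * y ^ (n - Suc i)" by (metis power_add)
    moreover have "2 * (y ^ i * y ^ (n - Suc i)) \<le> (y ^ i) ^ 2 + (y ^ (n - Suc i)) ^ 2"
      using sum_squares_bound[of "y ^ i" "y ^ (n - Suc i)"] by simp
    ultimately show "2 * y ^ (n - 1) \<le> (y ^ 2) ^ i + (y ^ 2) ^ (n - Suc i)"
      by (simp only: power_mult[symmetric] mult.commute[of 2])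
  qed
  finally show ?thesis by simp
qed

text \<open>
  Monsky's argument for real \<open>\<psi>\<close>: if \<open>L(1, \<psi>) = 0\<close>, monotonicity of this kernel bounds
  \<open>\<Sum> \<psi> n x\<^sup>n / (1 - x\<^sup>n)\<close> as \<open>x \<rightarrow> 1\<close>, but its coefficients are divisor sums of \<open>\<psi>\<close>.
\<close>

lemma lambert_kernel_antimono:
  fixes x :: real
  assumes x: "0 < x" "x < 1" and n: "n > 0"
  shows "1 / (real (Suc n) * (1 - x)) - x ^ Suc n / (1 - x ^ Suc n) \<le>
         1 / (real n * (1 - x)) - x ^ n / (1 - x ^ n)"
proof -
  \<comment> \<open>The square root turns the half-integral exponent \<open>(n - 1) / 2\<close> of
    \<open>x\<close> in the lower bound for \<open>s n\<close> into an integral one.\<close>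
  define y where "y = sqrt x"
  have y: "y > 0" "y < 1" "x = y ^ 2" using x by (auto simp: y_def)
  define s where "s n = (\<Sum>i<n. x ^ i)" for n
  have s: "1 - x ^ n = (1 - x) * s n" for n unfolding s_def by (rule one_diff_power_eq)
  have s_ge: "real n * y ^ (n - 1) \<le> s n" for n
    unfolding s_def y(3) by (rule geometric_mean_le_sum_powers[OF y(1)])
  have s_pos: "s n > 0" "s (Suc n) > 0"
    using s_ge[of n] s_ge[of "Suc n"] n y
    by (smt (verit) mult_pos_pos of_nat_0_less_iff zero_less_power zero_less_Suc)+
  have sS: "s (Suc n) = 1 + x * s n"
    unfolding s_def sum.lessThan_Suc_shift by (simp add: sum_distrib_left)
  \<comment> \<open>After clearing denominators the claim is
    \<open>n * (n + 1) * x ^ n \<le> s n * s (Suc n)\<close>. The half exponents in the two lower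
    bounds add up to \<open>n - 1/2\<close>, which is below \<open>n\<close>, and
    \<open>x < 1\<close>.\<close>
  have "real n * real (Suc n) * x ^ n \<le> (real n * y ^ (n - 1)) * (real (Suc n) * y ^ n)"
  proof -
    have "x ^ n = y ^ (2 * n)" by (simp add: y(3) power_mult)
    also have "\<dots> \<le> y ^ (n - 1 + n)" using y n by (intro power_decreasing) auto
    finally show ?thesis by (simp add: power_add mult_ac mult_left_mono)
  qed
  also have "\<dots> \<le> s n * s (Suc n)"
    using s_ge[of n] s_ge[of "Suc n"] y s_pos by (intro mult_mono) auto
  finally have main: "real n * real (Suc n) * x ^ n \<le> s n * s (Suc n)" .
  have "x ^ n / s n - x ^ Suc n / s (Suc n) = x ^ n / (s n * s (Suc n))"
    using s_pos by (simp add: field_simps sS)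
  also have "\<dots> \<le> 1 / (real n * real (Suc n))"
    using main s_pos n by (simp add: divide_simps mult_ac)
  also have "\<dots> = 1 / real n - 1 / real (Suc n)" using n by (simp add: field_simps)
  finally have "(1 / real (Suc n) - x ^ Suc n / s (Suc n)) / (1 - x) \<le> (1 / real n - x ^ n / s n) / (1 - x)"
    using x by (intro divide_right_mono) auto
  thus ?thesis unfolding s by (simp only: diff_divide_distrib divide_divide_eq_left mult.commute)
qed

lemma summable_of_nat_mult_power:
  fixes x :: real
  assumes "norm x < 1"
  shows "summable (\<lambda>m. real m * x ^ m)"
proof -
  have "summable (\<lambda>m. of_nat (Suc m) * x ^ m * x)"
    by (intro summable_mult2 sums_summable[OF geometric_deriv_sums] assms)
  hence "summable (\<lambda>m. real (Suc m) * x ^ Suc m)" by (simp only: power_Suc2 mult.assoc)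
  thus ?thesis by (subst (asm) summable_Suc_iff)
qed

lemma divisor_sum_coprime:
  fixes h :: "nat \<Rightarrow> real"
  assumes mult: "\<And>m n. h (m * n) = h m * h n" and mn: "coprime m n"
  shows "(\<Sum>d | d dvd m * n. h d) = (\<Sum>d | d dvd m. h d) * (\<Sum>d | d dvd n. h d)"
proof -
  have "bij_betw (\<lambda>(a, b). a * b) ({d. d dvd m} \<times> {d. d dvd n}) {d. d dvd m * n}"
  proof (rule bij_betw_imageI)
    show "inj_on (\<lambda>(a, b). a * b) ({d. d dvd m} \<times> {d. d dvd n})"
    proof (intro inj_onI, clarify)
      fix a b a' b' assume *: "a dvd m" "b dvd n" "a' dvd m" "b' dvd n" "a * b = a' * b'"
      have cop: "coprime a b'" "coprime a' b" "coprime b a'" "coprime b' a"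
        using mn *(1-4) by (meson coprime_commute coprime_divisors)+
      have "a dvd a' * b'" "a' dvd a * b" "b dvd a' * b'" "b' dvd a * b"
        using *(5) by (metis dvd_triv_left dvd_triv_right)+
      hence "a dvd a'" "a' dvd a" "b dvd b'" "b' dvd b"
        using cop by (auto simp: coprime_dvd_mult_left_iff coprime_dvd_mult_right_iff)
      thus "a = a' \<and> b = b'" by (auto intro: dvd_antisym)
    qed
    show "(\<lambda>(a, b). a * b) ` ({d. d dvd m} \<times> {d. d dvd n}) = {d. d dvd m * n}"
      by (auto intro: mult_dvd_mono dest!: division_decomp)
  qed
  hence "(\<Sum>d | d dvd m * n. h d) = (\<Sum>(a, b)\<in>{d. d dvd m} \<times> {d. d dvd n}. h (a * b))"
    by (subst sum.reindex_bij_betw[symmetric]) (auto simp: case_prod_unfold)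
  thus ?thesis by (simp add: mult sum_product sum.cartesian_product)
qed

context
  fixes h :: "nat \<Rightarrow> real"
  assumes h_mult: "\<And>m n. h (m * n) = h m * h n" and h_1: "h 1 = 1"
    and h_range: "\<And>m. h m \<in> {-1, 0, 1}"
begin

text \<open>The sum is geometric in \<open>h p\<close>: it is \<open>a + 1\<close> for
  \<open>h p = 1\<close>, it is 1 for \<open>h p = 0\<close>, and it alternates between 1 and 0 for
  \<open>h p = -1\<close>.\<close>

lemma divisor_sum_prime_power:
  assumes "prime p"
  shows "(\<Sum>d | d dvd p ^ a. h d) \<ge> (if even a then 1 else 0)"
proof -
  have "inj_on (\<lambda>i. p ^ i) {..a}"
    using prime_gt_1_nat[OF assms] by (auto intro!: inj_onI)
  moreover have "{d. d dvd p ^ a} = (\<lambda>i. p ^ i) ` {..a}"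
    using divides_primepow_nat[OF assms] by auto
  moreover have "h (p ^ i) = h p ^ i" for i by (induction i) (use h_1 in \<open>simp_all add: h_mult\<close>)
  ultimately have "(\<Sum>d | d dvd p ^ a. h d) = (\<Sum>i\<le>a. h p ^ i)"
    by (simp add: sum.reindex)
  also have "(\<Sum>i\<le>a. h p ^ i) \<ge> (if even a then 1 else 0)"
  proof -
    consider "h p = -1" | "h p = 0" | "h p = 1" using h_range[of p] by auto
    thus ?thesis
    proof cases
      case 1
      have "(\<Sum>i\<le>a. (-1::real) ^ i) = (if even a then 1 else 0)" by (induction a) auto
      thus ?thesis using 1 by simp
    next
      case 2
      have "(\<Sum>i\<le>a. (0::real) ^ i) = 1" by (induction a) auto
      thus ?thesis using 2 by simp
    qed auto
  qed
  finally show ?thesis .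
qed

lemma divisor_sum_nonneg:
  assumes "m > 0"
  shows "(\<Sum>d | d dvd m. h d) \<ge> 0"
  using assms
proof (induction m rule: less_induct)
  case (less m)
  show ?case
  proof (cases "m = 1")
    case False
    then obtain p where p: "prime p" "p dvd m" by (metis prime_factor_nat)
    have pu: "m \<noteq> 0" "\<not> is_unit p" using less.prems p(1) by (auto simp: not_prime_unit)
    obtain k where k: "m = p ^ multiplicity p m * k" "\<not> p dvd k"
      by (rule multiplicity_decompose'[OF pu])
    define a where "a = multiplicity p m"
    have "a > 0" using p pu unfolding a_def by (simp add: prime_multiplicity_gt_zero_iff)
    have k0: "k > 0" using k less.prems by (cases k) auto
    have "p ^ a > 1" using prime_gt_1_nat[OF p(1)] \<open>a > 0\<close> by (rule one_less_power)
    hence "k < m" using k(1) k0 unfolding a_def[symmetric] by simp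
    have "coprime (p ^ a) k" using p(1) k(2) by (simp add: prime_imp_coprime_nat)
    hence "(\<Sum>d | d dvd m. h d) = (\<Sum>d | d dvd p ^ a. h d) * (\<Sum>d | d dvd k. h d)"
      using divisor_sum_coprime[OF h_mult] k(1) unfolding a_def[symmetric] by simp
    moreover have "(\<Sum>d | d dvd p ^ a. h d) \<ge> 0"
      using divisor_sum_prime_power[OF p(1), of a] by (auto split: if_splits)
    ultimately show ?thesis using less.IH[OF \<open>k < m\<close> k0] by simp
  qed (use h_1 in simp)
qed

text \<open>The powers \<open>4 ^ j\<close> with \<open>j < J\<close> contribute at least 1 each,
  being even powers of the prime 2, and no other \<open>m\<close> contributes negatively.\<close>

lemma divisor_sum_sum_unbounded: "(\<Sum>m=1..4 ^ J. \<Sum>d | d dvd m. h d) \<ge> real J"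
proof -
  have "1 \<le> (\<Sum>d | d dvd 2 ^ (2 * j). h d)" for j
    using divisor_sum_prime_power[OF two_is_prime_nat, of "2 * j"] by simp
  hence "(\<Sum>j<J. 1) \<le> (\<Sum>j<J. \<Sum>d | d dvd 2 ^ (2 * j). h d)" by (intro sum_mono)
  hence "real J \<le> (\<Sum>j<J. \<Sum>d | d dvd 2 ^ (2 * j). h d)" by simp
  also have "\<dots> = (\<Sum>m\<in>(\<lambda>j. 2 ^ (2 * j)) ` {..<J}. \<Sum>d | d dvd m. h d)"
    by (subst sum.reindex) (auto intro!: inj_onI)
  also have "\<dots> \<le> (\<Sum>m=1..4 ^ J. \<Sum>d | d dvd m. h d)"
  proof (rule sum_mono2)
    show "(\<lambda>j. 2 ^ (2 * j)) ` {..<J} \<subseteq> {1..4 ^ J :: nat}"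
      by (auto simp: power_mult intro!: power_increasing)
  qed (auto intro: divisor_sum_nonneg)
  finally show ?thesis .
qed

text \<open>Truncating in \<open>n\<close> leaves finitely many geometric series, so no double
  series is rearranged. The coefficient of \<open>x ^ m\<close> is the sum of \<open>h\<close> over
  the divisors of \<open>m\<close> up to \<open>T\<close>: complete for \<open>m \<le> T\<close>,
  and beyond that at most \<open>m\<close> in absolute value, which accounts for the subtracted
  tail.\<close>

lemma lambert_partial_sum:
  fixes x :: real
  assumes x: "0 < x" "x < 1" and KT: "K \<le> T"
  shows "(\<Sum>n=1..T. h n * (x ^ n / (1 - x ^ n))) \<ge>
    (\<Sum>m=1..K. (\<Sum>d | d dvd m. h d) * x ^ m) - (\<Sum>m. real (m + Suc T) * x ^ (m + Suc T))"
proof -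
  define cT where "cT m = (\<Sum>n=1..T. if n dvd m then h n else 0)" for m
  have xn: "(\<lambda>m. if n dvd m \<and> m > 0 then x ^ m else 0) sums (x ^ n / (1 - x ^ n))" if "n > 0" for n
  proof -
    have "x ^ n < 1" using x that by (simp add: power_less_one_iff)
    hence "(\<lambda>j. x ^ n * (x ^ n) ^ j) sums (x ^ n * (1 / (1 - x ^ n)))"
      using x by (intro sums_mult geometric_sums) simp
    hence "(\<lambda>j. (\<lambda>m. if n dvd m \<and> m > 0 then x ^ m else 0) (n * Suc j)) sums (x ^ n / (1 - x ^ n))"
      using that by (simp add: power_mult power_add)
    moreover have "strict_mono (\<lambda>j. n * Suc j)" using that by (auto intro!: strict_monoI)
    moreover have "(\<lambda>m. if n dvd m \<and> m > 0 then x ^ m else 0) m = 0" if "m \<notin> range (\<lambda>j. n * Suc j)" for m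
    proof -
      { assume "n dvd m" "m > 0"
        then obtain k where "m = n * k" "k > 0" by (auto elim: dvdE)
        hence "m = n * Suc (k - 1)" by simp
        hence "m \<in> range (\<lambda>j. n * Suc j)" by blast }
      with that show ?thesis by auto
    qed
    ultimately show ?thesis by (subst (asm) sums_mono_reindex) auto
  qed
  have "(\<lambda>m. \<Sum>n=1..T. h n * (if n dvd m \<and> m > 0 then x ^ m else 0)) sums
      (\<Sum>n=1..T. h n * (x ^ n / (1 - x ^ n)))"
    by (intro sums_sum sums_mult xn) auto
  moreover have "(\<Sum>n=1..T. h n * (if n dvd m \<and> m > 0 then x ^ m else 0)) =
      (if m > 0 then cT m * x ^ m else 0)" for m
    unfolding cT_def by (auto simp: sum_distrib_right intro!: sum.cong)
  ultimately have sums: "(\<lambda>m. if m > 0 then cT m * x ^ m else 0) sums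
      (\<Sum>n=1..T. h n * (x ^ n / (1 - x ^ n)))" by simp
  have cT_abs: "\<bar>cT m\<bar> \<le> real m" if "m > 0" for m
  proof -
    have "cT m = (\<Sum>n | n \<in> {1..T} \<and> n dvd m. h n)"
      unfolding cT_def by (intro sum.inter_filter[symmetric]) simp
    also have "\<bar>\<dots>\<bar> \<le> (\<Sum>n | n \<in> {1..T} \<and> n dvd m. 1)"
    proof (rule order_trans[OF sum_abs sum_mono])
      fix n show "\<bar>h n\<bar> \<le> 1" using h_range[of n] by auto
    qed
    also have "\<dots> = real (card {n. n \<in> {1..T} \<and> n dvd m})" by simp
    also have "card {n. n \<in> {1..T} \<and> n dvd m} \<le> card {1..m}"
      using that by (intro card_mono) (auto dest: dvd_imp_le)
    finally show ?thesis by simp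
  qed
  have cT_eq: "cT m = (\<Sum>d | d dvd m. h d)" if "0 < m" "m \<le> T" for m
  proof -
    have "cT m = (\<Sum>n | n \<in> {1..T} \<and> n dvd m. h n)"
      unfolding cT_def by (intro sum.inter_filter[symmetric]) simp
    also have "{n. n \<in> {1..T} \<and> n dvd m} = {d. d dvd m}"
    proof -
      have "1 \<le> d \<and> d \<le> T" if "d dvd m" for d
        using dvd_pos_nat[OF \<open>0 < m\<close> that] dvd_imp_le[OF that \<open>0 < m\<close>] \<open>m \<le> T\<close> by simp
      thus ?thesis by auto
    qed
    finally show ?thesis .
  qed
  let ?g = "\<lambda>m. if m > 0 then cT m * x ^ m else 0"
  have smx: "summable (\<lambda>m. real m * x ^ m)"
    using x by (intro summable_of_nat_mult_power) auto
  hence smt: "summable (\<lambda>m. real (m + Suc T) * x ^ (m + Suc T))"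
    by (rule summable_ignore_initial_segment)
  have smg: "summable ?g" by (rule sums_summable[OF sums])
  have "(\<Sum>n=1..T. h n * (x ^ n / (1 - x ^ n))) = suminf ?g" by (rule sums_unique[OF sums])
  also have "\<dots> = (\<Sum>m. ?g (m + Suc T)) + (\<Sum>m<Suc T. ?g m)"
    by (rule suminf_split_initial_segment[OF smg])
  also have "(\<Sum>m<Suc T. ?g m) = (\<Sum>m=1..T. (\<Sum>d | d dvd m. h d) * x ^ m)"
    using cT_eq by (intro sum.mono_neutral_cong_right) auto
  also have "\<dots> \<ge> (\<Sum>m=1..K. (\<Sum>d | d dvd m. h d) * x ^ m)"
    using KT x by (intro sum_mono2) (auto intro!: mult_nonneg_nonneg divisor_sum_nonneg)
  moreover have "(\<Sum>m. ?g (m + Suc T)) \<ge> (\<Sum>m. - (real (m + Suc T) * x ^ (m + Suc T)))"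
  proof (rule suminf_le)
    show "- (real (m + Suc T) * x ^ (m + Suc T)) \<le> ?g (m + Suc T)" for m
    proof -
      have "- real (m + Suc T) \<le> cT (m + Suc T)" using cT_abs[of "m + Suc T"] by linarith
      hence "- real (m + Suc T) * x ^ (m + Suc T) \<le> cT (m + Suc T) * x ^ (m + Suc T)"
        by (rule mult_right_mono) (use x in simp)
      thus ?thesis by (simp only: mult_minus_left zero_less_Suc add_Suc_right if_True)
    qed
  qed (intro summable_minus smt summable_ignore_initial_segment[OF smg])+
  moreover have "(\<Sum>m. - (real (m + Suc T) * x ^ (m + Suc T))) = - (\<Sum>m. real (m + Suc T) * x ^ (m + Suc T))"
    by (rule suminf_minus[OF smt])
  ultimately show ?thesis by linarith
qed

lemma lambert_divisor_sum_le:
  fixes x :: real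
  assumes x: "0 < x" "x < 1" and sums: "(\<lambda>n. h (Suc n) * (x ^ Suc n / (1 - x ^ Suc n))) sums L"
  shows "(\<Sum>m=1..K. (\<Sum>d | d dvd m. h d) * x ^ m) \<le> L"
proof -
  let ?S = "\<Sum>m=1..K. (\<Sum>d | d dvd m. h d) * x ^ m"
  have "summable (\<lambda>m. real m * x ^ m)"
    using x by (intro summable_of_nat_mult_power) auto
  from LIMSEQ_Suc[OF suminf_exist_split2[OF this]]
  have tail: "(\<lambda>T. ?S - (\<Sum>m. real (m + Suc T) * x ^ (m + Suc T))) \<longlonglongrightarrow> ?S - 0"
    by (intro tendsto_diff tendsto_const)
  have "(\<lambda>T. \<Sum>n=1..T. h n * (x ^ n / (1 - x ^ n))) \<longlonglongrightarrow> L"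
    using sums by (simp add: sums_def sum.atLeast1_atMost_eq)
  from LIMSEQ_le[OF tail this] show ?thesis
    using lambert_partial_sum[OF x] by (auto intro!: exI[of _ K])
qed

end

context nontrivial_dirichlet_character
begin

text \<open>The bound \<open>N\<close> is independent of \<open>x\<close> and \<open>K\<close>, so
  it survives the limit at 1 and contradicts the growth of the divisor sums at
  \<open>K = 4 ^ Suc N\<close>.\<close>

lemma nonvanishing_real:
  assumes sq: "\<And>j. coprime j N \<Longrightarrow> \<psi> j ^ 2 = 1"
  shows "\<not> (\<lambda>m. \<psi> (Suc m) / of_nat (Suc m)) sums 0"
proof
  assume zero: "(\<lambda>m. \<psi> (Suc m) / of_nat (Suc m)) sums 0"
  define h where "h m = Re (\<psi> m)" for m
  have cases: "\<psi> m = 1 \<or> \<psi> m = -1 \<or> \<psi> m = 0" for m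
    using sq[of m] nonzero_iff[of m] by (auto simp: power2_eq_1_iff)
  have psi: "\<psi> m = of_real (h m)" and h_range: "h m \<in> {-1, 0, 1}" for m
    using cases[of m] by (auto simp: h_def)
  have h_mult: "h (m * n) = h m * h n" for m n
    using mult[of m n] unfolding psi by (simp only: of_real_mult[symmetric] of_real_eq_iff)
  have h_1: "h 1 = 1" by (simp add: h_def)
  have bound: "(\<Sum>m=1..K. (\<Sum>d | d dvd m. h d) * x ^ m) \<le> N" if x: "0 < x" "x < 1" for x :: real and K
  proof -
    define b where "b n = 1 / (real (Suc n) * (1 - x)) - x ^ Suc n / (1 - x ^ Suc n)" for n
    have "decseq b" unfolding b_def by (intro decseq_SucI lambert_kernel_antimono x) simp
    have b_eq: "b = (\<lambda>n. 1 / real (Suc n) * (1 / (1 - x)) - x ^ Suc n / (1 - x ^ Suc n))"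
      by (rule ext) (simp add: b_def)
    have h1: "(\<lambda>m. 1 / real (Suc m)) \<longlonglongrightarrow> 0"
      by (rule inverse_Suc_tendsto_0)
    have h2: "(\<lambda>m. x ^ Suc m) \<longlonglongrightarrow> 0"
      by (rule LIMSEQ_Suc[OF LIMSEQ_realpow_zero]) (use x in auto)
    have "b \<longlonglongrightarrow> 0 * (1 / (1 - x)) - 0 / (1 - 0)"
      unfolding b_eq by (rule tendsto_diff[OF tendsto_mult[OF h1 tendsto_const]
        tendsto_divide[OF h2 tendsto_diff[OF tendsto_const h2]]]) simp
    hence lim: "b \<longlonglongrightarrow> 0" by (simp only: mult_zero_left diff_zero div_by_1)
    define B where "B = (\<Sum>m. \<psi> (Suc m) * of_real (b m))"
    have sB: "(\<lambda>m. \<psi> (Suc m) * of_real (b m)) sums B"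
      unfolding B_def by (intro summable_sums Dirichlet_test_decseq(1)[OF sum_bounded lim \<open>decseq b\<close>])
    have "b 0 = 1" using x by (simp add: b_def diff_divide_distrib[symmetric])
    hence nB: "norm B \<le> N"
      unfolding B_def using Dirichlet_test_decseq(2)[OF sum_bounded lim \<open>decseq b\<close>] by simp
    \<comment> \<open>If the series at 1 vanishes, the part \<open>1 / (n * (1 - x))\<close> of the
      kernel sums to 0 against \<open>\<psi>\<close>; hence \<open>- B\<close> is the Lambert series
      itself.\<close>
    have "(\<lambda>m. of_real (1 / (1 - x)) * (\<psi> (Suc m) / of_nat (Suc m)) - \<psi> (Suc m) * of_real (b m))
        sums (of_real (1 / (1 - x)) * 0 - B)"
      by (intro sums_diff sums_mult zero sB)
    moreover have "of_real (1 / (1 - x)) * (\<psi> (Suc m) / of_nat (Suc m)) - \<psi> (Suc m) * of_real (b m)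
        = of_real (h (Suc m) * (x ^ Suc m / (1 - x ^ Suc m)))" for m
    proof -
      have "1 / (1 - x) * (h (Suc m) / real (Suc m)) - h (Suc m) * b m = h (Suc m) * (x ^ Suc m / (1 - x ^ Suc m))"
        unfolding b_eq right_diff_distrib by (simp only: divide_inverse mult_1_left mult_ac)
      moreover have "of_real (1 / (1 - x)) * (\<psi> (Suc m) / of_nat (Suc m)) - \<psi> (Suc m) * of_real (b m) =
          of_real (1 / (1 - x) * (h (Suc m) / real (Suc m)) - h (Suc m) * b m)"
        unfolding psi[of "Suc m"] by (simp only: of_real_diff of_real_mult of_real_divide of_real_of_nat_eq)
      ultimately show ?thesis by (simp only:)
    qed
    ultimately have "(\<lambda>m. complex_of_real (h (Suc m) * (x ^ Suc m / (1 - x ^ Suc m)))) sums (- B)"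
      by (simp only: mult_zero_right diff_0)
    from sums_Re[OF this] have "(\<lambda>m. h (Suc m) * (x ^ Suc m / (1 - x ^ Suc m))) sums Re (- B)"
      by (simp only: Re_complex_of_real)
    from lambert_divisor_sum_le[OF h_mult h_1 h_range x this]
    have "(\<Sum>m=1..K. (\<Sum>d | d dvd m. h d) * x ^ m) \<le> Re (- B)" .
    also have "\<dots> \<le> norm (- B)" by (rule complex_Re_le_cmod)
    finally show ?thesis using nB by simp
  qed
  let ?K = "4 ^ Suc N"
  have "((\<lambda>x. \<Sum>m=1..?K. (\<Sum>d | d dvd m. h d) * x ^ m) \<longlongrightarrow> (\<Sum>m=1..?K. (\<Sum>d | d dvd m. h d) * 1 ^ m)) (at_left (1::real))"
    by (intro tendsto_sum tendsto_mult tendsto_const tendsto_power tendsto_ident_at)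
  moreover have "\<forall>\<^sub>F x in at_left (1::real). (\<Sum>m=1..?K. (\<Sum>d | d dvd m. h d) * x ^ m) \<le> N"
    using eventually_at_left_real[OF zero_less_one] by eventually_elim (rule bound; simp)
  ultimately have "(\<Sum>m=1..?K. (\<Sum>d | d dvd m. h d) * 1 ^ m) \<le> N"
    by (intro tendsto_upperbound) auto
  moreover have "real (Suc N) \<le> (\<Sum>m=1..?K. \<Sum>d | d dvd m. h d)"
    by (rule divisor_sum_sum_unbounded[OF h_mult h_1 h_range])
  ultimately show False by simp
qed

theorem nonvanishing: "(\<Sum>m. \<psi> (Suc m) / of_nat (Suc m)) \<noteq> 0"
  using nonvanishing_real nonvanishing_complex summable_sums[OF summable_harmonic] by metis

end

section \<open>Alternating Abel sums\<close>

text \<open>The term \<open>m = 0\<close> is \<open>0\<close>, as \<open>x / 0 = 0\<close>.\<close>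

definition alternating_abel :: "(nat \<Rightarrow> complex) \<Rightarrow> real \<Rightarrow> complex" where
  "alternating_abel u r = (\<Sum>m. (-1) ^ Suc m * u m * of_real (r ^ m / real m))"

text \<open>Boundedness is included so that the series converges for \<open>0 < r < 1\<close>;
  otherwise the limit laws would involve unspecified values of \<open>suminf\<close>.\<close>

definition abel_limit :: "(nat \<Rightarrow> complex) \<Rightarrow> complex \<Rightarrow> bool" where
  "abel_limit u L \<longleftrightarrow> bounded (range u) \<and> (alternating_abel u \<longlongrightarrow> L) (at_left 1)"

lemma summable_power_over_n:
  fixes u :: "nat \<Rightarrow> complex"
  assumes "bounded (range u)" "0 < r" "r < 1"
  shows "summable (\<lambda>m. u m * of_real (r ^ m / real m))"
proof -
  from assms(1) obtain B where B: "\<And>m. norm (u m) \<le> B" unfolding bounded_iff by auto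
  have "B \<ge> 0" using B[of 0] norm_ge_zero order_trans by blast
  have le: "norm (u m * of_real (r ^ m / real m)) \<le> B * r ^ m" for m
  proof -
    have "r ^ m / real m \<le> r ^ m"
    proof (cases "m = 0")
      case False
      hence "r ^ m / real m \<le> r ^ m / 1" using assms by (intro divide_left_mono) auto
      thus ?thesis by simp
    qed simp
    hence "norm (u m) * (r ^ m / real m) \<le> B * r ^ m"
      using B assms \<open>B \<ge> 0\<close> by (intro mult_mono) auto
    moreover have "\<bar>r ^ m / real m\<bar> = r ^ m / real m" using assms by simp
    ultimately show ?thesis unfolding norm_mult norm_of_real by (simp only:)
  qed
  have "summable (\<lambda>m. B * r ^ m)" using assms by (intro summable_mult summable_geometric) auto
  thus ?thesis by (rule summable_comparison_test'[of _ 0]) (rule le)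
qed

lemma alternating_abel_sums:
  assumes "bounded (range u)" "0 < r" "r < 1"
  shows "(\<lambda>m. (-1) ^ Suc m * u m * of_real (r ^ m / real m)) sums alternating_abel u r"
proof -
  have "bounded (range (\<lambda>m. (-1) ^ Suc m * u m))"
    using assms(1) by (auto simp: bounded_iff norm_mult norm_power)
  from summable_sums[OF summable_power_over_n[OF this assms(2,3)]] show ?thesis
    by (simp only: alternating_abel_def)
qed

lemma eventually_unit_interval: "(\<And>r. 0 < r \<Longrightarrow> r < 1 \<Longrightarrow> P r) \<Longrightarrow> \<forall>\<^sub>F r::real in at_left 1. P r"
  using eventually_at_left_real[OF zero_less_one] by eventually_elim simp

lemma abel_limit_add:
  assumes "abel_limit u K" "abel_limit w L"
  shows "abel_limit (\<lambda>m. u m + w m) (K + L)"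
proof -
  have bd: "bounded (range u)" "bounded (range w)" using assms by (auto simp: abel_limit_def)
  then obtain B C where "\<And>x. x \<in> range u \<Longrightarrow> norm x \<le> B" "\<And>x. x \<in> range w \<Longrightarrow> norm x \<le> C"
    unfolding bounded_iff by blast
  hence "norm (u m) \<le> B" "norm (w m) \<le> C" for m by simp_all
  hence "norm (u m + w m) \<le> B + C" for m by (rule norm_triangle_mono)
  hence bd': "bounded (range (\<lambda>m. u m + w m))" by (intro boundedI[of _ "B + C"]) auto
  have "alternating_abel (\<lambda>m. u m + w m) r = alternating_abel u r + alternating_abel w r"
    if "0 < r" "r < 1" for r
  proof -
    have "(\<lambda>m. (-1) ^ Suc m * (u m + w m) * of_real (r ^ m / real m)) sums (alternating_abel u r + alternating_abel w r)"
      using sums_add[OF alternating_abel_sums[OF bd(1) that] alternating_abel_sums[OF bd(2) that]]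
      by (simp only: distrib_left distrib_right)
    with alternating_abel_sums[OF bd' that] show ?thesis by (rule sums_unique2)
  qed
  hence ev: "\<forall>\<^sub>F r in at_left 1. alternating_abel u r + alternating_abel w r = alternating_abel (\<lambda>m. u m + w m) r"
    by (intro eventually_unit_interval) simp
  have "((\<lambda>r. alternating_abel u r + alternating_abel w r) \<longlongrightarrow> K + L) (at_left 1)"
    using assms by (intro tendsto_add) (auto simp: abel_limit_def)
  from Lim_transform_eventually[OF this ev] show ?thesis using bd' by (simp only: abel_limit_def)
qed

lemma abel_limit_cmult:
  assumes "abel_limit u K"
  shows "abel_limit (\<lambda>m. c * u m) (c * K)"
proof -
  have bd: "bounded (range u)" using assms by (auto simp: abel_limit_def)
  have bd': "bounded (range (\<lambda>m. c * u m))"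
  proof -
    from bd obtain B where "\<And>x. x \<in> range u \<Longrightarrow> norm x \<le> B" unfolding bounded_iff by blast
    hence "norm (u m) \<le> B" for m by simp
    hence "norm (c * u m) \<le> norm c * B" for m by (simp add: norm_mult mult_left_mono)
    thus ?thesis by (intro boundedI[of _ "norm c * B"]) auto
  qed
  have "alternating_abel (\<lambda>m. c * u m) r = c * alternating_abel u r" if "0 < r" "r < 1" for r
  proof -
    have "c * ((-1) ^ Suc m * u m * of_real (r ^ m / real m)) = (-1) ^ Suc m * (c * u m) * of_real (r ^ m / real m)" for m
      by (simp only: mult_ac)
    with sums_mult[OF alternating_abel_sums[OF bd that], of c]
    have "(\<lambda>m. (-1) ^ Suc m * (c * u m) * of_real (r ^ m / real m)) sums (c * alternating_abel u r)"
      by (simp only:)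
    with alternating_abel_sums[OF bd' that] show ?thesis by (rule sums_unique2)
  qed
  hence ev: "\<forall>\<^sub>F r in at_left 1. c * alternating_abel u r = alternating_abel (\<lambda>m. c * u m) r"
    by (intro eventually_unit_interval) simp
  have "((\<lambda>r. c * alternating_abel u r) \<longlongrightarrow> c * K) (at_left 1)"
    using assms by (intro tendsto_mult tendsto_const) (auto simp: abel_limit_def)
  from Lim_transform_eventually[OF this ev] show ?thesis using bd' by (simp only: abel_limit_def)
qed

lemma abel_limit_diff:
  "abel_limit u K \<Longrightarrow> abel_limit w L \<Longrightarrow> abel_limit (\<lambda>m. u m - w m) (K - L)"
  using abel_limit_add[of u K "\<lambda>m. - 1 * w m" "- 1 * L"] abel_limit_cmult[of w L "-1"] by simp

lemma abel_limit_zero: "abel_limit (\<lambda>_. 0) 0"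
  unfolding abel_limit_def alternating_abel_def by auto

lemma abel_limit_sum:
  "finite I \<Longrightarrow> (\<And>i. i \<in> I \<Longrightarrow> abel_limit (u i) (K i)) \<Longrightarrow>
    abel_limit (\<lambda>m. \<Sum>i\<in>I. u i m) (\<Sum>i\<in>I. K i)"
  by (induction I rule: finite_induct) (auto intro: abel_limit_zero abel_limit_add)

lemma abel_limit_unique: "abel_limit u K \<Longrightarrow> abel_limit u L \<Longrightarrow> K = L"
  unfolding abel_limit_def by (elim conjE) (rule tendsto_unique[OF trivial_limit_at_left_real])

lemma filterlim_power_at_left_1:
  assumes "p > 0"
  shows "filterlim (\<lambda>r::real. r ^ p) (at_left 1) (at_left 1)"
proof (rule tendsto_imp_filterlim_at_left)
  have "((\<lambda>r::real. r ^ p) \<longlongrightarrow> 1 ^ p) (at_left 1)" by (intro tendsto_intros)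
  thus "((\<lambda>r::real. r ^ p) \<longlongrightarrow> 1) (at_left 1)" by simp
  show "\<forall>\<^sub>F r in at_left 1. r ^ p < (1::real)"
    using assms by (intro eventually_unit_interval) (simp add: power_less_one_iff)
qed

text \<open>For odd \<open>p\<close> the signs at \<open>p * k\<close> and \<open>k\<close> agree,
  so the multiples of \<open>p\<close> form the Abel sum of the dilate at \<open>r ^ p\<close>,
  divided by \<open>p\<close>; and \<open>r ^ p\<close> still tends to 1 from the left.\<close>

lemma abel_limit_sieve:
  assumes u: "abel_limit u K" and up: "abel_limit (\<lambda>m. u (p * m)) L" and p: "odd p"
  shows "abel_limit (\<lambda>m. if p dvd m then 0 else u m) (K - L / of_nat p)"
proof -
  have p0: "p > 0" using p by (auto intro: Nat.gr0I)
  have bd: "bounded (range u)" "bounded (range (\<lambda>m. u (p * m)))" using u up by (auto simp: abel_limit_def)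
  have bd': "bounded (range (\<lambda>m. if p dvd m then 0 else u m))"
    by (rule bounded_subset[of "insert 0 (range u)"]) (use bd in auto)
  let ?t = "\<lambda>u r m. (-1) ^ Suc m * u m * complex_of_real (r ^ m / real m)"
  have eq: "alternating_abel u r - alternating_abel (\<lambda>m. u (p * m)) (r ^ p) / of_nat p =
      alternating_abel (\<lambda>m. if p dvd m then 0 else u m) r" if r: "0 < r" "r < 1" for r
  proof -
    have rp: "0 < r ^ p" "r ^ p < 1" using r p0 by (auto simp: power_less_one_iff)
    have tp: "?t (\<lambda>m. u (p * m)) (r ^ p) k / of_nat p = ?t u r (p * k)" for k
    proof -
      have "(-1::complex) ^ Suc (p * k) = (-1) ^ Suc k"
        using p by (simp add: power_mult)
      thus ?thesis by (simp add: power_mult)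
    qed
    have "(\<lambda>k. ?t u r (p * k)) sums (alternating_abel (\<lambda>m. u (p * m)) (r ^ p) / of_nat p)"
      using sums_divide[OF alternating_abel_sums[OF bd(2) rp], of "of_nat p"] unfolding tp .
    hence "(\<lambda>k. (\<lambda>m. if p dvd m then ?t u r m else 0) (p * k)) sums
        (alternating_abel (\<lambda>m. u (p * m)) (r ^ p) / of_nat p)" by simp
    moreover have "strict_mono (\<lambda>k. p * k)" using p0 by (auto intro!: strict_monoI)
    ultimately have "(\<lambda>m. if p dvd m then ?t u r m else 0) sums
        (alternating_abel (\<lambda>m. u (p * m)) (r ^ p) / of_nat p)"
      by (subst (asm) sums_mono_reindex) auto
    from sums_diff[OF alternating_abel_sums[OF bd(1) r] this]
    have "(\<lambda>m. ?t u r m - (if p dvd m then ?t u r m else 0)) sums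
      (alternating_abel u r - alternating_abel (\<lambda>m. u (p * m)) (r ^ p) / of_nat p)" .
    moreover have "?t u r m - (if p dvd m then ?t u r m else 0) = ?t (\<lambda>m. if p dvd m then 0 else u m) r m" for m
      by simp
    ultimately have "(\<lambda>m. ?t (\<lambda>m. if p dvd m then 0 else u m) r m) sums
      (alternating_abel u r - alternating_abel (\<lambda>m. u (p * m)) (r ^ p) / of_nat p)" by (simp only:)
    thus ?thesis using alternating_abel_sums[OF bd' r] by (rule sums_unique2)
  qed
  have "((\<lambda>r. alternating_abel (\<lambda>m. u (p * m)) (r ^ p)) \<longlongrightarrow> L) (at_left 1)"
    by (rule filterlim_compose[OF _ filterlim_power_at_left_1[OF p0]]) (use up in \<open>simp add: abel_limit_def\<close>)
  hence lim: "((\<lambda>r. alternating_abel u r - alternating_abel (\<lambda>m. u (p * m)) (r ^ p) / of_nat p) \<longlongrightarrow>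
      K - L / of_nat p) (at_left 1)"
    using u p0 by (intro tendsto_diff tendsto_divide tendsto_const) (auto simp: abel_limit_def)
  have ev: "\<forall>\<^sub>F r in at_left 1. alternating_abel u r - alternating_abel (\<lambda>m. u (p * m)) (r ^ p) / of_nat p =
      alternating_abel (\<lambda>m. if p dvd m then 0 else u m) r"
    by (intro eventually_unit_interval eq)
  from Lim_transform_eventually[OF lim ev] show ?thesis using bd' by (simp only: abel_limit_def)
qed

text \<open>All dilates must share the limit, because removing \<open>p\<close> from the dilate by
  \<open>d\<close> brings in the dilate by \<open>d * p\<close>. The value \<open>L\<close> is
  general: it is 0 for character sums and \<open>ln 2\<close> for the constant function.\<close>

lemma abel_limit_prime_sieve:
  assumes v: "\<And>d. abel_limit (\<lambda>m. v (d * m)) L"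
    and "finite Q" "\<And>p. p \<in> Q \<Longrightarrow> prime p \<and> odd p"
  shows "abel_limit (\<lambda>m. if \<forall>p\<in>Q. \<not> p dvd m then v (d * m) else 0) (L * (\<Prod>p\<in>Q. 1 - 1 / of_nat p))"
  using assms(2,3)
proof (induction Q arbitrary: d)
  case empty
  thus ?case using v by simp
next
  case (insert p Q)
  let ?u = "\<lambda>d m. if \<forall>p\<in>Q. \<not> p dvd m then v (d * m) else 0"
  let ?P = "\<Prod>p\<in>Q. 1 - 1 / complex_of_nat p"
  have p: "prime p" "odd p" and Q: "prime q" if "q \<in> Q" for q using insert.prems that by auto
  have IH: "abel_limit (?u d) (L * ?P)" for d using insert.IH insert.prems by simp
  have "?u d (p * m) = ?u (d * p) m" for m
  proof -
    have "q dvd p * m \<longleftrightarrow> q dvd m" if "q \<in> Q" for q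
    proof -
      have "\<not> q dvd p" using primes_dvd_imp_eq[of q p] insert.prems insert.hyps(2) that by auto
      thus ?thesis using prime_dvd_mult_iff[OF Q[OF that]] by blast
    qed
    thus ?thesis by (simp add: mult.assoc)
  qed
  hence "abel_limit (\<lambda>m. ?u d (p * m)) (L * ?P)" using IH[of "d * p"] by simp
  moreover have "odd p" using insert.prems by simp
  ultimately have "abel_limit (\<lambda>m. if p dvd m then 0 else ?u d m) (L * ?P - L * ?P / of_nat p)"
    by (rule abel_limit_sieve[OF IH])
  moreover have "(if p dvd m then 0 else ?u d m) = (if \<forall>p\<in>insert p Q. \<not> p dvd m then v (d * m) else 0)" for m
    by simp
  moreover have "L * ?P - L * ?P / of_nat p = L * (\<Prod>p\<in>insert p Q. 1 - 1 / of_nat p)"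
    using insert.hyps by (simp add: algebra_simps)
  ultimately show ?case by (simp only:)
qed

lemma abel_limit_coprime:
  fixes N :: nat
  assumes v: "\<And>d. abel_limit (\<lambda>m. v (d * m)) L" and N: "odd N"
  shows "abel_limit (\<lambda>m. if coprime m N then v (d * m) else 0) (L * (\<Prod>p\<in>prime_factors N. 1 - 1 / of_nat p))"
proof -
  have N0: "N \<noteq> 0" using N by (cases N) auto
  have iff: "coprime m N \<longleftrightarrow> (\<forall>p\<in>prime_factors N. \<not> p dvd m)" for m
  proof
    assume m: "coprime m N"
    show "\<forall>p\<in>prime_factors N. \<not> p dvd m"
    proof (intro ballI notI)
      fix p assume p: "p \<in> prime_factors N" "p dvd m"
      hence "is_unit p" using coprime_common_divisor[OF m] by (simp add: in_prime_factors_iff)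
      thus False using p(1) by (simp add: in_prime_factors_iff)
    qed
  next
    assume *: "\<forall>p\<in>prime_factors N. \<not> p dvd m"
    show "coprime m N"
    proof (rule ccontr)
      assume "\<not> coprime m N"
      hence "gcd m N \<noteq> 1" by (simp only: coprime_iff_gcd_eq_1 not_False_eq_True)
      from prime_factor_nat[OF this] obtain p where p: "prime p" "p dvd gcd m N" by (elim exE conjE)
      hence "p \<in> prime_factors N" "p dvd m" using N0 by (simp_all add: in_prime_factors_iff)
      thus False using * by blast
    qed
  qed
  have odd: "prime p \<and> odd p" if "p \<in> prime_factors N" for p
  proof -
    have "prime p" "p dvd N" using that by (simp_all add: in_prime_factors_iff)
    moreover have "odd p"
    proof
      assume "even p"
      from dvd_trans[OF this \<open>p dvd N\<close>] N show False by simp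
    qed
    ultimately show ?thesis by simp
  qed
  show ?thesis unfolding iff
  proof (rule abel_limit_prime_sieve[where v = v and L = L and d = d and Q = "prime_factors N"])
    show "abel_limit (\<lambda>m. v (d * m)) L" for d by (rule v)
    show "prime p \<and> odd p" if "p \<in> prime_factors N" for p by (rule odd[OF that])
  qed simp
qed

lemma abel_limit_one: "abel_limit (\<lambda>_. 1) (of_real (ln 2))"
proof -
  have "alternating_abel (\<lambda>_. 1) r = of_real (ln (1 + r))" if "0 < r" "r < 1" for r
  proof -
    have "(\<lambda>n. - ((- complex_of_real r) ^ n) / of_nat n) sums ln (1 + complex_of_real r)"
      by (rule Ln_series') (use that in simp)
    also have "(\<lambda>n. - ((- complex_of_real r) ^ n) / of_nat n) =
        (\<lambda>m. (-1) ^ Suc m * 1 * of_real (r ^ m / real m))"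
      by (rule ext) (subst power_minus, simp)
    also have "ln (1 + complex_of_real r) = of_real (ln (1 + r))"
      using Ln_of_real[of "1 + r"] that by simp
    finally show ?thesis unfolding alternating_abel_def by (rule sums_unique[symmetric])
  qed
  hence ev: "\<forall>\<^sub>F r in at_left 1. complex_of_real (ln (1 + r)) = alternating_abel (\<lambda>_. 1) r"
    by (intro eventually_unit_interval) simp
  have "((\<lambda>r. complex_of_real (ln (1 + r))) \<longlongrightarrow> of_real (ln (1 + 1))) (at_left 1)"
    by (intro tendsto_intros) auto
  hence "(alternating_abel (\<lambda>_. 1) \<longlongrightarrow> of_real (ln 2)) (at_left 1)"
    using tendsto_cong[OF ev] by simp
  thus ?thesis unfolding abel_limit_def by simp
qed

section \<open>Dilation-invariant spaces of periodic functions\<close>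

lemma periodic_cong:
  fixes u :: "nat \<Rightarrow> 'b" and N :: nat
  assumes per: "\<And>m. u (m + N) = u m" and "[m = n] (mod N)"
  shows "u m = u n"
proof -
  have mult: "u (m + k * N) = u m" for m k
  proof (induction k)
    case (Suc k)
    have "m + Suc k * N = (m + k * N) + N" by simp
    thus ?case using Suc per[of "m + k * N"] by (simp only:)
  qed simp
  have "u m = u (m mod N)" for m using mult[of "m mod N" "m div N"] by simp
  from this[of m] this[of n] assms(2) show ?thesis by (simp add: nat_cong_def)
qed

text \<open>On functions of period \<open>N\<close>, dilation by a unit \<open>j\<close> has order
  dividing \<open>T = totient N\<close>, so for \<open>z ^ T = 1\<close> the sum of
  \<open>z ^ i * u (j ^ i * m)\<close> over \<open>i < T\<close> is an eigenvector or zero.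
  Dilations commute, so the eigenvector property for the units already treated persists.\<close>

lemma common_dilation_eigenvector:
  fixes W :: "(nat \<Rightarrow> complex) set" and N :: nat
  assumes N: "N > 0"
    and per: "\<And>u m. u \<in> W \<Longrightarrow> u (m + N) = u m"
    and clos: "\<And>u j c T. u \<in> W \<Longrightarrow> coprime j N \<Longrightarrow> (\<lambda>m. \<Sum>i<T. c i * u (j ^ i * m)) \<in> W"
    and u0: "u0 \<in> W" "u0 m0 \<noteq> 0" and S: "finite S" "\<And>j. j \<in> S \<Longrightarrow> coprime j N"
  shows "\<exists>u\<in>W. (\<exists>m. u m \<noteq> 0) \<and> (\<forall>j\<in>S. \<exists>y. \<forall>m. u (j * m) = y * u m)"
  using S
proof (induction S)
  case empty
  thus ?case using u0 by auto
next
  case (insert j S)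
  have j: "coprime j N" by (rule insert.prems) simp
  obtain u m0 where u: "u \<in> W" "u m0 \<noteq> 0" and eig: "\<forall>j\<in>S. \<exists>y. \<forall>m. u (j * m) = y * u m"
    using insert.IH insert.prems by (auto simp: Ball_def)
  define T where "T = totient N"
  have T: "T > 0" using N by (simp add: T_def)
  define c where "c i = u (j ^ i * m0)" for i
  \<comment> \<open>The values of these sums at \<open>m0\<close> are those of a polynomial in
    \<open>z\<close> of degree below \<open>T\<close> with constant coefficient
    \<open>u m0 \<noteq> 0\<close>, which cannot vanish at all \<open>T\<close> roots of
    unity.\<close>
  have "\<exists>z. z ^ T = 1 \<and> (\<Sum>i<T. c i * z ^ i) \<noteq> 0"
  proof (rule ccontr)
    assume "\<nexists>z. z ^ T = 1 \<and> (\<Sum>i<T. c i * z ^ i) \<noteq> 0"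
    moreover have "{..<T} = {..T - 1}" using T by auto
    ultimately have sub: "{z. z ^ T = 1} \<subseteq> {z. (\<Sum>i\<le>T - 1. c i * z ^ i) = 0}" by auto
    have "c 0 \<noteq> 0" using u by (simp add: c_def)
    from Transcendental.polyfun_rootbound[of c 0 "T - 1", OF this]
    have "finite {z. (\<Sum>i\<le>T - 1. c i * z ^ i) = 0}" "card {z. (\<Sum>i\<le>T - 1. c i * z ^ i) = 0} \<le> T - 1"
      by auto
    with card_mono[OF _ sub] card_roots_unity_eq[OF T] T show False by simp
  qed
  then obtain z where z: "z ^ T = 1" "(\<Sum>i<T. c i * z ^ i) \<noteq> 0" by blast
  have z0: "z \<noteq> 0" using z(1) T by (auto simp: power_0_left)
  define w where "w m = (\<Sum>i<T. z ^ i * u (j ^ i * m))" for m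
  have wW: "w \<in> W" unfolding w_def using clos[OF u(1) j, of "\<lambda>i. z ^ i" T] by simp
  have w0: "w m0 \<noteq> 0" using z(2) by (simp add: w_def c_def mult.commute)
  have zw: "z * w (j * m) = w m" for m
  proof -
    have "u (j ^ T * m) = u m"
    proof (rule periodic_cong[of u N])
      have "[j ^ T * m = 1 * m] (mod N)"
        unfolding T_def by (intro cong_mult euler_theorem j cong_refl)
      thus "[j ^ T * m = m] (mod N)" by simp
    qed (rule per[OF u(1)])
    have "z * w (j * m) = (\<Sum>i<T. z ^ Suc i * u (j ^ Suc i * m))"
      unfolding w_def by (simp add: sum_distrib_left mult_ac)
    also have "\<dots> = (\<Sum>i<Suc T. z ^ i * u (j ^ i * m)) - u m"
      by (subst sum.lessThan_Suc_shift) simp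
    also have "\<dots> = w m" using z(1) \<open>u (j ^ T * m) = u m\<close> by (simp add: w_def)
    finally show ?thesis .
  qed
  have wj: "w (j * m) = inverse z * w m" for m using z0 by (subst zw[of m, symmetric]) simp
  have wk: "\<exists>y. \<forall>m. w (k * m) = y * w m" if k: "k \<in> S" for k
  proof -
    from eig k obtain y where y: "u (k * m) = y * u m" for m by blast
    have "w (k * m) = y * w m" for m
      unfolding w_def sum_distrib_left
    proof (rule sum.cong[OF refl])
      fix i
      have "u (j ^ i * (k * m)) = y * u (j ^ i * m)"
        using y[of "j ^ i * m"] by (simp only: mult.left_commute)
      thus "z ^ i * u (j ^ i * (k * m)) = y * (z ^ i * u (j ^ i * m))" by simp
    qed
    thus ?thesis by (intro exI[of _ y] allI)
  qed
  have "\<exists>y. \<forall>m. w (k * m) = y * w m" if "k \<in> insert j S" for k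
    using that
  proof
    assume "k = j"
    thus ?thesis using wj by (intro exI[of _ "inverse z"]) simp
  qed (rule wk)
  thus ?case using wW w0 by (intro bexI[of _ w] conjI exI[of _ m0] ballI) simp_all
qed

text \<open>A common eigenvector divided by its value at 1 coincides with its own eigenvalue as a
  function of the unit \<open>j\<close> (evaluate at \<open>m = 1\<close>), and is therefore
  multiplicative.\<close>

lemma dilation_space_has_character:
  fixes W :: "(nat \<Rightarrow> complex) set" and N :: nat
  assumes N: "N > 0"
    and per: "\<And>u m. u \<in> W \<Longrightarrow> u (m + N) = u m"
    and supp: "\<And>u m. u \<in> W \<Longrightarrow> \<not> coprime m N \<Longrightarrow> u m = 0"
    and clos: "\<And>u j c T. u \<in> W \<Longrightarrow> coprime j N \<Longrightarrow> (\<lambda>m. \<Sum>i<T. c i * u (j ^ i * m)) \<in> W"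
    and u0: "u0 \<in> W" "u0 m0 \<noteq> 0"
  shows "\<exists>\<psi>\<in>W. dirichlet_character N \<psi>"
proof -
  let ?S = "{j. j < N \<and> coprime j N}"
  have "\<exists>u\<in>W. (\<exists>m. u m \<noteq> 0) \<and> (\<forall>j\<in>?S. \<exists>y. \<forall>m. u (j * m) = y * u m)"
  proof (rule common_dilation_eigenvector[of N W u0 m0])
    show "u (m + N) = u m" if "u \<in> W" for u m using that by (rule per)
    show "(\<lambda>m. \<Sum>i<T. c i * u (j ^ i * m)) \<in> W" if "u \<in> W" "coprime j N" for u j c T
      using that by (rule clos)
  qed (use N u0 in simp_all)
  then obtain u m0 where u: "u \<in> W" "u m0 \<noteq> 0"
    and eig: "\<forall>j\<in>?S. \<exists>y. \<forall>m. u (j * m) = y * u m"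
    by (elim bexE conjE exE)
  have ucong: "u m = u n" if "[m = n] (mod N)" for m n
    by (rule periodic_cong[of u N, OF per[OF u(1)] that])
  have eig': "\<exists>y. \<forall>m. u (j * m) = y * u m" if j: "coprime j N" for j
  proof -
    have "j mod N \<in> ?S" using N j by simp
    from bspec[OF eig this] obtain y where y: "u (j mod N * m) = y * u m" for m by blast
    have "u (j * m) = u (j mod N * m)" for m
      by (rule ucong) (simp add: nat_cong_def mod_mult_left_eq)
    with y show ?thesis by auto
  qed
  have u1: "u 1 \<noteq> 0"
  proof -
    have "coprime m0 N" using supp[OF u(1)] u(2) by blast
    from eig'[OF this] obtain y where "\<And>m. u (m0 * m) = y * u m" by blast
    from this[of 1] u(2) show ?thesis by auto
  qed
  define \<psi> where "\<psi> m = u m / u 1" for m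
  \<comment> \<open>Closure under scalar multiples is the case \<open>T = 1\<close> with dilation by
    1.\<close>
  have "\<psi> = (\<lambda>m. \<Sum>i<1. (1 / u 1) * u (1 ^ i * m))" by (simp add: \<psi>_def fun_eq_iff)
  also have "\<dots> \<in> W" by (rule clos[OF u(1)]) simp
  finally have "\<psi> \<in> W" .
  have mult: "u (j * m) = \<psi> j * u m" if "coprime j N" for j m
  proof -
    from eig'[OF that] obtain y where y: "\<And>m. u (j * m) = y * u m" by blast
    from y[of 1] have "y = \<psi> j" using u1 by (simp add: \<psi>_def)
    with y show ?thesis by simp
  qed
  have "dirichlet_character N \<psi>"
  proof
    show "N > 0" by (rule N)
    show "\<psi> (m + N) = \<psi> m" for m by (simp add: \<psi>_def per[OF u(1)])
    show "\<psi> (m * n) = \<psi> m * \<psi> n" for m n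
    proof (cases "coprime m N")
      case True
      thus ?thesis using mult[OF True, of n] by (simp add: \<psi>_def)
    next
      case False
      hence "\<not> coprime (m * n) N" by simp
      with False show ?thesis using supp[OF u(1)] by (simp add: \<psi>_def)
    qed
    show "\<psi> m \<noteq> 0 \<longleftrightarrow> coprime m N" for m
    proof (cases "coprime m N")
      case True
      have "totient N > 0" using N by simp
      then obtain t where t: "totient N = Suc t" by (cases "totient N") auto
      have "u (m * m ^ t) = u 1" by (rule ucong) (use euler_theorem[OF True] t in simp)
      hence "\<psi> m * u (m ^ t) \<noteq> 0" using mult[OF True, of "m ^ t"] u1 by simp
      with True show ?thesis by simp
    next
      case False
      thus ?thesis using supp[OF u(1) False] by (simp add: \<psi>_def)
    qed
  qed
  with \<open>\<psi> \<in> W\<close> show ?thesis by blast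
qed

section \<open>Abel sums of nontrivial characters\<close>

context nontrivial_dirichlet_character
begin

lemma bounded_range: "bounded (range \<psi>)"
  by (rule boundedI[of _ 1]) (auto simp: norm_le_1)

lemma power_series_sums:
  assumes "0 < r" "r < 1"
  shows "(\<lambda>m. \<psi> m * of_real (r ^ m / real m)) sums (\<Sum>m. \<psi> m * of_real (r ^ m / real m))"
  by (rule summable_sums[OF summable_power_over_n[OF bounded_range assms]])

text \<open>Abel's theorem with an explicit rate, by Dirichlet's test: the difference has weights
  \<open>(1 - r ^ m) / m\<close>, decreasing in \<open>m\<close>, with first value
  \<open>1 - r\<close>.\<close>

lemma power_series_limit:
  "((\<lambda>r. \<Sum>m. \<psi> m * of_real (r ^ m / real m)) \<longlongrightarrow> (\<Sum>m. \<psi> (Suc m) / of_nat (Suc m))) (at_left 1)"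
proof -
  let ?L = "\<Sum>m. \<psi> (Suc m) / of_nat (Suc m)" and ?Z = "\<lambda>r. \<Sum>m. \<psi> m * of_real (r ^ m / real m)"
  have bound: "norm (?Z r - ?L) \<le> real N * (1 - r)" if r: "0 < r" "r < 1" for r
  proof -
    define b where "b m = (1 - r ^ Suc m) / real (Suc m)" for m
    \<comment> \<open>\<open>b n\<close> is \<open>1 - r\<close> times the average of
      \<open>r ^ 0, ..., r ^ n\<close>, and the averages of a decreasing sequence decrease.\<close>
    have "decseq b"
    proof (rule decseq_SucI)
      fix n
      let ?s = "\<Sum>i<Suc n. r ^ i"
      have "real (Suc n) * r ^ Suc n = (\<Sum>i<Suc n. r ^ Suc n)" by simp
      also have "\<dots> \<le> ?s" using r by (intro sum_mono power_decreasing) auto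
      finally have "real (Suc n) * r ^ Suc n \<le> ?s" .
      hence ineq: "real (Suc n) * (?s + r ^ Suc n) \<le> real (Suc (Suc n)) * ?s"
        by (simp add: algebra_simps)
      have frac: "x / B \<le> y / A" if "A * x \<le> B * y" "A > 0" "B > 0" for x y A B :: real
        using that by (simp add: field_simps)
      have "(?s + r ^ Suc n) / real (Suc (Suc n)) \<le> ?s / real (Suc n)"
        by (rule frac[OF ineq]) simp_all
      hence "(1 - r) * ((?s + r ^ Suc n) / real (Suc (Suc n))) \<le> (1 - r) * (?s / real (Suc n))"
        using r by (intro mult_left_mono) auto
      moreover have "1 - r ^ Suc (Suc n) = (1 - r) * (?s + r ^ Suc n)" "1 - r ^ Suc n = (1 - r) * ?s"
        using one_diff_power_eq[of r "Suc (Suc n)"] one_diff_power_eq[of r "Suc n"]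
        by (simp_all only: sum.lessThan_Suc)
      ultimately show "b (Suc n) \<le> b n" unfolding b_def by (simp only: times_divide_eq_right)
    qed
    have lim: "b \<longlonglongrightarrow> 0"
    proof -
      have "(\<lambda>m. 1 / real (Suc m)) \<longlonglongrightarrow> 0"
        by (rule inverse_Suc_tendsto_0)
      moreover have "(\<lambda>m. 1 - r ^ Suc m) \<longlonglongrightarrow> 1 - 0"
        by (intro tendsto_diff tendsto_const LIMSEQ_Suc[OF LIMSEQ_realpow_zero]) (use r in auto)
      ultimately have "(\<lambda>m. (1 - r ^ Suc m) * (1 / real (Suc m))) \<longlonglongrightarrow> (1 - 0) * 0"
        by (intro tendsto_mult)
      thus ?thesis by (simp add: b_def[abs_def])
    qed
    have "(\<lambda>m. \<psi> (Suc m) * of_real (r ^ Suc m / real (Suc m))) sums ?Z r"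
      using power_series_sums[OF r] sums_Suc_iff[of "\<lambda>m. \<psi> m * of_real (r ^ m / real m)" "?Z r"] by simp
    from sums_diff[OF summable_sums[OF summable_harmonic] this]
    have "(\<lambda>m. \<psi> (Suc m) / of_nat (Suc m) - \<psi> (Suc m) * of_real (r ^ Suc m / real (Suc m))) sums (?L - ?Z r)" .
    also have "(\<lambda>m. \<psi> (Suc m) / of_nat (Suc m) - \<psi> (Suc m) * of_real (r ^ Suc m / real (Suc m))) =
        (\<lambda>m. \<psi> (Suc m) * of_real (b m))"
      unfolding b_def by (simp only: diff_divide_distrib of_real_diff of_real_divide of_real_1
        of_real_of_nat_eq right_diff_distrib times_divide_eq_right mult_1_right)
    finally have "(\<lambda>m. \<psi> (Suc m) * of_real (b m)) sums (?L - ?Z r)" .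
    hence "norm (?L - ?Z r) \<le> real N * b 0"
      using Dirichlet_test_decseq(2)[OF sum_bounded lim \<open>decseq b\<close>] by (simp add: sums_iff)
    thus ?thesis by (simp add: b_def norm_minus_commute)
  qed
  have "((\<lambda>r. ?Z r - ?L) \<longlongrightarrow> 0) (at_left 1)"
  proof (rule Lim_null_comparison[where g = "\<lambda>r. real N * (1 - r)"])
    show "\<forall>\<^sub>F r in at_left 1. norm (?Z r - ?L) \<le> real N * (1 - r)"
      by (rule eventually_unit_interval) (rule bound)
    have "((\<lambda>r. real N * (1 - r)) \<longlongrightarrow> real N * (1 - 1)) (at_left 1)" by (intro tendsto_intros)
    thus "((\<lambda>r. real N * (1 - r)) \<longlongrightarrow> 0) (at_left 1)" by simp
  qed
  thus ?thesis by (rule LIM_zero_cancel)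
qed

text \<open>The sign is 1 minus twice the indicator of even \<open>m\<close>, and
  \<open>\<psi> (2 * k) = \<psi> 2 * \<psi> k\<close> turns the even part into the series at
  \<open>r\<^sup>2\<close>.\<close>

lemma alternating_abel_character:
  assumes r: "0 < r" "r < 1"
  shows "alternating_abel \<psi> r =
    (\<Sum>m. \<psi> m * of_real (r ^ m / real m)) - \<psi> 2 * (\<Sum>m. \<psi> m * of_real ((r\<^sup>2) ^ m / real m))"
proof -
  have r2: "0 < r\<^sup>2" "r\<^sup>2 < 1" using r by (auto simp: power_less_one_iff)
  let ?t = "\<lambda>m. \<psi> m * of_real (r ^ m / real m)"
  have eq: "?t (2 * k) * 2 = \<psi> 2 * (\<psi> k * of_real ((r\<^sup>2) ^ k / real k))" for k
    by (simp add: mult power_mult)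
  from sums_mult[OF power_series_sums[OF r2], of "\<psi> 2"]
  have "(\<lambda>k. (\<lambda>m. if even m then ?t m * 2 else 0) (2 * k)) sums (\<psi> 2 * (\<Sum>m. \<psi> m * of_real ((r\<^sup>2) ^ m / real m)))"
    by (simp only: dvd_triv_left if_True eq)
  moreover have "strict_mono (\<lambda>k::nat. 2 * k)" by (auto intro!: strict_monoI)
  ultimately have "(\<lambda>m. if even m then ?t m * 2 else 0) sums (\<psi> 2 * (\<Sum>m. \<psi> m * of_real ((r\<^sup>2) ^ m / real m)))"
    by (subst (asm) sums_mono_reindex) auto
  from sums_diff[OF power_series_sums[OF r] this]
  have "(\<lambda>m. ?t m - (if even m then ?t m * 2 else 0)) sums
    ((\<Sum>m. ?t m) - \<psi> 2 * (\<Sum>m. \<psi> m * of_real ((r\<^sup>2) ^ m / real m)))" .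
  moreover have "?t m - (if even m then ?t m * 2 else 0) = (-1) ^ Suc m * \<psi> m * of_real (r ^ m / real m)" for m
    by simp
  ultimately have "(\<lambda>m. (-1) ^ Suc m * \<psi> m * of_real (r ^ m / real m)) sums
    ((\<Sum>m. ?t m) - \<psi> 2 * (\<Sum>m. \<psi> m * of_real ((r\<^sup>2) ^ m / real m)))" by (simp only:)
  with alternating_abel_sums[OF bounded_range r] show ?thesis by (rule sums_unique2)
qed

lemma abel_limit_character:
  "abel_limit \<psi> ((1 - \<psi> 2) * (\<Sum>m. \<psi> (Suc m) / of_nat (Suc m)))"
proof -
  let ?L = "\<Sum>m. \<psi> (Suc m) / of_nat (Suc m)" and ?Z = "\<lambda>r. \<Sum>m. \<psi> m * of_real (r ^ m / real m)"
  have "((\<lambda>r. ?Z (r\<^sup>2)) \<longlongrightarrow> ?L) (at_left 1)"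
    by (rule filterlim_compose[OF power_series_limit filterlim_power_at_left_1]) simp
  hence "((\<lambda>r. ?Z r - \<psi> 2 * ?Z (r\<^sup>2)) \<longlongrightarrow> ?L - \<psi> 2 * ?L) (at_left 1)"
    by (intro tendsto_diff tendsto_mult tendsto_const power_series_limit)
  moreover have "\<forall>\<^sub>F r in at_left 1. ?Z r - \<psi> 2 * ?Z (r\<^sup>2) = alternating_abel \<psi> r"
    by (rule eventually_unit_interval) (rule alternating_abel_character[symmetric])
  ultimately have "(alternating_abel \<psi> \<longlongrightarrow> ?L - \<psi> 2 * ?L) (at_left 1)"
    by (rule Lim_transform_eventually)
  thus ?thesis using bounded_range by (simp add: abel_limit_def algebra_simps)
qed

end

text \<open>The assumptions are linear and invariant under dilation by units, so the functions
  satisfying them contain a character unless all are zero. The orbit condition excludes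
  \<open>\<psi> 2 = 1\<close>, in particular the trivial character, and then the Abel limit
  \<open>(1 - \<psi> 2) * L(1, \<psi>)\<close> is nonzero.\<close>

lemma abel_vanishing_imp_zero:
  fixes u0 :: "nat \<Rightarrow> complex" and N t :: nat
  assumes N: "odd N" and t: "t > 0"
    and per: "\<And>m. u0 (m + N) = u0 m" and supp: "\<And>m. \<not> coprime m N \<Longrightarrow> u0 m = 0"
    and lim: "\<And>j. coprime j N \<Longrightarrow> abel_limit (\<lambda>m. u0 (j * m)) 0"
    and orbit: "\<And>m. (\<Sum>i<t. u0 (2 ^ i * m)) = 0"
  shows "u0 m0 = 0"
proof (rule ccontr)
  assume m0: "u0 m0 \<noteq> 0"
  have N0: "N > 0" using N by (cases N) auto
  define W where "W = {u :: nat \<Rightarrow> complex. (\<forall>m. u (m + N) = u m) \<and> (\<forall>m. \<not> coprime m N \<longrightarrow> u m = 0) \<and>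
    (\<forall>j. coprime j N \<longrightarrow> abel_limit (\<lambda>m. u (j * m)) 0) \<and> (\<forall>m. (\<Sum>i<t. u (2 ^ i * m)) = 0)}"
  have per_mult: "u (m + k * N) = u m" if "\<forall>m. u (m + N) = u m" for u :: "nat \<Rightarrow> complex" and m k
    by (rule periodic_cong[of u N]) (use that in \<open>simp_all add: nat_cong_def\<close>)
  have clos: "(\<lambda>m. \<Sum>i<T. c i * u (j ^ i * m)) \<in> W" if u: "u \<in> W" and j: "coprime j N" for u j T and c :: "nat \<Rightarrow> complex"
  proof -
    have uW: "\<forall>m. u (m + N) = u m" "\<And>m. \<not> coprime m N \<Longrightarrow> u m = 0"
      "\<And>j. coprime j N \<Longrightarrow> abel_limit (\<lambda>m. u (j * m)) 0" "\<And>m. (\<Sum>i<t. u (2 ^ i * m)) = 0"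
      using u by (simp_all add: W_def)
    have "u (j ^ i * (m + N)) = u (j ^ i * m)" for i m
      using per_mult[OF uW(1), of "j ^ i * m" "j ^ i"] by (simp only: distrib_left)
    moreover have "u (j ^ i * m) = 0" if "\<not> coprime m N" for i m
      by (rule uW(2)) (use that in simp)
    moreover have "abel_limit (\<lambda>m. \<Sum>i<T. c i * u (j ^ i * (k * m))) 0" if k: "coprime k N" for k
    proof -
      have "abel_limit (\<lambda>m. u (j ^ i * (k * m))) 0" for i
      proof -
        have "coprime (j ^ i * k) N" using j k by simp
        from uW(3)[OF this] show ?thesis by (simp only: mult.assoc)
      qed
      from abel_limit_sum[OF finite_lessThan abel_limit_cmult[OF this]]
      have "abel_limit (\<lambda>m. \<Sum>i<T. c i * u (j ^ i * (k * m))) (\<Sum>i<T. c i * 0)" .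
      thus ?thesis by simp
    qed
    moreover have "(\<Sum>l<t. \<Sum>i<T. c i * u (j ^ i * (2 ^ l * m))) = 0" for m
    proof -
      have "(\<Sum>l<t. \<Sum>i<T. c i * u (j ^ i * (2 ^ l * m))) = (\<Sum>i<T. c i * (\<Sum>l<t. u (2 ^ l * (j ^ i * m))))"
        by (subst sum.swap) (simp only: sum_distrib_left mult.left_commute)
      thus ?thesis by (simp only: uW(4) mult_zero_right sum.neutral_const)
    qed
    ultimately show ?thesis unfolding W_def by simp
  qed
  have "\<exists>\<psi>\<in>W. dirichlet_character N \<psi>"
  proof (rule dilation_space_has_character[of N W u0 m0])
    show "u (m + N) = u m" if "u \<in> W" for u m using that by (simp add: W_def)
    show "u m = 0" if "u \<in> W" "\<not> coprime m N" for u m using that by (simp add: W_def)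
    show "(\<lambda>m. \<Sum>i<T. c i * u (j ^ i * m)) \<in> W" if "u \<in> W" "coprime j N" for u j c T
      using that by (rule clos)
    show "u0 \<in> W" using per supp lim orbit by (simp add: W_def)
  qed (use N0 m0 in simp_all)
  then obtain \<psi> where \<psi>: "\<psi> \<in> W" and "dirichlet_character N \<psi>" by (elim bexE)
  interpret dirichlet_character N \<psi> by fact
  have W\<psi>: "\<forall>j. coprime j N \<longrightarrow> abel_limit (\<lambda>m. \<psi> (j * m)) 0" "\<forall>m. (\<Sum>i<t. \<psi> (2 ^ i * m)) = 0"
    using \<psi> by (simp_all add: W_def)
  have orb: "(\<Sum>i<t. \<psi> (2 ^ i * 1)) = 0" by (rule W\<psi>(2)[rule_format])
  have lim0: "abel_limit \<psi> 0" using W\<psi>(1)[rule_format, of 1] by simp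
  have two: "\<psi> 2 \<noteq> 1"
  proof
    assume "\<psi> 2 = 1"
    hence "(\<Sum>i<t. \<psi> (2 ^ i * 1)) = of_nat t" by (simp add: power)
    with orb t show False by simp
  qed
  interpret nontrivial_dirichlet_character N \<psi>
    by unfold_locales (use two N in \<open>auto intro!: exI[of _ 2]\<close>)
  from abel_limit_unique[OF lim0 abel_limit_character] two nonvanishing show False by simp
qed

text \<open>First claim: the sieved \<open>v\<close> minus its dilate by 2 telescopes along a
  doubling orbit, as \<open>2 ^ totient N\<close> is 1 modulo \<open>N\<close>, so it vanishes; read
  this at 1. Second claim: summing the sieved dilates over all units gives a constant times the
  indicator of the units, whose Abel limit is \<open>ln 2\<close> times a nonzero product.\<close>

lemma abel_vanishing_periodic:
  fixes v :: "nat \<Rightarrow> complex" and N :: nat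
  assumes N: "odd N" and per: "\<And>m. v (m + N) = v m"
    and lim: "\<And>d. abel_limit (\<lambda>m. v (d * m)) 0"
  shows "v 2 = v 1" and "(\<Sum>j | j < N \<and> coprime j N. v j) = 0"
proof -
  have N0: "N > 0" using N by (cases N) auto
  have vcong: "v m = v n" if "[m = n] (mod N)" for m n by (rule periodic_cong[of v N, OF per that])
  define w where "w d m = (if coprime m N then v (d * m) else 0)" for d m
  have wlim: "abel_limit (w d) 0" for d
  proof -
    have "abel_limit (\<lambda>m. if coprime m N then v (d * m) else 0) (0 * (\<Prod>p\<in>prime_factors N. 1 - 1 / of_nat p))"
      by (rule abel_limit_coprime[where v = v and L = 0]) (rule lim, rule N)
    thus ?thesis by (simp add: w_def[abs_def])
  qed
  define t where "t = totient N"
  have t: "t > 0" using N0 by (simp add: t_def)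
  have c2: "coprime 2 N" using N by simp
  define u where "u m = w 1 m - w 2 m" for m
  have "u 1 = 0"
  proof (rule abel_vanishing_imp_zero[OF N t])
    show "u (m + N) = u m" for m
    proof -
      have "v (2 * (m + N)) = v (2 * m)" by (rule vcong) (simp add: nat_cong_def distrib_left)
      moreover have "coprime (m + N) N \<longleftrightarrow> coprime m N" by (simp only: coprime_iff_gcd_eq_1 gcd_add1)
      ultimately show ?thesis by (simp only: u_def w_def per mult_1)
    qed
    show "u m = 0" if "\<not> coprime m N" for m using that by (simp add: u_def w_def)
    show "abel_limit (\<lambda>m. u (j * m)) 0" if j: "coprime j N" for j
    proof -
      have "w d (j * m) = w (d * j) m" for d m using j by (simp add: w_def mult.assoc)
      hence "(\<lambda>m. u (j * m)) = (\<lambda>m. w (1 * j) m - w (2 * j) m)" by (simp only: u_def)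
      with abel_limit_diff[OF wlim[of "1 * j"] wlim[of "2 * j"]] show ?thesis by simp
    qed
    show "(\<Sum>i<t. u (2 ^ i * m)) = 0" for m
    proof (cases "coprime m N")
      case True
      have "(\<Sum>i<t. u (2 ^ i * m)) = (\<Sum>i<t. v (2 ^ i * m) - v (2 ^ Suc i * m))"
        using True c2 by (simp add: u_def w_def mult.assoc)
      also have "\<dots> = v (2 ^ 0 * m) - v (2 ^ t * m)" by (rule sum_lessThan_telescope')
      also have "v (2 ^ t * m) = v (1 * m)"
        unfolding t_def by (intro vcong cong_mult euler_theorem c2 cong_refl)
      finally show ?thesis by simp
    next
      case False
      thus ?thesis using c2 by (simp add: u_def w_def)
    qed
  qed
  thus "v 2 = v 1" by (simp add: u_def w_def)
  let ?S = "{j. j < N \<and> coprime j N}"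
  let ?c = "\<Sum>j\<in>?S. v j"
  have shift: "(\<Sum>j\<in>?S. v (j * m)) = ?c" if m: "coprime m N" for m
  proof -
    have "inj_on (\<lambda>j. j * m mod N) ?S"
    proof (rule inj_onI)
      fix x y assume xy: "x \<in> ?S" "y \<in> ?S" "x * m mod N = y * m mod N"
      hence "[x = y] (mod N)" using cong_mult_rcancel_nat[OF m] by (simp add: nat_cong_def)
      thus "x = y" using xy by (simp add: nat_cong_def)
    qed
    moreover have "(\<lambda>j. j * m mod N) ` ?S \<subseteq> ?S" using N0 m by auto
    ultimately have "bij_betw (\<lambda>j. j * m mod N) ?S ?S"
      by (intro bij_betw_imageI endo_inj_surj) auto
    from sum.reindex_bij_betw[OF this, of v]
    have "(\<Sum>j\<in>?S. v (j * m mod N)) = ?c" .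
    moreover have "v (j * m mod N) = v (j * m)" for j by (rule vcong) (simp add: nat_cong_def)
    ultimately show ?thesis by (simp only:)
  qed
  have "abel_limit (\<lambda>m. \<Sum>j\<in>?S. w j m) (\<Sum>j\<in>?S. 0)"
    by (rule abel_limit_sum) (simp_all add: wlim)
  moreover have "(\<Sum>j\<in>?S. w j m) = ?c * (if coprime m N then 1 else 0)" for m
    using shift[of m] by (simp add: w_def)
  ultimately have "abel_limit (\<lambda>m. ?c * (if coprime m N then 1 else 0)) 0" by simp
  from abel_limit_unique[OF this] have unique: "abel_limit (\<lambda>m. ?c * (if coprime m N then 1 else 0)) K \<Longrightarrow> 0 = K" for K .
  have "abel_limit (\<lambda>m. ?c * (if coprime m N then 1 else 0))
      (?c * (of_real (ln 2) * (\<Prod>p\<in>prime_factors N. 1 - 1 / of_nat p)))"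
    by (rule abel_limit_cmult, rule abel_limit_coprime[where v = "\<lambda>_. 1"]) (rule abel_limit_one, rule N)
  from unique[OF this] have "?c * (of_real (ln 2) * (\<Prod>p\<in>prime_factors N. 1 - 1 / of_nat p)) = 0"
    by (rule sym)
  moreover have "(\<Prod>p\<in>prime_factors N. 1 - 1 / complex_of_nat p) \<noteq> 0"
  proof (subst prod_zero_iff)
    show "\<not> (\<exists>p\<in>prime_factors N. 1 - 1 / complex_of_nat p = 0)"
    proof
      assume "\<exists>p\<in>prime_factors N. 1 - 1 / complex_of_nat p = 0"
      then obtain p where p: "prime p" "1 - 1 / complex_of_nat p = 0" by (auto simp: in_prime_factors_iff)
      hence "complex_of_nat p = 1" using prime_gt_0_nat[OF p(1)] by (simp add: field_simps)
      hence "p = 1" by simp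
      thus False using p(1) by simp
    qed
  qed simp
  ultimately show "?c = 0" by simp
qed

section \<open>Characters of odd order\<close>

primrec nmul :: "nat \<Rightarrow> 'a::ab_group_add \<Rightarrow> 'a" where
  "nmul 0 g = 0"
| "nmul (Suc n) g = g + nmul n g"

lemma nmul_1 [simp]: "nmul (Suc 0) g = g" by simp

lemma nmul_add: "nmul (m + n) g = nmul m g + nmul n g"
  by (induction m) (simp_all add: add.assoc)

lemma nmul_mult: "nmul (m * n) g = nmul m (nmul n g)"
  by (induction m) (simp_all add: nmul_add)

lemma nmul_zero_right [simp]: "nmul n 0 = 0"
  by (induction n) simp_all

lemma nmul_2: "nmul 2 g = g + g"
  by (simp add: numeral_2_eq_2)

lemma nmul_mod:
  assumes "nmul n g = 0"
  shows "nmul (k mod n) g = nmul k g"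
proof -
  have "nmul k g = nmul (k div n * n + k mod n) g" by simp
  also have "\<dots> = nmul (k mod n) g" by (simp only: nmul_add nmul_mult assms nmul_zero_right add_0)
  finally show ?thesis by (rule sym)
qed

lemma nmul_eq_0_iff_dvd:
  assumes n: "n > 0" "nmul n g = 0" and least: "\<And>k. 0 < k \<Longrightarrow> k < n \<Longrightarrow> nmul k g \<noteq> 0"
  shows "nmul k g = 0 \<longleftrightarrow> n dvd k"
proof
  assume "nmul k g = 0"
  hence "nmul (k mod n) g = 0" by (simp add: nmul_mod[OF n(2)])
  with least[of "k mod n"] n(1) show "n dvd k" by (cases "k mod n = 0") auto
next
  assume "n dvd k"
  then obtain q where "k = n * q" by (rule dvdE)
  hence "k = q * n" by simp
  thus "nmul k g = 0" by (simp add: nmul_mult n(2))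
qed

text \<open>If the order were even, half of it would produce an element of order 2.\<close>

lemma torsion_order:
  fixes g :: "'a::ab_group_add"
  assumes "no_order_two TYPE('a)" and "k > 0" "nmul k g = 0"
  shows "\<exists>n. odd n \<and> (\<forall>k. nmul k g = 0 \<longleftrightarrow> n dvd k)"
proof -
  define n where "n = (LEAST n. n > 0 \<and> nmul n g = 0)"
  have n: "n > 0 \<and> nmul n g = 0" unfolding n_def by (rule LeastI[of _ k]) (use assms in simp)
  have least: "nmul k g \<noteq> 0" if "0 < k" "k < n" for k
    using not_less_Least[OF that(2)[unfolded n_def]] that(1) by simp
  have "odd n"
  proof
    assume "even n"
    then obtain m where "n = 2 * m" by (rule evenE)
    hence m: "n = m + m" by simp
    hence "nmul m g + nmul m g = 0" using n by (simp add: nmul_add)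
    hence "nmul m g = 0" using assms(1) unfolding no_order_two_def by blast
    with least[of m] m n show False by simp
  qed
  moreover have "nmul k g = 0 \<longleftrightarrow> n dvd k" for k
  proof (rule nmul_eq_0_iff_dvd)
    show "nmul k g \<noteq> 0" if "0 < k" "k < n" for k using that by (rule least)
  qed (use n in simp_all)
  ultimately show ?thesis by (intro exI[of _ n] conjI allI)
qed

text \<open>The exponent may depend on \<open>x\<close>, since an arbitrary group need not have a
  common one. Oddness excludes the value -1.\<close>

definition odd_char :: "('a::ab_group_add \<Rightarrow> complex) \<Rightarrow> bool" where
  "odd_char \<phi> \<longleftrightarrow> (\<forall>x y. \<phi> (x + y) = \<phi> x * \<phi> y) \<and> (\<forall>x. \<exists>k. odd k \<and> \<phi> x ^ k = 1)"

lemma odd_char_add: "odd_char \<phi> \<Longrightarrow> \<phi> (x + y) = \<phi> x * \<phi> y"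
  by (simp add: odd_char_def)

lemma odd_char_odd: "odd_char \<phi> \<Longrightarrow> \<exists>k. odd k \<and> \<phi> x ^ k = 1"
  unfolding odd_char_def by (elim conjE) (rule spec)

lemma odd_char_norm: "odd_char \<phi> \<Longrightarrow> norm (\<phi> x) = 1"
proof -
  assume "odd_char \<phi>"
  then obtain k where k: "odd k" "\<phi> x ^ k = 1" using odd_char_odd by blast
  hence "norm (\<phi> x) ^ k = 1 ^ k" by (simp add: norm_power[symmetric])
  moreover have "k > 0" using k(1) by (cases k) auto
  ultimately show ?thesis using power_eq_imp_eq_base[of "norm (\<phi> x)" k 1] by simp
qed

lemma odd_char_nonzero: "odd_char \<phi> \<Longrightarrow> \<phi> x \<noteq> 0"
  using odd_char_norm[of \<phi> x] by auto

lemma odd_char_zero: "odd_char \<phi> \<Longrightarrow> \<phi> 0 = 1"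
  using odd_char_add[of \<phi> 0 0] odd_char_nonzero[of \<phi> 0] by simp

lemma odd_char_minus: "odd_char \<phi> \<Longrightarrow> \<phi> (- x) = cnj (\<phi> x)"
proof -
  assume c: "odd_char \<phi>"
  have "\<phi> (- x) * \<phi> x = 1" using odd_char_add[OF c, of "- x" x] odd_char_zero[OF c] by simp
  moreover have "cnj (\<phi> x) * \<phi> x = 1"
    using complex_norm_square[of "\<phi> x"] odd_char_norm[OF c, of x] by (simp add: mult.commute)
  ultimately show ?thesis using odd_char_nonzero[OF c, of x] by (metis mult_right_cancel)
qed

lemma odd_char_nmul: "odd_char \<phi> \<Longrightarrow> \<phi> (nmul n x) = \<phi> x ^ n"
  by (induction n) (simp_all add: odd_char_add odd_char_zero)

lemma odd_char_mult:
  assumes "odd_char \<phi>" "odd_char \<theta>"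
  shows "odd_char (\<lambda>x. \<phi> x * \<theta> x)"
  unfolding odd_char_def
proof (intro conjI allI)
  fix x y
  show "\<phi> (x + y) * \<theta> (x + y) = \<phi> x * \<theta> x * (\<phi> y * \<theta> y)"
    by (simp add: odd_char_add assms mult_ac)
  from odd_char_odd[OF assms(1), of x] obtain k where k: "odd k" "\<phi> x ^ k = 1" by (elim exE conjE)
  from odd_char_odd[OF assms(2), of x] obtain l where l: "odd l" "\<theta> x ^ l = 1" by (elim exE conjE)
  have "\<theta> x ^ (k * l) = (\<theta> x ^ l) ^ k" by (simp only: power_mult[symmetric] mult.commute[of k l])
  with k l have "odd (k * l) \<and> (\<phi> x * \<theta> x) ^ (k * l) = 1"
    by (simp add: power_mult_distrib power_mult)
  thus "\<exists>k. odd k \<and> (\<phi> x * \<theta> x) ^ k = 1" by (rule exI)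
qed

lemma odd_char_power: "odd_char \<phi> \<Longrightarrow> odd_char (\<lambda>x. \<phi> x ^ j)"
proof (induction j)
  case 0
  show ?case unfolding odd_char_def by (auto intro: exI[of _ 1])
next
  case (Suc j)
  thus ?case using odd_char_mult[of \<phi> "\<lambda>x. \<phi> x ^ j"] by simp
qed

section \<open>Extension of characters from subgroups\<close>

lemma odd_root_of_unity_nonzero:
  fixes z :: complex
  assumes "odd k" "z ^ k = 1"
  shows "z \<noteq> 0"
  using assms by (cases "k = 0") (auto simp: power_0_left)

text \<open>A character on a subgroup, kept as its graph so that chains have their unions as upper
  bounds. Single-valuedness is encoded by the condition at 0.\<close>

definition char_graph :: "('a::ab_group_add \<times> complex) set \<Rightarrow> bool" where
  "char_graph R \<longleftrightarrow> (0, 1) \<in> R \<and>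
    (\<forall>x z y w. (x, z) \<in> R \<longrightarrow> (y, w) \<in> R \<longrightarrow> (x + y, z * w) \<in> R) \<and>
    (\<forall>x z. (x, z) \<in> R \<longrightarrow> (- x, inverse z) \<in> R) \<and>
    (\<forall>z. (0, z) \<in> R \<longrightarrow> z = 1) \<and>
    (\<forall>x z. (x, z) \<in> R \<longrightarrow> (\<exists>k. odd k \<and> z ^ k = 1))"

lemma char_graphD:
  assumes "char_graph R"
  shows "(0, 1) \<in> R" "(x, z) \<in> R \<Longrightarrow> (y, w) \<in> R \<Longrightarrow> (x + y, z * w) \<in> R"
    "(x, z) \<in> R \<Longrightarrow> (- x, inverse z) \<in> R" "(0, z) \<in> R \<Longrightarrow> z = 1"
    "(x, z) \<in> R \<Longrightarrow> \<exists>k. odd k \<and> z ^ k = 1"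
  using assms unfolding char_graph_def by blast+

lemma char_graph_nonzero: "char_graph R \<Longrightarrow> (x, z) \<in> R \<Longrightarrow> z \<noteq> 0"
  using char_graphD(5)[of R x z] odd_root_of_unity_nonzero by blast

lemma char_graph_unique:
  assumes R: "char_graph R" and "(x, z) \<in> R" "(x, w) \<in> R"
  shows "z = w"
proof -
  have "(x + - x, z * inverse w) \<in> R" using assms char_graphD(2,3)[OF R] by blast
  hence "z * inverse w = 1" using char_graphD(4)[OF R] by simp
  thus ?thesis using char_graph_nonzero[OF R assms(3)] by (simp add: field_simps)
qed

lemma char_graph_nmul: "char_graph R \<Longrightarrow> (x, z) \<in> R \<Longrightarrow> (nmul n x, z ^ n) \<in> R"
  by (induction n) (auto intro: char_graphD)

text \<open>An arbitrary \<open>m\<close>-th root \<open>w\<close> of \<open>y\<close> may have even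
  order. With \<open>m = 2 ^ b * q\<close> and \<open>q\<close> odd, raising \<open>w\<close> to the
  power \<open>2 ^ b * c\<close> removes the 2-part of its order, and choosing
  \<open>2 ^ b * c\<close> congruent to 1 modulo \<open>k\<close> keeps the \<open>m\<close>-th
  power equal to \<open>y\<close>.\<close>

lemma odd_root_of_odd_root_of_unity:
  fixes y :: complex
  assumes k: "odd k" "y ^ k = 1" and m: "m > 0"
  shows "\<exists>d. d ^ m = y \<and> (\<exists>l. odd l \<and> d ^ l = 1)"
proof -
  obtain w where w: "y = w ^ m" by (rule exists_complex_root[of m y]) (use m in simp_all)
  obtain q where q: "m = 2 ^ multiplicity 2 m * q" "odd q"
    by (rule multiplicity_decompose'[of m 2]) (use m in auto)
  define b where "b = multiplicity 2 m"
  note q = q[folded b_def]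
  have "coprime (2 ^ b) k" using k(1) by simp
  from cong_solve_coprime_nat[OF this] obtain c where c: "[2 ^ b * c = Suc 0] (mod k)" by (rule exE)
  define d where "d = w ^ (2 ^ b * c)"
  have "d ^ m = y ^ (2 ^ b * c)"
    unfolding d_def w by (simp only: power_mult[symmetric] mult.commute)
  also have "\<dots> = y"
  proof -
    have red: "y ^ (n mod k) = y ^ n" for n
    proof -
      have "y ^ n = y ^ (k * (n div k) + n mod k)" by simp
      also have "\<dots> = y ^ (n mod k)" by (simp only: power_add power_mult k(2) power_one mult_1)
      finally show ?thesis by (rule sym)
    qed
    have "y ^ (2 ^ b * c) = y ^ (2 ^ b * c mod k)" by (rule red[symmetric])
    also have "2 ^ b * c mod k = 1 mod k" using c by (simp add: nat_cong_def)
    also have "y ^ (1 mod k) = y ^ 1" by (rule red)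
    finally show ?thesis by simp
  qed
  finally have "d ^ m = y" .
  moreover have "d ^ (q * k) = 1"
  proof -
    have "d ^ (q * k) = ((w ^ m) ^ k) ^ c"
      unfolding d_def by (subst q(1)) (simp only: power_mult[symmetric] mult_ac)
    thus ?thesis by (simp add: w[symmetric] k(2))
  qed
  ultimately show ?thesis using k(1) q(2) by (metis even_mult_iff)
qed

text \<open>Adjoins \<open>s\<close> with value \<open>d\<close>; integer multiples of
  \<open>s\<close> are written as differences of natural ones. An element represented as 0 puts a
  multiple of \<open>s\<close> or its negative into the old domain, where \<open>compat\<close>
  fixes the value.\<close>

lemma char_graph_extend:
  assumes R: "char_graph R" and d: "odd k" "d ^ k = 1"
    and compat: "\<And>n y. (nmul n s, y) \<in> R \<Longrightarrow> d ^ n = y"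
  shows "char_graph {(x + nmul a s - nmul b s, z * d ^ a / d ^ b) | x z a b. (x, z) \<in> R}" (is "char_graph ?R")
  unfolding char_graph_def
proof (intro conjI allI impI)
  have d0: "d \<noteq> 0" using d by (rule odd_root_of_unity_nonzero)
  have mem: "(x + nmul a s - nmul b s, z * d ^ a / d ^ b) \<in> ?R" if "(x, z) \<in> R" for x z a b
    using that by blast
  show "(0, 1) \<in> ?R" using mem[OF char_graphD(1)[OF R], of 0 0] by simp
  show "(x + y, z * w) \<in> ?R" if xy: "(x, z) \<in> ?R" "(y, w) \<in> ?R" for x z y w
  proof -
    from xy(1) obtain x' z' a b where 1: "x = x' + nmul a s - nmul b s" "z = z' * d ^ a / d ^ b" "(x', z') \<in> R" by blast
    from xy(2) obtain y' w' e f where 2: "y = y' + nmul e s - nmul f s" "w = w' * d ^ e / d ^ f" "(y', w') \<in> R" by blast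
    from mem[OF char_graphD(2)[OF R 1(3) 2(3)], of "a + e" "b + f"]
    show ?thesis unfolding 1(1,2) 2(1,2) by (simp add: nmul_add power_add algebra_simps)
  qed
  show "(- x, inverse z) \<in> ?R" if x: "(x, z) \<in> ?R" for x z
  proof -
    from x obtain x' z' a b where 1: "x = x' + nmul a s - nmul b s" "z = z' * d ^ a / d ^ b" "(x', z') \<in> R" by blast
    from mem[OF char_graphD(3)[OF R 1(3)], of b a]
    show ?thesis unfolding 1(1,2) by (simp add: divide_inverse algebra_simps)
  qed
  show "z = 1" if x: "(0, z) \<in> ?R" for z
  proof -
    from x obtain x' z' a b where 1: "0 = x' + nmul a s - nmul b s" "z = z' * d ^ a / d ^ b" "(x', z') \<in> R" by blast
    show ?thesis
    proof (cases "b \<le> a")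
      case True
      then obtain n where n: "a = n + b" by (metis le_add_diff_inverse2)
      have "nmul n s = - x'" using 1(1) by (simp add: n nmul_add algebra_simps eq_neg_iff_add_eq_0)
      with char_graphD(3)[OF R 1(3)] compat have "d ^ n = inverse z'" by simp
      thus ?thesis using 1(2) d0 char_graph_nonzero[OF R 1(3)] by (simp add: n power_add)
    next
      case False
      then obtain n where n: "b = n + a" by (metis le_add_diff_inverse2 nat_le_linear)
      have "nmul n s = x'" using 1(1) by (simp add: n nmul_add algebra_simps)
      with 1(3) compat have "d ^ n = z'" by simp
      thus ?thesis using 1(2) d0 char_graph_nonzero[OF R 1(3)] by (simp add: n power_add)
    qed
  qed
  show "\<exists>k. odd k \<and> z ^ k = 1" if x: "(x, z) \<in> ?R" for x z
  proof -
    from x obtain x' z' a b where 1: "z = z' * d ^ a / d ^ b" "(x', z') \<in> R" by blast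
    from char_graphD(5)[OF R 1(2)] obtain l where l: "odd l" "z' ^ l = 1" by blast
    have "(z') ^ (l * k) = 1" "(d ^ e) ^ (l * k) = 1" for e
    proof -
      show "(z') ^ (l * k) = 1" by (simp add: power_mult l(2))
      have "(d ^ e) ^ (l * k) = (d ^ k) ^ (e * l)" by (simp only: power_mult[symmetric] mult_ac)
      thus "(d ^ e) ^ (l * k) = 1" by (simp add: d(2))
    qed
    hence "z ^ (l * k) = 1" unfolding 1(1) power_mult_distrib power_divide by simp
    moreover have "odd (l * k)" using l(1) d(1) by simp
    ultimately show ?thesis by blast
  qed
qed

text \<open>The multiples of \<open>s\<close> in the domain come from the least positive one,
  \<open>nmul m s\<close>, so any odd-order \<open>m\<close>-th root of its value can serve as
  \<open>d\<close>. If there is no positive one, \<open>d = 1\<close> works.\<close>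

lemma char_graph_extend_exists:
  assumes R: "char_graph R"
  shows "\<exists>R' y. char_graph R' \<and> R \<subseteq> R' \<and> (s, y) \<in> R'"
proof -
  have "\<exists>d k. odd k \<and> d ^ k = 1 \<and> (\<forall>n y. (nmul n s, y) \<in> R \<longrightarrow> d ^ n = y)"
  proof (cases "\<exists>n>0. \<exists>y. (nmul n s, y) \<in> R")
    case False
    have "1 ^ n = y" if y: "(nmul n s, y) \<in> R" for n y
    proof -
      have "n = 0"
      proof (rule ccontr)
        assume "n \<noteq> 0"
        with y have "\<exists>n>0. \<exists>y. (nmul n s, y) \<in> R" by (intro exI[of _ n] conjI exI[of _ y]) simp_all
        with False show False by (rule notE)
      qed
      with y char_graphD(4)[OF R, of y] show ?thesis by simp
    qed
    thus ?thesis by (intro exI[of _ 1]) auto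
  next
    case True
    define m where "m = (LEAST n. n > 0 \<and> (\<exists>y. (nmul n s, y) \<in> R))"
    have "m > 0 \<and> (\<exists>y. (nmul m s, y) \<in> R)" unfolding m_def by (rule LeastI_ex) (use True in blast)
    then obtain y where m: "m > 0" "(nmul m s, y) \<in> R" by blast
    have least: "(nmul k s, w) \<notin> R" if "0 < k" "k < m" for k w
      using not_less_Least[of k "\<lambda>n. n > 0 \<and> (\<exists>y. (nmul n s, y) \<in> R)"] that unfolding m_def by blast
    from char_graphD(5)[OF R m(2)] obtain k where k: "odd k" "y ^ k = 1" by blast
    from odd_root_of_odd_root_of_unity[OF this m(1)] obtain d l where d: "d ^ m = y" "odd l" "d ^ l = 1" by blast
    have "d ^ n = w" if w: "(nmul n s, w) \<in> R" for n w
    proof -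
      define q where "q = n div m"
      have n: "n = q * m + n mod m" by (simp add: q_def)
      have q: "(nmul (q * m) s, y ^ q) \<in> R" using char_graph_nmul[OF R m(2), of q] by (simp add: nmul_mult)
      have "(nmul n s + - nmul (q * m) s, w * inverse (y ^ q)) \<in> R"
        by (intro char_graphD(2,3)[OF R] w q)
      moreover have "nmul n s + - nmul (q * m) s = nmul (n mod m) s"
        by (subst n, subst nmul_add) simp
      ultimately have "(nmul (n mod m) s, w * inverse (y ^ q)) \<in> R" by simp
      with least[of "n mod m"] m(1) have "n mod m = 0" by (cases "n mod m = 0") auto
      with n have n': "n = q * m" by simp
      hence "w = y ^ q" using char_graph_unique[OF R w] q by simp
      thus ?thesis by (simp add: n' d(1)[symmetric] power_mult[symmetric] mult.commute)
    qed
    with d show ?thesis by blast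
  qed
  then obtain d k where d: "odd k" "d ^ k = 1" and compat: "\<And>n y. (nmul n s, y) \<in> R \<Longrightarrow> d ^ n = y" by blast
  let ?R = "{(x + nmul a s - nmul b s, z * d ^ a / d ^ b) | x z a b. (x, z) \<in> R}"
  have mem: "(x + nmul a s - nmul b s, z * d ^ a / d ^ b) \<in> ?R" if "(x, z) \<in> R" for x z a b
    using that by blast
  have "char_graph ?R" by (rule char_graph_extend[OF R d compat])
  moreover have "R \<subseteq> ?R"
  proof
    fix p assume "p \<in> R"
    thus "p \<in> ?R" using mem[of "fst p" "snd p" 0 0] by simp
  qed
  moreover have "(s, d) \<in> ?R" using mem[OF char_graphD(1)[OF R], of 1 0] by simp
  ultimately show ?thesis by blast
qed

text \<open>By Zorn's lemma there is a maximal extension; its domain is everything, since any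
  missing \<open>s\<close> could be adjoined.\<close>

lemma char_graph_imp_odd_char:
  assumes R0: "char_graph R0"
  shows "\<exists>\<phi>. odd_char \<phi> \<and> (\<forall>(x, z)\<in>R0. \<phi> x = z)"
proof -
  define A where "A = {R. char_graph R \<and> R0 \<subseteq> R}"
  have "\<exists>M\<in>A. \<forall>X\<in>A. M \<subseteq> X \<longrightarrow> X = M"
  proof (rule subset_Zorn_nonempty)
    show "A \<noteq> {}" using R0 by (auto simp: A_def)
    fix C assume C: "C \<noteq> {}" "subset.chain A C"
    have CA: "char_graph R" "R0 \<subseteq> R" if "R \<in> C" for R
      using C(2) that by (auto simp: A_def subset_chain_def)
    have "char_graph (\<Union>C)"
      unfolding char_graph_def
    proof (intro conjI allI impI)
      obtain R where R: "R \<in> C" using C(1) by blast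
      show "(0, 1) \<in> \<Union>C" using char_graphD(1)[OF CA(1)[OF R]] R by blast
      show "(x + y, z * w) \<in> \<Union>C" if xy: "(x, z) \<in> \<Union>C" "(y, w) \<in> \<Union>C" for x z y w
      proof -
        from xy obtain R1 R2 where R12: "R1 \<in> C" "(x, z) \<in> R1" "R2 \<in> C" "(y, w) \<in> R2" by blast
        hence "R1 \<subseteq> R2 \<or> R2 \<subseteq> R1" using C(2) by (auto simp: subset_chain_def)
        then obtain R where R: "R \<in> C" "(x, z) \<in> R" "(y, w) \<in> R" using R12 by blast
        from char_graphD(2)[OF CA(1)[OF R(1)] R(2,3)] R(1) show ?thesis by blast
      qed
      show "(- x, inverse z) \<in> \<Union>C" if "(x, z) \<in> \<Union>C" for x z
        using that char_graphD(3)[OF CA(1)] by blast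
      show "z = 1" if "(0, z) \<in> \<Union>C" for z
        using that char_graphD(4)[OF CA(1)] by blast
      show "\<exists>k. odd k \<and> z ^ k = 1" if "(x, z) \<in> \<Union>C" for x z
        using that char_graphD(5)[OF CA(1)] by blast
    qed
    thus "\<Union>C \<in> A" using C(1) CA(2) by (auto simp: A_def)
  qed
  then obtain M where MA: "M \<in> A" and maxA: "\<forall>X\<in>A. M \<subseteq> X \<longrightarrow> X = M" by (elim bexE)
  have M: "char_graph M" "R0 \<subseteq> M" using MA by (simp_all add: A_def)
  have max: "X = M" if X: "char_graph X" "M \<subseteq> X" for X
  proof -
    have "X \<in> A" using X(1) subset_trans[OF M(2) X(2)] by (simp add: A_def)
    from bspec[OF maxA this] X(2) show ?thesis by (rule mp)
  qed
  have "\<exists>y. (s, y) \<in> M" for s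
  proof -
    from char_graph_extend_exists[OF M(1), of s] obtain R' y
      where R': "char_graph R'" "M \<subseteq> R'" "(s, y) \<in> R'" by (elim exE conjE)
    from max[OF R'(1,2)] R'(3) show ?thesis by blast
  qed
  hence "\<exists>\<phi>. \<forall>s. (s, \<phi> s) \<in> M" by (intro choice allI)
  then obtain \<phi> where "\<forall>s. (s, \<phi> s) \<in> M" by (rule exE)
  hence \<phi>: "(s, \<phi> s) \<in> M" for s by (rule spec)
  have eq: "\<phi> s = y" if "(s, y) \<in> M" for s y using char_graph_unique[OF M(1) \<phi> that] .
  have "odd_char \<phi>"
    unfolding odd_char_def
  proof (intro conjI allI)
    show "\<phi> (x + y) = \<phi> x * \<phi> y" for x y by (rule eq[OF char_graphD(2)[OF M(1) \<phi> \<phi>]])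
    show "\<exists>k. odd k \<and> \<phi> x ^ k = 1" for x by (rule char_graphD(5)[OF M(1) \<phi>])
  qed
  moreover have "\<forall>(x, z)\<in>R0. \<phi> x = z" using eq M(2) by blast
  ultimately show ?thesis by blast
qed

lemma odd_char_separates:
  fixes g :: "'a::ab_group_add"
  assumes two: "no_order_two TYPE('a)" and g: "g \<noteq> 0"
  shows "\<exists>\<phi>. odd_char \<phi> \<and> \<phi> g \<noteq> 1"
proof -
  have triv: "char_graph {(0::'a, 1)}" unfolding char_graph_def by (auto intro: exI[of _ 1])
  have "\<exists>n\<ge>2. odd n \<and> (\<forall>k. nmul k g = 0 \<longrightarrow> n dvd k)"
  proof (cases "\<exists>k>0. nmul k g = 0")
    case True
    then obtain k where "k > 0" "nmul k g = 0" by (elim exE conjE)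
    from torsion_order[OF two this] obtain n where n: "odd n" "\<forall>k. nmul k g = 0 \<longleftrightarrow> n dvd k"
      by (elim exE conjE)
    have "n \<noteq> 1" using spec[OF n(2), of 1] g by auto
    moreover have "n \<noteq> 0" using n(1) by (cases n) auto
    ultimately have "n \<ge> 2" by simp
    with n show ?thesis by (intro exI[of _ n]) simp
  next
    case False
    \<comment> \<open>For \<open>g\<close> of infinite order, any odd number above 1 can play the
      role of the order.\<close>
    have "3 dvd k" if "nmul k g = 0" for k
    proof -
      have "\<not> k > 0"
      proof
        assume "k > 0"
        with that have "\<exists>k>0. nmul k g = 0" by (intro exI[of _ k] conjI)
        with False show False by (rule notE)
      qed
      thus ?thesis by simp
    qed
    thus ?thesis by (intro exI[of _ 3]) simp
  qed
  then obtain n where n: "n \<ge> 2" "odd n" "\<forall>k. nmul k g = 0 \<longrightarrow> n dvd k" by (elim exE conjE)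
  obtain \<zeta> :: complex where z: "\<zeta> ^ n = 1" "\<zeta> \<noteq> 1"
  proof -
    have "card {z::complex. z ^ n = 1} = n" using n by (intro card_roots_unity_eq) simp
    hence "\<not> {z::complex. z ^ n = 1} \<subseteq> {1}" using n(1) card_mono[of "{1}" "{z::complex. z ^ n = 1}"] by auto
    thus ?thesis using that by blast
  qed
  have compat: "\<zeta> ^ k = y" if "(nmul k g, y) \<in> {(0, 1)}" for k y
  proof -
    have "n dvd k" "y = 1" using spec[OF n(3), of k] that by simp_all
    from this(1) obtain q where "k = n * q" by (rule dvdE)
    thus ?thesis using z(1) \<open>y = 1\<close> by (simp add: power_mult)
  qed
  let ?R = "{(x + nmul a g - nmul b g, z * \<zeta> ^ a / \<zeta> ^ b) | x z a b. (x, z) \<in> {(0, 1)}}"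
  have "char_graph ?R" by (rule char_graph_extend[OF triv n(2) z(1) compat])
  from char_graph_imp_odd_char[OF this] obtain \<phi> where \<phi>: "odd_char \<phi>" "\<forall>(x, z)\<in>?R. \<phi> x = z" by blast
  have "(0 + nmul 1 g - nmul 0 g, 1 * \<zeta> ^ 1 / \<zeta> ^ 0) \<in> ?R"
    by (rule CollectI, rule exI[of _ 0], rule exI[of _ 1], rule exI[of _ 1], rule exI[of _ 0]) simp
  from bspec[OF \<phi>(2) this] have "\<phi> g = \<zeta>" by simp
  with z(2) \<phi>(1) show ?thesis by auto
qed

text \<open>Dedekind's independence of characters, applied to the evaluation maps on the group of characters.\<close>

lemma odd_char_independence:
  fixes c :: "'a::ab_group_add \<Rightarrow> complex"
  assumes two: "no_order_two TYPE('a)" and "finite F"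
    and "\<And>\<phi>. odd_char \<phi> \<Longrightarrow> (\<Sum>g\<in>F. c g * \<phi> g) = 0"
    and "g \<in> F"
  shows "c g = 0"
  using assms(2-4)
proof (induction F arbitrary: c g)
  case (insert g0 F)
  have zero: "c h = 0" if h: "h \<in> F" for h
  proof -
    have "h - g0 \<noteq> 0" using insert.hyps(2) h by auto
    from odd_char_separates[OF two this] obtain \<theta> where \<theta>: "odd_char \<theta>" "\<theta> (h - g0) \<noteq> 1" by blast
    have "\<theta> h \<noteq> \<theta> g0"
      using odd_char_add[OF \<theta>(1), of "h - g0" g0] \<theta>(2) odd_char_nonzero[OF \<theta>(1), of g0] by simp
    \<comment> \<open>The induction hypothesis is applied to the coefficients multiplied by
      \<open>\<theta> g - \<theta> g0\<close>, which kills the term of \<open>g0\<close>.\<close>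
    moreover have "c h * (\<theta> h - \<theta> g0) = 0"
    proof (rule insert.IH[OF _ h])
      fix \<phi> :: "'a \<Rightarrow> complex" assume \<phi>: "odd_char \<phi>"
      have 1: "(\<Sum>g\<in>insert g0 F. c g * (\<phi> g * \<theta> g)) = 0"
        by (rule insert.prems(1)[OF odd_char_mult[OF \<phi> \<theta>(1)]])
      have 2: "(\<Sum>g\<in>insert g0 F. c g * \<phi> g) = 0" by (rule insert.prems(1)[OF \<phi>])
      have "(\<Sum>g\<in>insert g0 F. c g * (\<theta> g - \<theta> g0) * \<phi> g) =
          (\<Sum>g\<in>insert g0 F. c g * (\<phi> g * \<theta> g)) - \<theta> g0 * (\<Sum>g\<in>insert g0 F. c g * \<phi> g)"
        unfolding sum_distrib_left sum_subtractf[symmetric] by (simp add: algebra_simps)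
      thus "(\<Sum>g\<in>F. c g * (\<theta> g - \<theta> g0) * \<phi> g) = 0" using insert.hyps 1 2 by simp
    qed
    ultimately show ?thesis by simp
  qed
  have triv: "odd_char (\<lambda>_::'a. 1)" unfolding odd_char_def by (auto intro: exI[of _ 1])
  have "c g0 = 0" using insert.prems(1)[OF triv] insert.hyps zero by simp
  with zero insert.prems(2) show ?case by blast
qed simp

section \<open>Subset sums and characters\<close>

lemma finite_occurrences: "finite (occurrences A)"
  by (simp add: occurrences_def)

lemma occurrences_add:
  "occurrences (add_mset a A) = insert (a, count A a) (occurrences A)"
  by (auto simp: occurrences_def not_in_iff less_Suc_eq split: if_splits)

lemma new_occurrence: "(a, count A a) \<notin> occurrences A"
  by (simp add: occurrences_def)

lemma FS_empty: "FS {#} = {#0#}"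
  by (simp add: FS_def occurrences_def)

lemma FS_add: "FS (add_mset a A) = FS A + translate (FS A) a"
proof -
  let ?S = "occurrences A" and ?x = "(a, count A a)" and ?s = "\<lambda>T. \<Sum>(a, i)\<in>T. a"
  have inj: "inj_on (insert ?x) (Pow ?S)"
  proof (rule inj_onI)
    fix S T assume ST: "S \<in> Pow ?S" "T \<in> Pow ?S" "insert ?x S = insert ?x T"
    have "?x \<notin> S" "?x \<notin> T" using ST(1,2) new_occurrence[of a A] by auto
    thus "S = T" using ST(3) by (simp add: insert_ident)
  qed
  have disj: "Pow ?S \<inter> insert ?x ` Pow ?S = {}" using new_occurrence[of a A] by auto
  have "mset_set (Pow (insert ?x ?S)) = mset_set (Pow ?S) + image_mset (insert ?x) (mset_set (Pow ?S))"
    unfolding Pow_insert using disj finite_occurrences[of A]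
    by (simp add: mset_set_Union image_mset_mset_set[OF inj])
  hence "FS (add_mset a A) = FS A + image_mset (\<lambda>T. ?s (insert ?x T)) (mset_set (Pow ?S))"
    by (simp add: FS_def occurrences_add multiset.map_comp o_def)
  also have "image_mset (\<lambda>T. ?s (insert ?x T)) (mset_set (Pow ?S)) = image_mset (\<lambda>T. ?s T + a) (mset_set (Pow ?S))"
  proof (rule image_mset_cong)
    fix T assume "T \<in># mset_set (Pow ?S)"
    hence T: "T \<subseteq> ?S" using finite_occurrences[of A] by simp
    hence "?x \<notin> T" "finite T" using new_occurrence[of a A] finite_subset[OF T finite_occurrences] by auto
    thus "?s (insert ?x T) = ?s T + a" by (simp add: add.commute)
  qed
  also have "\<dots> = translate (FS A) a" by (simp add: translate_def FS_def multiset.map_comp o_def)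
  finally show ?thesis .
qed

lemma translate_union: "translate (S + T) s = translate S s + translate T s"
  by (simp add: translate_def)

lemma translate_translate: "translate (translate S s) t = translate S (s + t)"
  by (simp add: translate_def multiset.map_comp o_def add.assoc)

lemma translate_zero: "translate S 0 = S"
  by (simp add: translate_def)

lemma odd_char_sum_FS:
  assumes "odd_char \<phi>"
  shows "(\<Sum>x\<in>#FS A. \<phi> x) = (\<Prod>a\<in>#A. 1 + \<phi> a)"
proof (induction A)
  case empty
  show ?case by (simp add: FS_empty odd_char_zero[OF assms])
next
  case (add a A)
  have "(\<Sum>x\<in>#translate (FS A) a. \<phi> x) = (\<Sum>x\<in>#FS A. \<phi> x * \<phi> a)"
    by (simp add: translate_def multiset.map_comp o_def odd_char_add[OF assms])
  also have "\<dots> = (\<Sum>x\<in>#FS A. \<phi> x) * \<phi> a" by (rule sum_mset_distrib_right[symmetric])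
  finally show ?case using add by (simp add: FS_add algebra_simps)
qed

lemma odd_char_neq_minus_1: "odd_char \<phi> \<Longrightarrow> \<phi> x \<noteq> - 1"
proof
  assume c: "odd_char \<phi>" and m: "\<phi> x = - 1"
  from odd_char_odd[OF c, of x] obtain k where "odd k" "\<phi> x ^ k = 1" by (elim exE conjE)
  thus False by (simp add: m)
qed

lemma one_plus_odd_char_nonzero: "odd_char \<phi> \<Longrightarrow> 1 + \<phi> x \<noteq> 0"
  using odd_char_neq_minus_1[of \<phi> x] by (simp add: eq_neg_iff_add_eq_0 add.commute)

lemma sum_mset_eq_sum_count:
  fixes h :: "'a \<Rightarrow> real"
  assumes "finite F" "set_mset A \<subseteq> F"
  shows "(\<Sum>a\<in>#A. h a) = (\<Sum>g\<in>F. real (count A g) * h g)"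
  using assms(2)
proof (induction A)
  case (add x A)
  have "(\<Sum>g\<in>F. real (count (add_mset x A) g) * h g) = (\<Sum>g\<in>F. real (count A g) * h g + (if g = x then h g else 0))"
    by (intro sum.cong) (auto simp: algebra_simps)
  also have "\<dots> = (\<Sum>g\<in>F. real (count A g) * h g) + h x"
    using assms(1) add.prems by (simp add: sum.distrib)
  finally show ?case using add by simp
qed simp

lemma ln_norm_prod_odd_char:
  assumes "odd_char \<phi>"
  shows "ln (norm (\<Prod>a\<in>#A. 1 + \<phi> a)) = (\<Sum>a\<in>#A. ln (norm (1 + \<phi> a))) \<and> (\<Prod>a\<in>#A. 1 + \<phi> a) \<noteq> 0"
proof (induction A)
  case (add a A)
  thus ?case using one_plus_odd_char_nonzero[OF assms, of a] by (simp add: norm_mult ln_mult)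
qed simp

text \<open>The translation multiplies the product by \<open>\<phi> s\<close>, which has norm
  1.\<close>

lemma FS_translate_imp_log_relation:
  assumes c: "odd_char \<phi>" and FS: "FS A = translate (FS B) s"
    and F: "finite F" "set_mset A \<subseteq> F" "set_mset B \<subseteq> F"
  shows "(\<Sum>g\<in>F. of_int (int (count A g) - int (count B g)) * ln (norm (1 + \<phi> g))) = 0"
proof -
  have "(\<Prod>a\<in>#A. 1 + \<phi> a) = (\<Sum>x\<in>#FS B. \<phi> x * \<phi> s)"
    unfolding odd_char_sum_FS[OF c, symmetric] FS
    by (simp add: translate_def multiset.map_comp o_def odd_char_add[OF c])
  also have "\<dots> = (\<Prod>a\<in>#B. 1 + \<phi> a) * \<phi> s"
    unfolding odd_char_sum_FS[OF c, symmetric] by (rule sum_mset_distrib_right[symmetric])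
  finally have "norm (\<Prod>a\<in>#A. 1 + \<phi> a) = norm (\<Prod>a\<in>#B. 1 + \<phi> a)"
    by (simp add: norm_mult odd_char_norm[OF c])
  hence "(\<Sum>a\<in>#A. ln (norm (1 + \<phi> a))) = (\<Sum>a\<in>#B. ln (norm (1 + \<phi> a)))"
    using ln_norm_prod_odd_char[OF c, of A] ln_norm_prod_odd_char[OF c, of B] by simp
  thus ?thesis
    by (simp add: sum_mset_eq_sum_count[OF F(1,2)] sum_mset_eq_sum_count[OF F(1,3)] left_diff_distrib sum_subtractf)
qed

lemma unit_plus_one_notin_nonpos:
  fixes z :: complex
  assumes "norm z = 1" "z \<noteq> - 1"
  shows "1 + z \<notin> \<real>\<^sub>\<le>\<^sub>0"
proof
  assume "1 + z \<in> \<real>\<^sub>\<le>\<^sub>0"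
  hence *: "Re z \<le> - 1" "Im z = 0" by (auto simp: complex_nonpos_Reals_iff)
  have "\<bar>Re z\<bar> \<le> 1" using abs_Re_le_cmod[of z] assms(1) by simp
  with * have "z = - 1" by (simp add: complex_eq_iff)
  with assms(2) show False by (rule notE)
qed

text \<open>Since \<open>z\<close> is on the unit circle and not -1, the limit point
  \<open>1 + z\<close> lies off the branch cut, where the logarithm is continuous.\<close>

lemma abel_limit_unit_power:
  assumes z: "norm z = 1" "z \<noteq> - 1"
  shows "abel_limit (\<lambda>m. z ^ m) (ln (1 + z))"
proof -
  have "alternating_abel (\<lambda>m. z ^ m) r = ln (1 + of_real r * z)" if r: "0 < r" "r < 1" for r
  proof -
    have "(\<lambda>n. - ((- (of_real r * z)) ^ n) / of_nat n) sums ln (1 + of_real r * z)"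
      by (rule Ln_series') (use r z in \<open>simp add: norm_mult\<close>)
    also have "(\<lambda>n. - ((- (of_real r * z)) ^ n) / of_nat n) = (\<lambda>m. (-1) ^ Suc m * z ^ m * of_real (r ^ m / real m))"
      by (rule ext) (subst power_minus, simp add: power_mult_distrib)
    finally show ?thesis unfolding alternating_abel_def by (rule sums_unique[symmetric])
  qed
  hence ev: "\<forall>\<^sub>F r in at_left 1. ln (1 + of_real r * z) = alternating_abel (\<lambda>m. z ^ m) r"
    by (intro eventually_unit_interval) simp
  have "((\<lambda>r. ln (1 + complex_of_real r * z)) \<longlongrightarrow> ln (1 + of_real 1 * z)) (at_left 1)"
    by (intro tendsto_Ln tendsto_add tendsto_const tendsto_mult tendsto_of_real tendsto_ident_at)
      (use unit_plus_one_notin_nonpos[OF z] in simp)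
  from Lim_transform_eventually[OF this ev]
  have "(alternating_abel (\<lambda>m. z ^ m) \<longlongrightarrow> ln (1 + z)) (at_left 1)" by simp
  moreover have "bounded (range (\<lambda>m. z ^ m))"
    by (rule boundedI[of _ 1]) (auto simp: norm_power z(1))
  ultimately show ?thesis by (simp add: abel_limit_def)
qed

text \<open>The points \<open>p i\<close> may coincide, so only the total coefficient at each point
  vanishes.\<close>

lemma odd_char_independence_family:
  fixes p :: "'i \<Rightarrow> 'a::ab_group_add" and c :: "'i \<Rightarrow> complex"
  assumes two: "no_order_two TYPE('a)" and I: "finite I"
    and zero: "\<And>\<phi>. odd_char \<phi> \<Longrightarrow> (\<Sum>i\<in>I. c i * \<phi> (p i)) = 0"
  shows "(\<Sum>i\<in>{i\<in>I. p i = h}. c i) = 0"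
proof (cases "h \<in> p ` I")
  case True
  show ?thesis
  proof (rule odd_char_independence[OF two, of "p ` I" "\<lambda>h. \<Sum>i\<in>{i\<in>I. p i = h}. c i"])
    fix \<phi> :: "'a \<Rightarrow> complex" assume \<phi>: "odd_char \<phi>"
    have "(\<Sum>h\<in>p ` I. (\<Sum>i\<in>{i\<in>I. p i = h}. c i) * \<phi> h) = (\<Sum>h\<in>p ` I. \<Sum>i\<in>{i\<in>I. p i = h}. c i * \<phi> (p i))"
      by (simp add: sum_distrib_right)
    also have "\<dots> = (\<Sum>i\<in>I. c i * \<phi> (p i))"
      by (rule sum.image_gen[symmetric, OF I])
    finally show "(\<Sum>h\<in>p ` I. (\<Sum>i\<in>{i\<in>I. p i = h}. c i) * \<phi> h) = 0" using zero[OF \<phi>] by simp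
  qed (use I True in simp_all)
next
  case False
  hence "{i\<in>I. p i = h} = {}" by auto
  thus ?thesis by (simp only: sum.empty)
qed

text \<open>Doubling keeps \<open>g\<close> in the finite support, so two of the elements
  \<open>nmul (2 ^ i) g\<close> coincide.\<close>

lemma doubling_invariant_torsion:
  fixes f :: "'a::ab_group_add \<Rightarrow> int"
  assumes two: "no_order_two TYPE('a)" and fin: "finite {g. f g \<noteq> 0}"
    and dbl: "\<And>g. f (g + g) = f g" and g: "f g \<noteq> 0"
  shows "\<exists>n. odd n \<and> (\<forall>k. nmul k g = 0 \<longleftrightarrow> n dvd k)"
proof -
  have pow: "f (nmul (2 ^ i) g) = f g" for i
  proof (induction i)
    case (Suc i)
    have "nmul (2 ^ Suc i) g = nmul (2 ^ i) g + nmul (2 ^ i) g"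
      by (simp only: power_Suc nmul_mult nmul_2)
    thus ?case using Suc dbl by simp
  qed simp
  have "range (\<lambda>i. nmul (2 ^ i) g) \<subseteq> {g. f g \<noteq> 0}" using pow g by auto
  hence "finite (range (\<lambda>i. nmul (2 ^ i) g))" by (rule finite_subset) (rule fin)
  hence "\<not> inj (\<lambda>i::nat. nmul (2 ^ i) g)" using finite_imageD infinite_UNIV_nat by blast
  then obtain i j :: nat where ij: "i < j" "nmul (2 ^ i) g = nmul (2 ^ j) g"
    by (metis (mono_tags, lifting) injI linorder_less_linear)
  have "(2::nat) ^ i < 2 ^ j" using ij(1) by simp
  hence pos: "(2::nat) ^ j - 2 ^ i > 0" by simp
  have "2 ^ j = (2 ^ j - 2 ^ i) + (2::nat) ^ i" using \<open>2 ^ i < 2 ^ j\<close> by simp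
  hence "nmul (2 ^ j) g = nmul (2 ^ j - 2 ^ i) g + nmul (2 ^ i) g" by (metis nmul_add)
  hence "nmul (2 ^ j - 2 ^ i) g = 0" using ij(2) by simp
  from torsion_order[OF two pos this] show ?thesis .
qed

section \<open>The two relations satisfied by f\<close>

context
  fixes f :: "'a::ab_group_add \<Rightarrow> int" and F :: "'a set"
  assumes two: "no_order_two TYPE('a)"
    and F: "finite F" "\<And>g. g \<in> F \<Longrightarrow> - g \<in> F" and supp: "\<And>g. g \<notin> F \<Longrightarrow> f g = 0"
    and even: "\<And>g. f (- g) = f g"
    and log_relation: "\<And>\<phi>. odd_char \<phi> \<Longrightarrow> (\<Sum>g\<in>F. of_int (f g) * ln (norm (1 + \<phi> g))) = 0"
begin

text \<open>The log relation controls only the real part of the limit. The imaginary part vanishes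
  because \<open>f\<close> is even and \<open>\<phi> (- g)\<close> is the conjugate of
  \<open>\<phi> g\<close>.\<close>

lemma abel_limit_char_sum:
  assumes c: "odd_char \<phi>"
  shows "abel_limit (\<lambda>m. \<Sum>g\<in>F. of_int (f g) * \<phi> g ^ m) 0"
proof -
  let ?L = "\<Sum>g\<in>F. of_int (f g) * ln (1 + \<phi> g)"
  have lim: "abel_limit (\<lambda>m. \<Sum>g\<in>F. of_int (f g) * \<phi> g ^ m) ?L"
    using odd_char_norm[OF c] odd_char_neq_minus_1[OF c]
    by (intro abel_limit_sum F abel_limit_cmult abel_limit_unit_power) simp_all
  have "Re ?L = (\<Sum>g\<in>F. of_int (f g) * ln (norm (1 + \<phi> g)))"
    by (simp add: Re_Ln one_plus_odd_char_nonzero[OF c])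
  hence re: "Re ?L = 0" using log_relation[OF c] by simp
  have bij: "bij_betw uminus F F"
    by (rule bij_betw_byWitness[where f' = uminus]) (use F(2) in auto)
  have "?L = (\<Sum>g\<in>F. of_int (f (- g)) * ln (1 + \<phi> (- g)))"
    by (rule sum.reindex_bij_betw[OF bij, symmetric])
  also have "\<dots> = cnj ?L"
  proof -
    have "ln (1 + \<phi> (- g)) = cnj (ln (1 + \<phi> g))" for g
      using cnj_Ln[OF unit_plus_one_notin_nonpos[OF odd_char_norm[OF c, of g] odd_char_neq_minus_1[OF c]]]
      by (simp add: odd_char_minus[OF c])
    thus ?thesis by (simp add: even)
  qed
  finally have "Im ?L = Im (cnj ?L)" by (rule arg_cong)
  hence "Im ?L = - Im ?L" by (simp only: cnj.simps)
  hence "Im ?L = 0" by linarith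
  with re have "?L = 0" by (simp add: complex_eq_iff)
  with lim show ?thesis by simp
qed

text \<open>The dilate by \<open>d\<close> of a character sum is the character sum of the
  \<open>d\<close>-th power of \<open>\<phi>\<close>, again of odd order; so the Abel limits of all
  dilates vanish.\<close>

lemma char_sum_relations:
  assumes c: "odd_char \<phi>" and N: "odd N" "\<And>g. g \<in> F \<Longrightarrow> f g \<noteq> 0 \<Longrightarrow> \<phi> g ^ N = 1"
  shows "(\<Sum>g\<in>F. of_int (f g) * \<phi> g ^ 2) = (\<Sum>g\<in>F. of_int (f g) * \<phi> g ^ 1)"
    and "(\<Sum>j | j < N \<and> coprime j N. \<Sum>g\<in>F. of_int (f g) * \<phi> g ^ j) = 0"
proof -
  have per: "(\<Sum>g\<in>F. of_int (f g) * \<phi> g ^ (m + N)) = (\<Sum>g\<in>F. of_int (f g) * \<phi> g ^ m)" for m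
  proof (rule sum.cong[OF refl])
    fix g assume "g \<in> F"
    thus "of_int (f g) * \<phi> g ^ (m + N) = of_int (f g) * \<phi> g ^ m"
      using N(2)[of g] by (cases "f g = 0") (simp_all add: power_add)
  qed
  have lim: "abel_limit (\<lambda>m. \<Sum>g\<in>F. of_int (f g) * \<phi> g ^ (d * m)) 0" for d
    using abel_limit_char_sum[OF odd_char_power[OF c, of d]] by (simp add: power_mult)
  show "(\<Sum>g\<in>F. of_int (f g) * \<phi> g ^ 2) = (\<Sum>g\<in>F. of_int (f g) * \<phi> g ^ 1)"
    by (rule abel_vanishing_periodic(1)[where v = "\<lambda>m. \<Sum>g\<in>F. of_int (f g) * \<phi> g ^ m", OF N(1) per lim])
  show "(\<Sum>j | j < N \<and> coprime j N. \<Sum>g\<in>F. of_int (f g) * \<phi> g ^ j) = 0"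
    by (rule abel_vanishing_periodic(2)[where v = "\<lambda>m. \<Sum>g\<in>F. of_int (f g) * \<phi> g ^ m", OF N(1) per lim])
qed

lemma double_eq_iff: "g + g = h + h \<longleftrightarrow> g = (h::'a)"
proof
  assume "g + g = h + h"
  hence "(g - h) + (g - h) = 0" by (simp add: algebra_simps)
  hence "g - h = 0" using two unfolding no_order_two_def by (elim allE impE)
  thus "g = h" by simp
qed simp

text \<open>\<open>f\<close> and its pushforward under doubling have equal character sums, hence
  agree by independence; doubling is injective, so the fibre over \<open>g + g\<close> is just
  \<open>g\<close>.\<close>

lemma doubling_invariant: "f (g + g) = f g"
proof -
  let ?c = "\<lambda>h. complex_of_int (f h) - (\<Sum>g\<in>{g\<in>F. g + g = h}. of_int (f g))"
  let ?F = "F \<union> (\<lambda>g. g + g) ` F"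
  have fin: "finite ?F" using F(1) by simp
  have rel: "(\<Sum>h\<in>?F. ?c h * \<phi> h) = 0" if c: "odd_char \<phi>" for \<phi>
  proof -
    \<comment> \<open>\<open>N\<close> depends on \<open>\<phi>\<close> and is built from the orders
      of its values, because elements of \<open>F\<close> may still have infinite order
      here.\<close>
    have "\<exists>k. odd k \<and> \<phi> g ^ k = 1" for g by (rule odd_char_odd[OF c])
    hence "\<exists>k. \<forall>g. odd (k g) \<and> \<phi> g ^ k g = 1" by (intro choice allI)
    then obtain k where k: "\<forall>g. odd (k g) \<and> \<phi> g ^ k g = 1" by (rule exE)
    define N where "N = (\<Prod>g\<in>F. k g)"
    have "odd N" unfolding N_def using F(1) k by (induction F rule: finite_induct) auto
    have "\<phi> g ^ N = 1" if "g \<in> F" for g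
    proof -
      have "k g dvd N" unfolding N_def using F(1) that by (rule dvd_prodI)
      then obtain q where "N = k g * q" by (rule dvdE)
      thus ?thesis using k by (simp add: power_mult)
    qed
    with char_sum_relations(1)[OF c \<open>odd N\<close>]
    have eq: "(\<Sum>g\<in>F. of_int (f g) * \<phi> g ^ 2) = (\<Sum>g\<in>F. of_int (f g) * \<phi> g)" by simp
    have "(\<Sum>h\<in>?F. ?c h * \<phi> h) = (\<Sum>h\<in>?F. of_int (f h) * \<phi> h) - (\<Sum>h\<in>?F. \<Sum>g\<in>{g\<in>F. g + g = h}. of_int (f g) * \<phi> (g + g))"
      unfolding sum_subtractf[symmetric] left_diff_distrib sum_distrib_right by (intro sum.cong refl arg_cong2[of _ _ _ _ "(-)"]) simp
    also have "(\<Sum>h\<in>?F. of_int (f h) * \<phi> h) = (\<Sum>h\<in>F. of_int (f h) * \<phi> h)"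
      using fin supp by (intro sum.mono_neutral_right) auto
    also have "(\<Sum>h\<in>?F. \<Sum>g\<in>{g\<in>F. g + g = h}. of_int (f g) * \<phi> (g + g)) = (\<Sum>g\<in>F. of_int (f g) * \<phi> (g + g))"
      by (rule sum.group[OF F(1) fin]) simp
    also have "\<dots> = (\<Sum>g\<in>F. of_int (f g) * \<phi> g ^ 2)" by (simp add: odd_char_add[OF c] power2_eq_square)
    finally show ?thesis using eq by simp
  qed
  have c0: "?c (g + g) = 0"
  proof (cases "g + g \<in> ?F")
    case True
    show ?thesis by (rule odd_char_independence[OF two fin _ True, of ?c]) (rule rel)
  next
    case False
    have "f (g + g) = 0" using False by (intro supp) simp
    moreover have "{g'\<in>F. g' + g' = g + g} = {}"
    proof (rule equals0I)
      fix x assume "x \<in> {g'\<in>F. g' + g' = g + g}"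
      hence "x \<in> F" "g + g = x + x" by simp_all
      hence "g + g \<in> (\<lambda>g. g + g) ` F" by (intro image_eqI[of _ _ x])
      with False show False by simp
    qed
    ultimately show ?thesis by (simp only: sum.empty of_int_0 diff_zero)
  qed
  have "(\<Sum>g'\<in>{g'\<in>F. g' + g' = g + g}. complex_of_int (f g')) = of_int (f g)"
  proof (cases "g \<in> F")
    case True
    hence "{g'\<in>F. g' + g' = g + g} = {g}" by (auto simp: double_eq_iff)
    thus ?thesis by simp
  next
    case False
    hence "{g'\<in>F. g' + g' = g + g} = {}" by (auto simp: double_eq_iff)
    thus ?thesis by (simp only: sum.empty supp[OF False] of_int_0)
  qed
  with c0 have "complex_of_int (f (g + g)) = of_int (f g)" by simp
  thus ?thesis by simp
qed

lemma add_subgroup_nmul: "add_subgroup H \<Longrightarrow> g \<in> H \<Longrightarrow> nmul n g \<in> H"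
  by (induction n) (auto simp: add_subgroup_def)

text \<open>The support is torsion now, so one \<open>N\<close> serves all characters and
  independence applies to the points \<open>nmul j g\<close> with \<open>j\<close> a unit modulo
  \<open>N\<close>. Such a multiple lies in \<open>H\<close> exactly when \<open>g\<close> does, so
  adding the coefficients over \<open>H\<close> gives \<open>card J\<close> times the wanted
  sum.\<close>

lemma subgroup_sum_eq_0:
  assumes H: "add_subgroup H"
  shows "(\<Sum>g\<in>{g\<in>F. g \<in> H}. f g) = 0"
proof -
  define S where "S = {g\<in>F. f g \<noteq> 0}"
  have S: "finite S" "\<And>g. g \<in> S \<Longrightarrow> f g \<noteq> 0" using F(1) by (auto simp: S_def)
  have "\<exists>n. odd n \<and> nmul n g = 0" if "g \<in> S" for g
  proof -
    have "finite {g. f g \<noteq> 0}" by (rule finite_subset[OF _ F(1)]) (use supp in auto)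
    from doubling_invariant_torsion[OF two this doubling_invariant S(2)[OF that]] obtain n where n: "odd n" "\<forall>k. nmul k g = 0 \<longleftrightarrow> n dvd k"
      by (elim exE conjE)
    with spec[OF n(2), of n] show ?thesis by (intro exI[of _ n]) simp
  qed
  hence "\<exists>k. \<forall>g\<in>S. odd (k g) \<and> nmul (k g) g = 0" by (intro bchoice ballI)
  then obtain k where k: "\<forall>g\<in>S. odd (k g) \<and> nmul (k g) g = 0" by (rule exE)
  define N where "N = (\<Prod>g\<in>S. k g)"
  have "odd N" unfolding N_def using S(1) k by (induction S rule: finite_induct) auto
  have N: "nmul N g = 0" if "g \<in> S" for g
  proof -
    have "k g dvd N" unfolding N_def using S(1) that by (rule dvd_prodI)
    then obtain q where "N = k g * q" by (rule dvdE)
    hence "N = q * k g" by simp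
    thus ?thesis using k that by (simp add: nmul_mult)
  qed
  have N0: "N > 0" using \<open>odd N\<close> by (cases N) auto
  define J where "J = {j. j < N \<and> coprime j N}"
  \<comment> \<open>\<open>1 mod N\<close> instead of 1, because for \<open>N = 1\<close> the set
    \<open>J\<close> is \<open>{0}\<close>.\<close>
  have J: "finite J" "1 mod N \<in> J" using N0 by (simp_all add: J_def)
  let ?I = "J \<times> S" and ?p = "\<lambda>(j, g). nmul j g" and ?c = "\<lambda>(j::nat, g). complex_of_int (f g)"
  have zero: "(\<Sum>i\<in>{i\<in>?I. ?p i = h}. ?c i) = 0" for h
  proof (rule odd_char_independence_family[OF two])
    fix \<phi> :: "'a \<Rightarrow> complex" assume c: "odd_char \<phi>"
    have "(\<Sum>j\<in>J. \<Sum>g\<in>F. of_int (f g) * \<phi> g ^ j) = 0"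
      unfolding J_def
    proof (rule char_sum_relations(2)[OF c \<open>odd N\<close>])
      fix g assume "g \<in> F" "f g \<noteq> 0"
      hence "nmul N g = 0" by (intro N) (simp add: S_def)
      thus "\<phi> g ^ N = 1" using odd_char_nmul[OF c, of N g] odd_char_zero[OF c] by simp
    qed
    also have "(\<Sum>j\<in>J. \<Sum>g\<in>F. of_int (f g) * \<phi> g ^ j) = (\<Sum>j\<in>J. \<Sum>g\<in>S. of_int (f g) * \<phi> g ^ j)"
      using F(1) by (intro sum.cong refl sum.mono_neutral_right) (auto simp: S_def)
    also have "\<dots> = (\<Sum>i\<in>?I. ?c i * \<phi> (?p i))"
      by (simp add: sum.cartesian_product case_prod_unfold odd_char_nmul[OF c])
    finally show "(\<Sum>i\<in>?I. ?c i * \<phi> (?p i)) = 0" .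
  qed (use J(1) S(1) in simp)
  have iff: "nmul j g \<in> H \<longleftrightarrow> g \<in> H" if j: "j \<in> J" and g: "g \<in> S" for j g
  proof
    have "coprime j N" using j by (simp add: J_def)
    from cong_solve_coprime_nat[OF this] obtain l where l: "[j * l = Suc 0] (mod N)" by (rule exE)
    assume "nmul j g \<in> H"
    hence "nmul l (nmul j g) \<in> H" by (rule add_subgroup_nmul[OF H])
    hence "nmul (j * l) g \<in> H" by (simp only: nmul_mult[symmetric] mult.commute)
    moreover have "nmul (j * l) g = nmul (Suc 0) g"
      using nmul_mod[OF N[OF g], of "j * l"] nmul_mod[OF N[OF g], of "Suc 0"] l
      unfolding nat_cong_def by simp
    ultimately show "g \<in> H" by simp
  qed (rule add_subgroup_nmul[OF H])
  have eqset: "{i\<in>?I. ?p i \<in> H} = J \<times> {g\<in>S. g \<in> H}" using iff by auto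
  have "(\<Sum>i\<in>{i\<in>?I. ?p i \<in> H}. ?c i) = (\<Sum>h\<in>?p ` ?I \<inter> H. \<Sum>i\<in>{i\<in>{i\<in>?I. ?p i \<in> H}. ?p i = h}. ?c i)"
    by (rule sum.group[symmetric]) (use J(1) S(1) in auto)
  also have "\<dots> = (\<Sum>h\<in>?p ` ?I \<inter> H. \<Sum>i\<in>{i\<in>?I. ?p i = h}. ?c i)"
    by (intro sum.cong refl) auto
  also have "\<dots> = 0" by (simp only: zero sum.neutral_const)
  finally have "(\<Sum>j\<in>J. \<Sum>g\<in>{g\<in>S. g \<in> H}. complex_of_int (f g)) = 0"
    unfolding eqset by (simp only: sum.cartesian_product)
  hence "of_nat (card J) * complex_of_int (\<Sum>g\<in>{g\<in>S. g \<in> H}. f g) = 0" by simp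
  moreover have "card J > 0" using J by (auto simp: card_gt_0_iff)
  ultimately have "(\<Sum>g\<in>{g\<in>S. g \<in> H}. f g) = 0" by (simp del: of_int_sum)
  moreover have "(\<Sum>g\<in>{g\<in>F. g \<in> H}. f g) = (\<Sum>g\<in>{g\<in>S. g \<in> H}. f g)"
    using F(1) by (intro sum.mono_neutral_right) (auto simp: S_def)
  ultimately show ?thesis by simp
qed

end

theorem FS_translate_imp_V:
  fixes A B :: "'a::ab_group_add multiset"
  assumes two: "no_order_two TYPE('a)" and FS: "FS A = translate (FS B) s"
  shows "(\<lambda>g. int (count A g) - int (count B g)) \<in> V"
proof -
  define \<mu> where "\<mu> g = int (count A g) - int (count B g)" for g
  define F where "F = set_mset (A + B) \<union> uminus ` set_mset (A + B)"
  define f where "f g = \<mu> g + \<mu> (- g)" for g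
  have F: "finite F" "\<And>g. g \<in> F \<Longrightarrow> - g \<in> F" "set_mset A \<subseteq> F" "set_mset B \<subseteq> F"
    by (auto simp: F_def)
  have mu0: "\<mu> g = 0" if "g \<notin> F" for g
  proof -
    have "g \<notin># A" "g \<notin># B" using that F(3,4) by auto
    thus ?thesis by (simp add: \<mu>_def not_in_iff)
  qed
  have bij: "bij_betw uminus {g\<in>F. g \<in> H} {g\<in>F. g \<in> H}" if "\<And>g. g \<in> H \<Longrightarrow> - g \<in> H" for H
    by (rule bij_betw_byWitness[where f' = uminus]) (use F(2) that in auto)
  have supp: "f g = 0" if "g \<notin> F" for g
  proof -
    have "- g \<notin> F" using F(2)[of "- g"] that by auto
    thus ?thesis using mu0 that by (simp add: f_def)
  qed
  have ev: "f (- g) = f g" for g by (simp add: f_def)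
  have log: "(\<Sum>g\<in>F. of_int (f g) * ln (norm (1 + \<phi> g))) = 0" if c: "odd_char \<phi>" for \<phi>
  proof -
    let ?l = "\<lambda>g. ln (norm (1 + \<phi> g))"
    have "norm (1 + \<phi> (- g)) = norm (1 + \<phi> g)" for g
      using complex_mod_cnj[of "1 + \<phi> g"] by (simp add: odd_char_minus[OF c])
    moreover have "(\<Sum>g\<in>F. of_int (\<mu> (- g)) * ?l (- g)) = (\<Sum>g\<in>F. of_int (\<mu> g) * ?l g)"
      using sum.reindex_bij_betw[OF bij[of UNIV], of "\<lambda>g. of_int (\<mu> g) * ?l g"] by simp
    moreover have "(\<Sum>g\<in>F. of_int (\<mu> g) * ?l g) = 0"
      unfolding \<mu>_def by (rule FS_translate_imp_log_relation[OF c FS F(1,3,4)])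
    ultimately show ?thesis by (simp add: f_def distrib_right sum.distrib)
  qed
  have dbl: "f (g + g) = f g" for g
    by (rule doubling_invariant[of F f, OF two F(1,2) supp ev log])
  have sums: "(\<Sum>g\<in>{g\<in>H. \<mu> g \<noteq> 0}. \<mu> g) = 0" if H: "add_subgroup H" for H
  proof -
    have neg: "- g \<in> H" if "g \<in> H" for g using H that by (simp add: add_subgroup_def)
    \<comment> \<open>As \<open>H\<close> is closed under negation, the sum of \<open>f\<close> over
      it is twice that of \<open>\<mu>\<close>.\<close>
    have "0 = (\<Sum>g\<in>{g\<in>F. g \<in> H}. f g)"
      by (rule subgroup_sum_eq_0[of F f, OF two F(1,2) supp ev log H, symmetric])
    also have "\<dots> = (\<Sum>g\<in>{g\<in>F. g \<in> H}. \<mu> g) + (\<Sum>g\<in>{g\<in>F. g \<in> H}. \<mu> (- g))"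
      by (simp add: f_def sum.distrib)
    also have "(\<Sum>g\<in>{g\<in>F. g \<in> H}. \<mu> (- g)) = (\<Sum>g\<in>{g\<in>F. g \<in> H}. \<mu> g)"
      by (rule sum.reindex_bij_betw[OF bij]) (rule neg)
    finally have "(\<Sum>g\<in>{g\<in>F. g \<in> H}. \<mu> g) = 0" by simp
    moreover have "(\<Sum>g\<in>{g\<in>F. g \<in> H}. \<mu> g) = (\<Sum>g\<in>{g\<in>H. \<mu> g \<noteq> 0}. \<mu> g)"
      using F(1) mu0 by (intro sum.mono_neutral_right) auto
    ultimately show ?thesis by simp
  qed
  have "finite {g. \<mu> g \<noteq> 0}" by (rule finite_subset[OF _ F(1)]) (use mu0 in auto)
  moreover have "\<mu> g + \<mu> (- g) = \<mu> (g + g) + \<mu> (- (g + g))" for g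
    using dbl[of g] by (simp only: f_def)
  ultimately have "\<mu> \<in> V" using sums by (simp add: V_def)
  thus ?thesis by (simp only: \<mu>_def[abs_def])
qed

section \<open>Subset sums under the moves\<close>

lemma FS_union_translate:
  assumes "FS Y' = translate (FS Y) s"
  shows "FS (X + Y') = translate (FS (X + Y)) s"
proof (induction X)
  case (add x X)
  thus ?case by (simp add: FS_add translate_union translate_translate add.commute)
qed (simp add: assms)

lemma translate_multiples:
  "translate (image_mset (\<lambda>j. nmul j h) S) (nmul k h) = image_mset (\<lambda>j. nmul (j + k) h) S"
  by (simp add: translate_def multiset.map_comp o_def nmul_add)

lemma image_mset_lessThan_add:
  "image_mset p (mset_set {..<m + L :: nat}) =
    image_mset p (mset_set {..<L}) + image_mset (\<lambda>j. p (j + L)) (mset_set {..<m})"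
  by (induction m) (simp_all add: lessThan_Suc)

text \<open>Binary expansion: each \<open>j < 2 ^ k\<close> arises from exactly one set of exponents
  below \<open>k\<close>.\<close>

lemma FS_powers_of_two:
  "FS (image_mset (\<lambda>i. nmul (2 ^ i) h) (mset_set {..<k})) = image_mset (\<lambda>j. nmul j h) (mset_set {..<2 ^ k})"
proof (induction k)
  case (Suc k)
  have "(2::nat) ^ Suc k = 2 ^ k + 2 ^ k" by simp
  thus ?case using Suc
    by (simp only: image_mset_lessThan_add) (simp add: lessThan_Suc FS_add translate_multiples)
qed (simp add: FS_empty lessThan_Suc)

lemma U_length_dvd:
  fixes n :: nat
  shows "U_length (int n) = (LEAST k. k \<ge> 1 \<and> (n dvd 2 ^ k - 1 \<or> n dvd 2 ^ k + 1))"
proof -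
  have "[2 ^ k = 1] (mod int n) \<longleftrightarrow> n dvd 2 ^ k - 1" for k
  proof -
    have "(2::int) ^ k - 1 = int (2 ^ k - 1)" by (simp add: of_nat_diff)
    thus ?thesis by (simp only: cong_iff_dvd_diff int_dvd_int_iff)
  qed
  moreover have "[2 ^ k = - 1] (mod int n) \<longleftrightarrow> n dvd 2 ^ k + 1" for k
  proof -
    have "(2::int) ^ k - (- 1) = int (2 ^ k + 1)" by simp
    thus ?thesis by (simp only: cong_iff_dvd_diff int_dvd_int_iff)
  qed
  ultimately show ?thesis by (simp only: U_length_def)
qed

lemma U_length_props:
  fixes n :: nat
  assumes "odd n"
  defines "k \<equiv> U_length (int n)"
  shows "k \<ge> 1" and "n dvd 2 ^ k - 1 \<or> n dvd 2 ^ k + 1"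
    and "\<And>j. 1 \<le> j \<Longrightarrow> j < k \<Longrightarrow> \<not> n dvd 2 ^ j - 1 \<and> \<not> n dvd 2 ^ j + 1"
proof -
  let ?P = "\<lambda>k. k \<ge> 1 \<and> (n dvd 2 ^ k - 1 \<or> n dvd 2 ^ k + 1)"
  have "n > 0" using assms(1) by (cases n) auto
  have "[2 ^ totient n = 1] (mod n)" by (rule euler_theorem) (use assms(1) in simp)
  hence "n dvd 2 ^ totient n - 1" by (rule cong_to_1_nat)
  hence "?P (totient n)" using \<open>n > 0\<close> by (simp add: Suc_le_eq)
  hence "?P k" unfolding k_def U_length_dvd by (rule LeastI)
  thus "k \<ge> 1" "n dvd 2 ^ k - 1 \<or> n dvd 2 ^ k + 1" by simp_all
  show "\<not> n dvd 2 ^ j - 1 \<and> \<not> n dvd 2 ^ j + 1" if "1 \<le> j" "j < k" for j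
    using not_less_Least[OF that(2)[unfolded k_def U_length_dvd]] that(1) by simp
qed

lemma dvd_two_power_mult:
  fixes n x :: nat
  assumes "odd n" "n dvd 2 ^ i * x"
  shows "n dvd x"
proof -
  have "coprime n (2 ^ i)" using assms(1) by simp
  thus ?thesis using assms(2) by (simp add: coprime_dvd_mult_right_iff)
qed

context
  fixes h :: "'a::ab_group_add" and n :: nat
  assumes n: "odd n" "n \<ge> 3" and ord: "\<And>j. nmul j h = 0 \<longleftrightarrow> n dvd j"
begin

lemma inj_on_two_powers: "inj_on (\<lambda>i. nmul (2 ^ i) h) {..<U_length (int n)}"
proof (rule linorder_inj_onI')
  fix i j assume ij: "i \<in> {..<U_length (int n)}" "j \<in> {..<U_length (int n)}" "i < j"
  show "nmul (2 ^ i) h \<noteq> nmul (2 ^ j) h"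
  proof
    assume eq: "nmul (2 ^ i) h = nmul (2 ^ j) h"
    obtain t where t: "(2::nat) ^ (j - i) = Suc t" by (cases "(2::nat) ^ (j - i)") simp_all
    have "(2::nat) ^ j = 2 ^ i * 2 ^ (j - i)" using ij(3) by (simp add: power_add[symmetric])
    hence "(2::nat) ^ j = 2 ^ i * t + 2 ^ i" unfolding t by simp
    hence "nmul (2 ^ j) h = nmul (2 ^ i * t) h + nmul (2 ^ i) h" by (simp only: nmul_add)
    hence "nmul (2 ^ i * t) h = 0" using eq by simp
    hence "n dvd 2 ^ i * t" by (simp only: ord)
    hence "n dvd t" by (rule dvd_two_power_mult[OF n(1)])
    hence "n dvd 2 ^ (j - i) - 1" by (simp add: t)
    with U_length_props(3)[OF n(1), of "j - i"] ij show False by simp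
  qed
qed

text \<open>For distinct exponents this is the minimality of the length with respect to -1; for
  equal ones, \<open>n\<close> does not divide 2. It is what later allows signs to be chosen freely
  on the whole set.\<close>

lemma two_powers_minus_disjoint:
  assumes "i < U_length (int n)" "j < U_length (int n)"
  shows "nmul (2 ^ i) h \<noteq> - nmul (2 ^ j) h"
proof -
  have main: "nmul (2 ^ i) h + nmul (2 ^ j) h \<noteq> 0" if "i \<le> j" "j < U_length (int n)" for i j
  proof
    assume "nmul (2 ^ i) h + nmul (2 ^ j) h = 0"
    hence "n dvd 2 ^ i + 2 ^ j" by (simp only: nmul_add[symmetric] ord)
    moreover have "(2::nat) ^ j = 2 ^ i * 2 ^ (j - i)" using that(1) by (simp add: power_add[symmetric])
    hence "(2::nat) ^ i + 2 ^ j = 2 ^ i * (2 ^ (j - i) + 1)" by simp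
    ultimately have "n dvd 2 ^ i * (2 ^ (j - i) + 1)" by simp
    hence dv: "n dvd 2 ^ (j - i) + 1" by (rule dvd_two_power_mult[OF n(1)])
    show False
    proof (cases "i = j")
      case True
      with dv have "n dvd 2" by (simp add: numeral_2_eq_2)
      hence "n \<le> 2" by (rule dvd_imp_le) simp
      with n(2) show False by simp
    next
      case False
      with that U_length_props(3)[OF n(1), of "j - i"] dv show False by simp
    qed
  qed
  have "nmul (2 ^ i) h + nmul (2 ^ j) h \<noteq> 0"
    using main[of i j] main[of j i] assms by (cases "i \<le> j") (simp_all add: add.commute)
  thus ?thesis by (simp add: eq_neg_iff_add_eq_0)
qed

lemma multiples_add_period:
  "image_mset (\<lambda>j. nmul j h) (mset_set {..<c * n}) =
    repeat_mset c (image_mset (\<lambda>j. nmul j h) (mset_set {..<n}))"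
proof (induction c)
  case (Suc c)
  have "nmul n h = 0" by (simp add: ord)
  hence "nmul (j + n) h = nmul j h" for j by (simp add: nmul_add)
  with Suc show ?case
    by (simp only: mult_Suc add.commute[of n] image_mset_lessThan_add) simp
qed simp

text \<open>The first \<open>n + 1\<close> multiples arise from either side by adding one 0: split
  off the initial term, or the last one, since \<open>nmul n h = 0\<close>.\<close>

lemma translate_multiples_period:
  "translate (image_mset (\<lambda>j. nmul j h) (mset_set {..<n})) h = image_mset (\<lambda>j. nmul j h) (mset_set {..<n})"
proof -
  let ?p = "\<lambda>j. nmul j h"
  have "nmul n h = 0" by (simp add: ord)
  have "image_mset ?p (mset_set {..<n + 1}) = {#0#} + translate (image_mset ?p (mset_set {..<n})) h"
    using translate_multiples[of h "mset_set {..<n}" 1]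
    by (simp only: image_mset_lessThan_add) (simp add: lessThan_Suc)
  moreover have "image_mset ?p (mset_set {..<n + 1}) = {#0#} + image_mset ?p (mset_set {..<n})"
    using \<open>nmul n h = 0\<close> by (simp add: lessThan_Suc)
  ultimately show ?thesis by simp
qed

lemma FS_two_powers:
  "FS (mset_set ((\<lambda>i. nmul (2 ^ i) h) ` {..<U_length (int n)})) =
    image_mset (\<lambda>j. nmul j h) (mset_set {..<2 ^ U_length (int n)})"
  unfolding image_mset_mset_set[OF inj_on_two_powers, symmetric] by (rule FS_powers_of_two)

end

lemma repeat_translate: "translate (repeat_mset c S) s = repeat_mset c (translate S s)"
  by (induction c) (simp_all add: translate_def)

text \<open>
  The subset sums of \<open>h, 2 h, \<dots>, 2\<^sup>k\<^sup>-\<^sup>1 h\<close> are \<open>j h\<close> for \<open>0 \<le> j < 2\<^sup>k\<close>; as \<open>2\<^sup>k \<equiv> \<plusminus>1 (mod n)\<close> they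
  cover the group generated by \<open>h\<close> uniformly, except for one extra \<open>0\<close> or one missing \<open>- h\<close>.
\<close>

lemma FS_two_powers_translate:
  fixes h h' :: "'a::ab_group_add" and n :: nat
  assumes n: "odd n" "n \<ge> 3"
    and ord: "\<And>j. nmul j h = 0 \<longleftrightarrow> n dvd j" and ord': "\<And>j. nmul j h' = 0 \<longleftrightarrow> n dvd j"
    and same: "image_mset (\<lambda>j. nmul j h) (mset_set {..<n}) = image_mset (\<lambda>j. nmul j h') (mset_set {..<n})"
  shows "\<exists>s. FS (mset_set ((\<lambda>i. nmul (2 ^ i) h') ` {..<U_length (int n)})) =
    translate (FS (mset_set ((\<lambda>i. nmul (2 ^ i) h) ` {..<U_length (int n)}))) s"
proof -
  let ?k = "U_length (int n)"
  let ?M = "\<lambda>h L. image_mset (\<lambda>j. nmul j h) (mset_set {..<L::nat})"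
  have "\<exists>s. ?M h' (2 ^ ?k) = translate (?M h (2 ^ ?k)) s"
    using U_length_props(2)[OF n(1)]
  proof
    assume "n dvd 2 ^ ?k - 1"
    then obtain c where "2 ^ ?k - 1 = n * c" by (rule dvdE)
    moreover have "(1::nat) \<le> 2 ^ ?k" by simp
    ultimately have "2 ^ ?k = Suc (n * c)" by linarith
    hence c: "2 ^ ?k = Suc (c * n)" by (simp only: mult.commute)
    have "nmul (c * n) h = 0" "nmul (c * n) h' = 0" by (simp_all add: ord ord')
    hence "?M h' (2 ^ ?k) = ?M h (2 ^ ?k)"
      unfolding c lessThan_Suc
      by (simp add: multiples_add_period[OF n ord] multiples_add_period[OF n ord'] same)
    thus ?thesis by (intro exI[of _ 0]) (simp add: translate_zero)
  next
    assume "n dvd 2 ^ ?k + 1"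
    then obtain c where "2 ^ ?k + 1 = n * c" by (rule dvdE)
    hence c: "Suc (2 ^ ?k) = c * n" by (simp add: mult.commute)
    \<comment> \<open>Here \<open>nmul (2 ^ ?k) g = - g\<close> is the one element missing from
      uniform coverage.\<close>
    have full: "add_mset (- g) (?M g (2 ^ ?k)) = repeat_mset c (?M g n)"
      if g: "\<And>j. nmul j g = 0 \<longleftrightarrow> n dvd j" for g :: 'a
    proof -
      have "nmul (Suc (2 ^ ?k)) g = 0" unfolding g c by simp
      hence "nmul (2 ^ ?k) g = - g" by (simp add: eq_neg_iff_add_eq_0 add.commute)
      moreover have "?M g (Suc (2 ^ ?k)) = add_mset (nmul (2 ^ ?k) g) (?M g (2 ^ ?k))"
        by (simp add: lessThan_Suc)
      ultimately show ?thesis using multiples_add_period[OF n g, of c] unfolding c by simp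
    qed
    let ?T = "?M h n"
    have Th: "translate ?T h = ?T" by (rule translate_multiples_period[OF n ord])
    have Th': "translate ?T h' = ?T" unfolding same by (rule translate_multiples_period[OF n ord'])
    have "translate ?T (- h') = translate (translate ?T h') (- h')" by (simp only: Th')
    also have "\<dots> = ?T" by (simp add: translate_translate translate_zero)
    finally have neg: "translate ?T (- h') = ?T" .
    have "translate ?T (h - h') = translate (translate ?T h) (- h')" by (simp add: translate_translate)
    hence inv: "translate ?T (h - h') = ?T" by (simp only: Th neg)
    \<comment> \<open>The shift \<open>h - h'\<close> carries the missing \<open>- h\<close> to
      \<open>- h'\<close> and preserves the uniform part.\<close>
    have "add_mset (- h') (?M h' (2 ^ ?k)) = translate (add_mset (- h) (?M h (2 ^ ?k))) (h - h')"
      unfolding full[OF ord] full[OF ord'] repeat_translate same[symmetric] inv ..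
    also have "\<dots> = add_mset (- h') (translate (?M h (2 ^ ?k)) (h - h'))"
      by (simp add: translate_def)
    finally show ?thesis by (intro exI[of _ "h - h'"]) simp
  qed
  thus ?thesis by (simp only: FS_two_powers[OF n ord] FS_two_powers[OF n ord'])
qed

section \<open>Transfer to the residue ring\<close>

context
  fixes n :: int and \<iota> :: "int \<Rightarrow> 'a::ab_group_add"
  assumes n: "odd n" "n \<ge> 3" and hom: "inj_residue_hom n \<iota>"
begin

lemma residue_hom_add: "x \<in> {0..n - 1} \<Longrightarrow> y \<in> {0..n - 1} \<Longrightarrow> \<iota> ((x + y) mod n) = \<iota> x + \<iota> y"
  using hom by (simp add: inj_residue_hom_def residue_ring_def)

lemma residue_hom_inj: "inj_on \<iota> {0..n - 1}"
  using hom by (simp add: inj_residue_hom_def residue_ring_def)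

lemma mod_in_range: "x mod n \<in> {0..n - 1}"
  using n(2) by (simp add: zle_diff1_eq)

lemma nmul_residue_hom:
  assumes x: "x \<in> {0..n - 1}"
  shows "nmul j (\<iota> x) = \<iota> (int j * x mod n)"
proof (induction j)
  case 0
  have "\<iota> 0 = \<iota> 0 + \<iota> 0" using residue_hom_add[of 0 0] n(2) by simp
  thus ?case by simp
next
  case (Suc j)
  have "nmul (Suc j) (\<iota> x) = \<iota> ((x + int j * x mod n) mod n)"
    using residue_hom_add[OF x mod_in_range, of "int j * x"] Suc by simp
  also have "(x + int j * x mod n) mod n = int (Suc j) * x mod n"
    by (simp add: mod_add_right_eq algebra_simps)
  finally show ?case .
qed

lemma unit_dvd:
  assumes "\<alpha> \<in> Units (residue_ring n)"
  shows "\<alpha> \<in> {0..n - 1}" and "n dvd \<alpha> * x \<longleftrightarrow> n dvd x"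
proof -
  from assms obtain \<gamma> where *: "\<alpha> \<in> {0..n - 1}" "\<gamma> * \<alpha> mod n = 1"
    by (auto simp: Units_def residue_ring_def)
  show "\<alpha> \<in> {0..n - 1}" by (rule *(1))
  show "n dvd \<alpha> * x \<longleftrightarrow> n dvd x"
  proof
    assume "n dvd \<alpha> * x"
    hence "n dvd \<gamma> * \<alpha> * x" by (simp add: mult.assoc)
    hence "(\<gamma> * \<alpha> * x) mod n = 0" by (simp only: dvd_eq_mod_eq_0)
    hence "(\<gamma> * \<alpha> mod n * x) mod n = 0" by (simp only: mod_mult_left_eq)
    thus "n dvd x" unfolding *(2) by (simp add: dvd_eq_mod_eq_0)
  qed simp
qed

lemma residue_hom_order:
  assumes "\<alpha> \<in> Units (residue_ring n)"
  shows "nmul j (\<iota> \<alpha>) = 0 \<longleftrightarrow> nat n dvd j"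
proof -
  have \<iota>0: "\<iota> 0 = 0" using nmul_residue_hom[of 0 0] n(2) by simp
  have "nmul j (\<iota> \<alpha>) = 0 \<longleftrightarrow> \<iota> (int j * \<alpha> mod n) = \<iota> 0"
    using nmul_residue_hom[OF unit_dvd(1)[OF assms]] \<iota>0 by simp
  also have "\<dots> \<longleftrightarrow> int j * \<alpha> mod n = 0"
    using inj_on_eq_iff[OF residue_hom_inj mod_in_range, of 0] n(2) by simp
  also have "\<dots> \<longleftrightarrow> n dvd \<alpha> * int j" by (simp add: dvd_eq_mod_eq_0 mult.commute)
  also have "\<dots> \<longleftrightarrow> n dvd int j" by (rule unit_dvd(2)[OF assms])
  also have "\<dots> \<longleftrightarrow> nat n dvd j" using n(2) by (simp add: nat_dvd_iff)
  finally show ?thesis .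
qed

text \<open>The right-hand side is independent of the unit, so two units have the same multiset of
  multiples, as \<open>FS_two_powers_translate\<close> requires.\<close>

lemma residue_hom_multiples:
  assumes "\<alpha> \<in> Units (residue_ring n)"
  shows "image_mset (\<lambda>j. nmul j (\<iota> \<alpha>)) (mset_set {..<nat n}) = mset_set (\<iota> ` {0..n - 1})"
proof -
  have inj: "inj_on (\<lambda>j. nmul j (\<iota> \<alpha>)) {..<nat n}"
  proof (rule linorder_inj_onI')
    fix i j assume ij: "i \<in> {..<nat n}" "j \<in> {..<nat n}" "i < j"
    show "nmul i (\<iota> \<alpha>) \<noteq> nmul j (\<iota> \<alpha>)"
    proof
      assume eq: "nmul i (\<iota> \<alpha>) = nmul j (\<iota> \<alpha>)"
      have "nmul j (\<iota> \<alpha>) = nmul (j - i) (\<iota> \<alpha>) + nmul i (\<iota> \<alpha>)"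
        using ij(3) nmul_add[of "j - i" i "\<iota> \<alpha>"] by simp
      hence "nmul (j - i) (\<iota> \<alpha>) = 0" using eq by simp
      hence "nat n dvd j - i" by (simp only: residue_hom_order[OF assms])
      hence "nat n \<le> j - i" by (rule dvd_imp_le) (use ij(3) in simp)
      with ij show False by simp
    qed
  qed
  have fin: "finite (\<iota> ` {0..n - 1})" by simp
  have "(\<lambda>j. nmul j (\<iota> \<alpha>)) ` {..<nat n} = \<iota> ` {0..n - 1}"
  proof (rule card_subset_eq[OF fin])
    show "(\<lambda>j. nmul j (\<iota> \<alpha>)) ` {..<nat n} \<subseteq> \<iota> ` {0..n - 1}"
      using nmul_residue_hom[OF unit_dvd(1)[OF assms]] mod_in_range by auto
    show "card ((\<lambda>j. nmul j (\<iota> \<alpha>)) ` {..<nat n}) = card (\<iota> ` {0..n - 1})"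
      by (simp add: card_image[OF inj] card_image[OF residue_hom_inj])
  qed
  thus ?thesis by (simp only: image_mset_mset_set[OF inj])
qed

lemma residue_hom_image_U:
  assumes "\<alpha> \<in> {0..n - 1}"
  shows "\<iota> ` residue_scale n \<alpha> (U n) = (\<lambda>i. nmul (2 ^ i) (\<iota> \<alpha>)) ` {..<U_length n}"
proof -
  have "\<iota> (\<alpha> * (2 ^ i mod n) mod n) = nmul (2 ^ i) (\<iota> \<alpha>)" for i
    by (simp add: nmul_residue_hom[OF assms] mod_mult_right_eq mult.commute)
  thus ?thesis by (simp add: residue_scale_def U_def residue_ring_def image_image)
qed

lemma FS_residue_scale:
  assumes "\<alpha> \<in> Units (residue_ring n)" "\<beta> \<in> Units (residue_ring n)"
  shows "\<exists>s. FS (mset_set (\<iota> ` residue_scale n \<beta> (U n))) =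
    translate (FS (mset_set (\<iota> ` residue_scale n \<alpha> (U n)))) s"
proof -
  have nn: "odd (nat n)" "nat n \<ge> 3" "int (nat n) = n" using n by (simp_all add: even_nat_iff)
  have same: "image_mset (\<lambda>j. nmul j (\<iota> \<alpha>)) (mset_set {..<nat n}) = image_mset (\<lambda>j. nmul j (\<iota> \<beta>)) (mset_set {..<nat n})"
    by (simp only: residue_hom_multiples[OF assms(1)] residue_hom_multiples[OF assms(2)])
  show ?thesis
    using FS_two_powers_translate[OF nn(1,2) residue_hom_order[OF assms(1)] residue_hom_order[OF assms(2)] same]
    by (simp only: residue_hom_image_U[OF unit_dvd(1)[OF assms(1)]]
      residue_hom_image_U[OF unit_dvd(1)[OF assms(2)]] nn(3))
qed

end

lemma move1_FS:
  assumes "move1 A A'"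
  shows "\<exists>s. FS A' = translate (FS A) s"
proof -
  from assms obtain g where g: "g \<in># A" "A' = (A - {#g#}) + {#- g#}" by (auto simp: move1_def)
  have "FS {#- g#} = translate (FS {#g#}) (- g)" by (simp add: FS_add FS_empty translate_def)
  from FS_union_translate[OF this, of "A - {#g#}"] show ?thesis
    using g by (intro exI[of _ "- g"]) simp
qed

lemma move2_FS:
  assumes "move2 A A'"
  shows "\<exists>s. FS A' = translate (FS A) s"
proof -
  from assms obtain n \<alpha> \<beta> and \<iota> :: "int \<Rightarrow> 'a" where m: "odd n" "n \<ge> 3" "\<alpha> \<in> Units (residue_ring n)"
    "\<beta> \<in> Units (residue_ring n)" "inj_residue_hom n \<iota>"
    "mset_set (\<iota> ` residue_scale n \<alpha> (U n)) \<subseteq># A"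
    "A' = (A - mset_set (\<iota> ` residue_scale n \<alpha> (U n))) + mset_set (\<iota> ` residue_scale n \<beta> (U n))"
    unfolding move2_def by (elim exE conjE)
  from FS_residue_scale[OF m(1,2,5,3,4)] obtain s where
    "FS (mset_set (\<iota> ` residue_scale n \<beta> (U n))) = translate (FS (mset_set (\<iota> ` residue_scale n \<alpha> (U n)))) s"
    by (rule exE)
  from FS_union_translate[OF this, of "A - mset_set (\<iota> ` residue_scale n \<alpha> (U n))"]
  show ?thesis using m(6,7) by (intro exI[of _ s]) simp
qed

section \<open>Connecting multisets by moves\<close>

definition move :: "'a::ab_group_add multiset \<Rightarrow> 'a multiset \<Rightarrow> bool" where
  "move A A' \<longleftrightarrow> move1 A A' \<or> move2 A A'"

lemma move_FS: "move A A' \<Longrightarrow> \<exists>s. FS A' = translate (FS A) s"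
  unfolding move_def by (elim disjE) (rule move1_FS, assumption, rule move2_FS, assumption)

lemma moves_FS: "move\<^sup>*\<^sup>* A A' \<Longrightarrow> \<exists>s. FS A' = translate (FS A) s"
proof (induction rule: rtranclp_induct)
  case base
  show ?case by (intro exI[of _ 0]) (simp add: translate_zero)
next
  case (step B C)
  from step.IH obtain s where s: "FS B = translate (FS A) s" by (rule exE)
  from move_FS[OF step.hyps(2)] obtain t where "FS C = translate (FS B) t" by (rule exE)
  thus ?case by (intro exI[of _ "s + t"]) (simp add: s translate_translate)
qed

text \<open>Invariant under sign changes; its difference for \<open>A\<close> and \<open>B\<close>
  is the function \<open>f\<close> of the overview. An element equal to its negative counts
  twice.\<close>

definition sym_count :: "'a::ab_group_add multiset \<Rightarrow> 'a \<Rightarrow> nat" where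
  "sym_count A g = count A g + count A (- g)"

text \<open>An element in excess in \<open>A\<close> has its negative in deficit, so flipping it
  shrinks \<open>A - B\<close>.\<close>

lemma flips_if_sym_count_eq:
  fixes A B :: "'a::ab_group_add multiset"
  assumes "\<And>g. sym_count A g = sym_count B g"
  shows "move\<^sup>*\<^sup>* A B"
  using assms
proof (induction "size (A - B)" arbitrary: A rule: less_induct)
  case less
  have sc: "count A g + count A (- g) = count B g + count B (- g)" for g
    using less.prems[of g] by (simp add: sym_count_def)
  show ?case
  proof (cases "A - B = {#}")
    case True
    hence le: "count A g \<le> count B g" for g by (simp add: Diff_eq_empty_iff_mset mset_subset_eq_count)
    have "A = B"
    proof (rule multiset_eqI)
      fix g show "count A g = count B g" using le[of g] le[of "- g"] sc[of g] by linarith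
    qed
    thus ?thesis by simp
  next
    case False
    then obtain g where gin: "g \<in># A - B" by (meson multiset_nonemptyE)
    hence g: "count A g > count B g" by (simp add: in_diff_count)
    hence mg: "count A (- g) < count B (- g)" using sc[of g] by linarith
    hence ne: "- g \<noteq> g" using g by auto
    define A' where "A' = (A - {#g#}) + {#- g#}"
    have gA: "g \<in># A" using g by (simp flip: count_greater_zero_iff)
    hence "move A A'" unfolding move_def move1_def A'_def by (intro disjI1 exI[of _ g] conjI refl)
    moreover have "move\<^sup>*\<^sup>* A' B"
    proof (rule less.hyps)
      have "A' - B = (A - B) - {#g#}"
      proof (rule multiset_eqI)
        fix x show "count (A' - B) x = count (A - B - {#g#}) x"
          using g mg ne by (cases "x = g"; cases "x = - g") (simp_all add: A'_def)
      qed
      thus "size (A' - B) < size (A - B)" using gin by (simp only: size_Diff1_less[OF gin])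
      show "sym_count A' x = sym_count B x" for x
      proof -
        have "count A g \<ge> 1" using gA by simp
        have iff: "- x = g \<longleftrightarrow> x = - g" "g = - x \<longleftrightarrow> x = - g" by auto
        have "sym_count A' x = sym_count A x"
          using ne \<open>count A g \<ge> 1\<close> unfolding sym_count_def A'_def
          by (cases "x = g"; cases "x = - g") (simp_all add: iff)
        thus ?thesis using less.prems by simp
      qed
    qed
    ultimately show ?thesis by (rule converse_rtranclp_into_rtranclp)
  qed
qed

text \<open>\<open>X\<close> never contains both an element and its negative, so each sign can be
  adjusted without disturbing the others. \<open>flips_if_sym_count_eq\<close> later connects
  \<open>A\<close> to the result.\<close>

lemma choose_signs:
  fixes A :: "'a::ab_group_add multiset"
  assumes "finite X" "\<And>x. x \<in> X \<Longrightarrow> - x \<notin> X" "\<And>x. x \<in> X \<Longrightarrow> sym_count A x > 0"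
  shows "\<exists>A'. (\<forall>g. sym_count A' g = sym_count A g) \<and> X \<subseteq> set_mset A'"
  using assms
proof (induction X)
  case empty
  show ?case by (intro exI[of _ A]) simp
next
  case (insert x X)
  have "\<exists>A'. (\<forall>g. sym_count A' g = sym_count A g) \<and> X \<subseteq> set_mset A'"
    by (rule insert.IH) (use insert.prems in auto)
  then obtain A' where A': "\<forall>g. sym_count A' g = sym_count A g" "X \<subseteq> set_mset A'" by (elim exE conjE)
  have nx: "- x \<notin> insert x X" using insert.prems(1) by simp
  show ?case
  proof (cases "x \<in># A'")
    case True
    thus ?thesis using A' by (intro exI[of _ A']) simp
  next
    case False
    hence c0: "count A' x = 0" by (simp add: not_in_iff)
    have "sym_count A' x > 0" using A'(1) insert.prems(2)[of x] by simp
    hence c1: "count A' (- x) \<ge> 1" using c0 by (simp add: sym_count_def)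
    define A'' where "A'' = (A' - {#- x#}) + {#x#}"
    have "sym_count A'' g = sym_count A' g" for g
    proof -
      have iff: "- g = x \<longleftrightarrow> g = - x" "x = - g \<longleftrightarrow> g = - x" by auto
      have "x \<noteq> - x" "- x \<noteq> x" using nx by auto
      with c1 show ?thesis unfolding sym_count_def A''_def
        by (cases "g = x"; cases "g = - x") (simp_all add: iff)
    qed
    moreover have "insert x X \<subseteq> set_mset A''"
    proof
      fix y assume y: "y \<in> insert x X"
      hence "y \<noteq> - x" using nx by auto
      show "y \<in> set_mset A''"
      proof (cases "y = x")
        case False
        hence "y \<in># A'" using y A'(2) by auto
        hence "y \<in># A' - {#- x#}" using \<open>y \<noteq> - x\<close> by (simp add: in_diff_count)
        thus ?thesis by (simp add: A''_def)
      qed (simp add: A''_def)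
    qed
    ultimately show ?thesis using A'(1) by (intro exI[of _ A'']) simp
  qed
qed

lemma V_add:
  assumes "\<mu> \<in> V" "\<nu> \<in> V"
  shows "(\<lambda>g. \<mu> g + \<nu> g) \<in> V"
proof -
  have fin: "finite {g. \<mu> g \<noteq> 0}" "finite {g. \<nu> g \<noteq> 0}" using assms by (simp_all add: V_def)
  have sub: "{g. \<mu> g + \<nu> g \<noteq> 0} \<subseteq> {g. \<mu> g \<noteq> 0} \<union> {g. \<nu> g \<noteq> 0}" by auto
  have "\<mu> g + \<nu> g + (\<mu> (- g) + \<nu> (- g)) = \<mu> (g + g) + \<nu> (g + g) + (\<mu> (- (g + g)) + \<nu> (- (g + g)))" for g
  proof -
    have "\<mu> g + \<mu> (- g) = \<mu> (g + g) + \<mu> (- (g + g))" "\<nu> g + \<nu> (- g) = \<nu> (g + g) + \<nu> (- (g + g))"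
      using assms unfolding V_def by (simp_all only: mem_Collect_eq)
    thus ?thesis by linarith
  qed
  moreover have "(\<Sum>g\<in>{g\<in>H. \<mu> g + \<nu> g \<noteq> 0}. \<mu> g + \<nu> g) = 0" if H: "add_subgroup H" for H
  proof -
    let ?S = "{g\<in>H. \<mu> g \<noteq> 0} \<union> {g\<in>H. \<nu> g \<noteq> 0}"
    have finS: "finite ?S" by (rule finite_subset[OF _ finite_UnI[OF fin]]) auto
    have "(\<Sum>g\<in>{g\<in>H. \<mu> g + \<nu> g \<noteq> 0}. \<mu> g + \<nu> g) = (\<Sum>g\<in>?S. \<mu> g + \<nu> g)"
      by (rule sum.mono_neutral_left[OF finS]) auto
    also have "\<dots> = (\<Sum>g\<in>?S. \<mu> g) + (\<Sum>g\<in>?S. \<nu> g)" by (rule sum.distrib)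
    also have "(\<Sum>g\<in>?S. \<mu> g) = (\<Sum>g\<in>{g\<in>H. \<mu> g \<noteq> 0}. \<mu> g)"
      by (rule sum.mono_neutral_right[OF finS]) auto
    also have "(\<Sum>g\<in>?S. \<nu> g) = (\<Sum>g\<in>{g\<in>H. \<nu> g \<noteq> 0}. \<nu> g)"
      by (rule sum.mono_neutral_right[OF finS]) auto
    finally show ?thesis using assms H by (simp add: V_def)
  qed
  ultimately show ?thesis using finite_subset[OF sub finite_UnI[OF fin]] by (simp add: V_def)
qed

lemma add_subgroup_multiples:
  assumes "n > 0" "nmul n g = 0"
  shows "add_subgroup (range (\<lambda>j. nmul j g))" and "finite (range (\<lambda>j. nmul j g))"
proof -
  have "- nmul j g \<in> range (\<lambda>j. nmul j g)" for j
  proof -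
    have "j \<le> j * n" using assms(1) by simp
    hence "nmul (j * n) g = nmul (j * n - j) g + nmul j g" using nmul_add[of "j * n - j" j g] by simp
    moreover have "nmul (j * n) g = 0" by (simp add: nmul_mult assms(2))
    ultimately have "- nmul j g = nmul (j * n - j) g" by (simp add: eq_neg_iff_add_eq_0[symmetric])
    thus ?thesis by (rule range_eqI)
  qed
  moreover have "nmul i g + nmul j g \<in> range (\<lambda>j. nmul j g)" for i j
    by (rule range_eqI[of _ _ "i + j"]) (simp add: nmul_add)
  moreover have "0 \<in> range (\<lambda>j. nmul j g)" by (rule range_eqI[of _ _ 0]) simp
  ultimately show "add_subgroup (range (\<lambda>j. nmul j g))" by (auto simp: add_subgroup_def)
  have "range (\<lambda>j. nmul j g) \<subseteq> (\<lambda>j. nmul j g) ` {..<n}"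
  proof
    fix x assume "x \<in> range (\<lambda>j. nmul j g)"
    then obtain j where "x = nmul j g" by (rule rangeE)
    hence "x = nmul (j mod n) g" by (simp add: nmul_mod[OF assms(2)])
    thus "x \<in> (\<lambda>j. nmul j g) ` {..<n}" by (rule image_eqI) (simp add: assms(1))
  qed
  thus "finite (range (\<lambda>j. nmul j g))" by (rule finite_subset) simp
qed

text \<open>Sort the elements of the cyclic group by the subgroup they generate. The total is 0, and
  by induction on the order so is every class except that of the generators.\<close>

lemma sum_generators_eq_0:
  fixes f :: "'a::ab_group_add \<Rightarrow> int"
  assumes sub: "\<And>H. add_subgroup H \<Longrightarrow> finite H \<Longrightarrow> (\<Sum>g\<in>H. f g) = 0"
    and "n > 0" "nmul n g = 0"
  defines "C \<equiv> \<lambda>x. range (\<lambda>j. nmul j x)"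
  shows "(\<Sum>y\<in>{y\<in>C g. C y = C g}. f y) = 0"
  using assms(3)
proof (induction "card (C g)" arbitrary: g rule: less_induct)
  case less
  have H: "add_subgroup (C g)" "finite (C g)"
    unfolding C_def by (rule add_subgroup_multiples[OF assms(2) less.prems])+
  have inC: "x \<in> C x" for x unfolding C_def by (rule range_eqI[of _ _ 1]) simp
  have mono: "C y \<subseteq> C g" if "y \<in> C g" for y
  proof
    fix x assume "x \<in> C y"
    then obtain i where i: "x = nmul i y" unfolding C_def by (rule rangeE)
    from that obtain j where "y = nmul j g" unfolding C_def by (rule rangeE)
    with i have "x = nmul (i * j) g" by (simp add: nmul_mult)
    thus "x \<in> C g" unfolding C_def by (rule range_eqI)
  qed
  have zero: "(\<Sum>y\<in>{y\<in>C g. C y = D}. f y) = 0" if D: "D \<in> C ` C g - {C g}" for D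
  proof -
    from D obtain x where x: "x \<in> C g" "D = C x" "C x \<noteq> C g" by auto
    have "C x \<subset> C g" using mono[OF x(1)] x(3) by blast
    hence "card (C x) < card (C g)" by (rule psubset_card_mono[OF H(2)])
    moreover have "nmul n x = 0"
    proof -
      from x(1) obtain j where "x = nmul j g" unfolding C_def by (rule rangeE)
      hence "nmul n x = nmul (j * n) g" by (simp only: nmul_mult[symmetric] mult.commute)
      thus ?thesis by (simp add: nmul_mult less.prems)
    qed
    ultimately have "(\<Sum>y\<in>{y\<in>C x. C y = C x}. f y) = 0" by (rule less.hyps)
    moreover have "{y\<in>C g. C y = D} = {y\<in>C x. C y = C x}"
      using x(2) inC mono[OF x(1)] by auto
    ultimately show ?thesis by simp
  qed
  have "0 = (\<Sum>y\<in>C g. f y)" by (rule sub[OF H, symmetric])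
  also have "\<dots> = (\<Sum>D\<in>C ` C g. \<Sum>y\<in>{y\<in>C g. C y = D}. f y)" by (rule sum.image_gen[OF H(2)])
  also have "\<dots> = (\<Sum>y\<in>{y\<in>C g. C y = C g}. f y) + (\<Sum>D\<in>C ` C g - {C g}. \<Sum>y\<in>{y\<in>C g. C y = D}. f y)"
    by (rule sum.remove) (use H(2) inC in auto)
  also have "(\<Sum>D\<in>C ` C g - {C g}. \<Sum>y\<in>{y\<in>C g. C y = D}. f y) = 0"
    by (rule sum.neutral) (rule ballI, rule zero)
  finally show ?case by simp
qed

lemma sum_eq_0_obtains:
  fixes f :: "'b \<Rightarrow> int"
  assumes "finite S" "(\<Sum>x\<in>S. f x) = 0" "x \<in> S" "f x \<noteq> 0"
  shows "\<exists>y\<in>S. f y > 0" and "\<exists>y\<in>S. f y < 0"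
proof -
  show "\<exists>y\<in>S. f y > 0"
  proof (rule ccontr)
    assume "\<not> ?thesis"
    hence "\<And>y. y \<in> S \<Longrightarrow> - f y \<ge> 0" by (auto simp: not_less)
    from sum_nonneg_eq_0_iff[OF assms(1) this] assms(2-4) show False by (simp add: sum_negf)
  qed
  show "\<exists>y\<in>S. f y < 0"
  proof (rule ccontr)
    assume "\<not> ?thesis"
    hence "\<And>y. y \<in> S \<Longrightarrow> f y \<ge> 0" by (auto simp: not_less)
    from sum_nonneg_eq_0_iff[OF assms(1) this] assms(2-4) show False by simp
  qed
qed

lemma mset_set_subset_eq: "finite X \<Longrightarrow> X \<subseteq> set_mset A \<Longrightarrow> mset_set X \<subseteq># A"
  by (rule mset_subset_eqI) (auto simp: count_mset_set' Suc_le_eq)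

text \<open>Realises the change between two generators of a cyclic group as a move: the homomorphism
  sends 1 to \<open>g\<close>, and the units are 1 and \<open>b mod n\<close>, the latter with
  inverse \<open>c mod n\<close>.\<close>

lemma move2_generator:
  fixes g :: "'a::ab_group_add"
  assumes n: "odd n" "n \<ge> 3" and ord: "\<And>j. nmul j g = 0 \<longleftrightarrow> n dvd j"
    and inv: "nmul c (nmul b g) = g"
  defines "X \<equiv> \<lambda>g. (\<lambda>i. nmul (2 ^ i) g) ` {..<U_length (int n)}"
  assumes A: "X g \<subseteq> set_mset A"
  shows "move2 A ((A - mset_set (X g)) + mset_set (X (nmul b g)))"
proof -
  define \<iota> where "\<iota> x = nmul (nat x) g" for x :: int
  have gn: "nmul n g = 0" by (simp add: ord)
  have inj: "i = j" if "nmul i g = nmul j g" "i < n" "j < n" for i j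
  proof -
    have main: "i = j" if le: "i \<le> j" and eq: "nmul i g = nmul j g" and "j < n" for i j
    proof -
      have "nmul j g = nmul (j - i) g + nmul i g" using nmul_add[of "j - i" i g] le by simp
      hence "n dvd j - i" using eq by (simp flip: ord)
      hence "j - i = 0" using \<open>j < n\<close> by (metis dvd_imp_le gr0I leD less_imp_diff_less)
      with le show ?thesis by simp
    qed
    show ?thesis using main[of i j] main[of j i] that by (cases "i \<le> j") auto
  qed
  have hom: "inj_residue_hom (int n) \<iota>"
    unfolding inj_residue_hom_def
  proof (intro conjI ballI)
    fix x y assume xy: "x \<in> carrier (residue_ring (int n))" "y \<in> carrier (residue_ring (int n))"
    hence "nat ((x + y) mod int n) = (nat x + nat y) mod n"
      by (simp add: residue_ring_def nat_mod_distrib nat_add_distrib)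
    thus "\<iota> (x \<oplus>\<^bsub>residue_ring (int n)\<^esub> y) = \<iota> x + \<iota> y"
      by (simp add: \<iota>_def residue_ring_def nmul_mod[OF gn] nmul_add)
  next
    show "inj_on \<iota> (carrier (residue_ring (int n)))"
    proof (rule inj_onI)
      fix x y assume xy: "x \<in> carrier (residue_ring (int n))" "y \<in> carrier (residue_ring (int n))" "\<iota> x = \<iota> y"
      have "nat x = nat y" by (rule inj) (use xy in \<open>simp_all add: \<iota>_def residue_ring_def nat_less_iff\<close>)
      thus "x = y" using xy(1,2) by (simp add: residue_ring_def eq_nat_nat_iff)
    qed
  qed
  have bc: "int (c mod n) * int (b mod n) mod int n = 1"
  proof -
    have "nmul (c * b mod n) g = nmul 1 g" using inv by (simp add: nmul_mod[OF gn] nmul_mult)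
    hence "c * b mod n = 1" by (rule inj) (use n(2) in simp_all)
    hence "(c mod n) * (b mod n) mod n = 1" by (simp add: mod_mult_eq)
    hence "int ((c mod n) * (b mod n) mod n) = 1" by simp
    thus ?thesis by (simp only: zmod_int of_nat_mult)
  qed
  have unit1: "1 \<in> Units (residue_ring (int n))"
    using n(2) by (auto simp: Units_def residue_ring_def intro!: bexI[of _ 1])
  have unitb: "int (b mod n) \<in> Units (residue_ring (int n))"
    unfolding Units_def residue_ring_def
    using bc n(2) by (auto intro!: bexI[of _ "int (c mod n)"] simp: mult.commute simp flip: of_nat_mod zless_iff_Suc_zadd)
  have n': "odd (int n)" "int n \<ge> 3" using n by simp_all
  have img: "\<iota> ` residue_scale (int n) \<alpha> (U (int n)) = X (\<iota> \<alpha>)" if "\<alpha> \<in> Units (residue_ring (int n))" for \<alpha>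
    unfolding X_def by (rule residue_hom_image_U[OF n' hom unit_dvd(1)[OF n' hom that]])
  have \<iota>1: "\<iota> 1 = g" and \<iota>b: "\<iota> (int (b mod n)) = nmul b g"
    by (simp_all add: \<iota>_def nmul_mod[OF gn])
  have "mset_set (X g) \<subseteq># A" by (rule mset_set_subset_eq[OF _ A]) (simp add: X_def)
  thus ?thesis
    unfolding move2_def
    by (intro exI[of _ "int n"] exI[of _ 1] exI[of _ "int (b mod n)"] exI[of _ \<iota>] conjI n' unit1 unitb hom)
      (simp_all only: img[OF unit1] img[OF unitb] \<iota>1 \<iota>b)
qed

lemma sym_count_mset_set:
  assumes "finite X" "\<And>x. x \<in> X \<Longrightarrow> - x \<notin> X"
  shows "sym_count (mset_set X) y = (if y \<in> X \<or> - y \<in> X then 1 else 0)"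
  using assms(1) assms(2)[of y] by (auto simp: sym_count_def count_mset_set')

text \<open>Take \<open>f\<close> positive at \<open>g\<close> and negative at another generator
  \<open>g'\<close> of the same group. By doubling invariance \<open>f\<close> is constant on
  \<open>X g\<close> and on \<open>X g'\<close>, so exchanging these sets moves \<open>f\<close>
  towards 0 wherever it changes.\<close>

lemma moves_if_V:
  fixes A B :: "'a::ab_group_add multiset"
  assumes two: "no_order_two TYPE('a)"
  shows "(\<lambda>g. int (count A g) - int (count B g)) \<in> V \<Longrightarrow> move\<^sup>*\<^sup>* A B"
proof (induction "\<Sum>g | sym_count A g \<noteq> sym_count B g. nat \<bar>int (sym_count A g) - int (sym_count B g)\<bar>"
    arbitrary: A rule: less_induct)
  case less
  define f where "f g = int (sym_count A g) - int (sym_count B g)" for g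
  define \<mu> where "\<mu> g = int (count A g) - int (count B g)" for g
  have V: "\<mu> \<in> V" unfolding \<mu>_def[abs_def] by (rule less.prems)
  have f\<mu>: "f g = \<mu> g + \<mu> (- g)" for g by (simp add: f_def \<mu>_def sym_count_def)
  have f_iff: "f g \<noteq> 0 \<longleftrightarrow> sym_count A g \<noteq> sym_count B g" for g by (simp add: f_def)
  have fin\<mu>: "finite {g. \<mu> g \<noteq> 0}" using V by (simp add: V_def)
  have fin: "finite {g. f g \<noteq> 0}"
  proof (rule finite_subset)
    show "{g. f g \<noteq> 0} \<subseteq> {g. \<mu> g \<noteq> 0} \<union> uminus ` {g. \<mu> g \<noteq> 0}"
    proof
      fix g assume "g \<in> {g. f g \<noteq> 0}"
      hence "\<mu> g \<noteq> 0 \<or> \<mu> (- g) \<noteq> 0" by (auto simp: f\<mu>)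
      thus "g \<in> {g. \<mu> g \<noteq> 0} \<union> uminus ` {g. \<mu> g \<noteq> 0}"
        by (auto intro: image_eqI[of g uminus "- g"])
    qed
  qed (use fin\<mu> in simp)
  have dbl: "f (g + g) = f g" for g
    using V unfolding V_def mem_Collect_eq f\<mu> by simp
  have minus: "f (- g) = f g" for g by (simp add: f\<mu>)
  show ?case
  proof (cases "\<forall>g. f g = 0")
    case True
    thus ?thesis by (intro flips_if_sym_count_eq) (simp add: f_def)
  next
    case False
    then obtain g0 where g0: "f g0 \<noteq> 0" by auto
    from doubling_invariant_torsion[OF two fin dbl g0] obtain n0 where
      n0: "odd n0" "\<forall>k. nmul k g0 = 0 \<longleftrightarrow> n0 dvd k" by (elim exE conjE)
    have n0': "n0 > 0" "nmul n0 g0 = 0" using n0 by (cases n0, simp_all)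
    have sub: "(\<Sum>g\<in>H. f g) = 0" if H: "add_subgroup H" "finite H" for H
    proof -
      have "(\<Sum>g\<in>H. \<mu> g) = (\<Sum>g\<in>{g\<in>H. \<mu> g \<noteq> 0}. \<mu> g)"
        by (rule sum.mono_neutral_right[OF H(2)]) auto
      also have "\<dots> = 0" using V H(1) by (simp add: V_def)
      finally have "(\<Sum>g\<in>H. \<mu> g) = 0" .
      moreover have "bij_betw uminus H H"
        by (rule bij_betw_byWitness[where f' = uminus]) (use H(1) in \<open>auto simp: add_subgroup_def\<close>)
      hence "(\<Sum>g\<in>H. \<mu> (- g)) = (\<Sum>g\<in>H. \<mu> g)" by (rule sum.reindex_bij_betw)
      ultimately show ?thesis by (simp add: f\<mu> sum.distrib)
    qed
    let ?C = "\<lambda>x::'a. range (\<lambda>j. nmul j x)"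
    let ?S = "{y \<in> ?C g0. ?C y = ?C g0}"
    have inC: "x \<in> ?C x" for x by (rule range_eqI[of _ _ 1]) simp
    have S: "finite ?S" "g0 \<in> ?S"
      using add_subgroup_multiples(2)[OF n0'] inC by simp_all
    have sum0: "(\<Sum>y\<in>?S. f y) = 0" by (rule sum_generators_eq_0[OF sub n0'])
    from sum_eq_0_obtains[where f = f, OF S(1) sum0 S(2) g0]
    obtain g g' where g: "g \<in> ?S" "f g > 0" and g': "g' \<in> ?S" "f g' < 0" by (elim bexE)
    have "g' \<in> ?C g" "g \<in> ?C g'" using g(1) g'(1) inC[of g'] inC[of g] by auto
    then obtain b c where b: "g' = nmul b g" and c: "g = nmul c g'" by (elim rangeE)
    have "f g \<noteq> 0" using g(2) by simp
    from doubling_invariant_torsion[OF two fin dbl this] obtain n where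
      n: "odd n" "\<forall>k. nmul k g = 0 \<longleftrightarrow> n dvd k" by (elim exE conjE)
    have ord: "nmul k g = 0 \<longleftrightarrow> n dvd k" for k by (rule spec[OF n(2)])
    have ord': "nmul k g' = 0 \<longleftrightarrow> n dvd k" for k
    proof -
      have "nmul k g' = 0" if "nmul k g = 0"
        unfolding b using that by (simp only: nmul_mult[symmetric] mult.commute[of k b]) (simp add: nmul_mult)
      moreover have "nmul k g = 0" if "nmul k g' = 0"
        by (subst c) (use that in \<open>simp only: nmul_mult[symmetric] mult.commute[of k c], simp add: nmul_mult\<close>)
      ultimately show ?thesis using ord[of k] by (cases "nmul k g = 0") auto
    qed
    \<comment> \<open>The trivial subgroup rules out \<open>g = 0\<close>, so the odd order of
      \<open>g\<close> is at least 3, as a move of the second type demands.\<close>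
    have "f 0 = 0" using sub[of "{0}"] by (simp add: add_subgroup_def)
    hence "g \<noteq> 0" using g(2) by auto
    hence "n \<noteq> 1" using ord[of 1] by auto
    moreover have "n \<noteq> 0" "n \<noteq> 2" using n(1) by (cases n, auto)
    ultimately have n3: "n \<ge> 3" by linarith
    define X where "X g = (\<lambda>i. nmul (2 ^ i) g) ` {..<U_length (int n)}" for g :: 'a
    have finX: "finite (X g)" for g by (simp add: X_def)
    have fX: "f x = f g" if "x \<in> X g" for x g
    proof -
      have "f (nmul (2 ^ i) g) = f g" for i
      proof (induction i)
        case (Suc i)
        have "nmul (2 ^ Suc i) g = nmul (2 ^ i) g + nmul (2 ^ i) g"
          by (simp only: power_Suc nmul_mult nmul_2)
        thus ?case using Suc dbl by simp
      qed simp
      thus ?thesis using that by (auto simp: X_def)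
    qed
    have negX: "- x \<notin> X g" if "x \<in> X g" for x
    proof
      assume "- x \<in> X g"
      with that obtain i j where ij: "i < U_length (int n)" "j < U_length (int n)"
        "x = nmul (2 ^ i) g" "- x = nmul (2 ^ j) g" by (auto simp: X_def)
      have "nmul (2 ^ i) g = - nmul (2 ^ j) g" by (simp flip: ij(3,4))
      with two_powers_minus_disjoint[OF n(1) n3 ord ij(1,2)] show False by (rule notE)
    qed
    have negX': "- x \<notin> X g'" if "x \<in> X g'" for x
    proof
      assume "- x \<in> X g'"
      with that obtain i j where ij: "i < U_length (int n)" "j < U_length (int n)"
        "x = nmul (2 ^ i) g'" "- x = nmul (2 ^ j) g'" by (auto simp: X_def)
      have "nmul (2 ^ i) g' = - nmul (2 ^ j) g'" by (simp flip: ij(3,4))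
      with two_powers_minus_disjoint[OF n(1) n3 ord' ij(1,2)] show False by (rule notE)
    qed
    \<comment> \<open>Where \<open>f\<close> is positive, \<open>A\<close> contains \<open>x\<close>
      or \<open>- x\<close>; sign changes can therefore bring all of \<open>X g\<close> into
      \<open>A\<close>.\<close>
    have sc_pos: "sym_count A x > 0" if "x \<in> X g" for x
      using fX[OF that] g(2) by (simp add: f_def)
    have "\<exists>A'. (\<forall>x. sym_count A' x = sym_count A x) \<and> X g \<subseteq> set_mset A'"
      by (rule choose_signs[OF finX]) (rule negX, assumption, rule sc_pos, assumption)
    then obtain A1 where
      A1: "\<forall>g. sym_count A1 g = sym_count A g" "X g \<subseteq> set_mset A1" by (elim exE conjE)
    have A_A1: "move\<^sup>*\<^sup>* A A1" by (rule flips_if_sym_count_eq) (simp add: A1(1))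
    define A2 where "A2 = (A1 - mset_set (X g)) + mset_set (X g')"
    have "nmul c (nmul b g) = g" using b c by simp
    from move2_generator[OF n(1) n3 ord this, of A1] A1(2)
    have "move2 A1 A2" unfolding A2_def X_def b by simp
    hence "move A1 A2" by (simp add: move_def)
    with A_A1 have A_A2: "move\<^sup>*\<^sup>* A A2" by (rule rtranclp.rtrancl_into_rtrancl)
    \<comment> \<open>The moves so far translate the subset sums, so the implication already proved
      puts the change from \<open>A\<close> to \<open>A2\<close> into \<open>V\<close>.\<close>
    have "(\<lambda>x. (int (count A2 x) - int (count A x)) + (int (count A x) - int (count B x))) \<in> V"
    proof (rule V_add)
      from moves_FS[OF A_A2] obtain s where "FS A2 = translate (FS A) s" by (rule exE)
      thus "(\<lambda>x. int (count A2 x) - int (count A x)) \<in> V" by (rule FS_translate_imp_V[OF two])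
    qed (rule less.prems)
    hence V2: "(\<lambda>x. int (count A2 x) - int (count B x)) \<in> V" by simp
    define f2 where "f2 y = int (sym_count A2 y) - int (sym_count B y)" for y
    have f2: "f2 y = f y - (if y \<in> X g \<or> - y \<in> X g then 1 else 0) + (if y \<in> X g' \<or> - y \<in> X g' then 1 else 0)" for y
    proof -
      have sub: "mset_set (X g) \<subseteq># A1" by (rule mset_set_subset_eq[OF finX A1(2)])
      have "int (count A2 z) = int (count A1 z) - int (count (mset_set (X g)) z) + int (count (mset_set (X g')) z)" for z
        using mset_subset_eq_count[OF sub, of z] by (simp add: A2_def of_nat_diff)
      hence "int (sym_count A2 y) = int (sym_count A1 y) - int (sym_count (mset_set (X g)) y) + int (sym_count (mset_set (X g')) y)"
        by (simp add: sym_count_def)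
      thus ?thesis
        by (simp add: f2_def f_def A1(1) sym_count_mset_set[OF finX negX] sym_count_mset_set[OF finX negX'])
    qed
    have pos: "f y > 0" if "y \<in> X g \<or> - y \<in> X g" for y
      using that fX[of y g] fX[of "- y" g] minus[of y] g(2) by auto
    have neg: "f y < 0" if "y \<in> X g' \<or> - y \<in> X g'" for y
      using that fX[of y g'] fX[of "- y" g'] minus[of y] g'(2) by auto
    \<comment> \<open>A positive integer drops by at most 1 and a negative one rises by at most 1;
      the signs of \<open>f\<close> keep the two affected sets apart.\<close>
    have le: "\<bar>f2 y\<bar> \<le> \<bar>f y\<bar>" for y
      using f2[of y] pos[of y] neg[of y] by (auto split: if_splits)
    have "g \<in> X g"
      unfolding X_def by (rule image_eqI[of _ _ 0]) (use U_length_props(1)[OF n(1)] in simp_all)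
    hence lt: "\<bar>f2 g\<bar> < \<bar>f g\<bar>"
      using f2[of g] pos[of g] neg[of g] by (auto split: if_splits)
    have "(\<Sum>y | f2 y \<noteq> 0. nat \<bar>f2 y\<bar>) = (\<Sum>y | f y \<noteq> 0. nat \<bar>f2 y\<bar>)"
    proof (rule sum.mono_neutral_left[OF fin])
      show "{y. f2 y \<noteq> 0} \<subseteq> {y. f y \<noteq> 0}"
      proof
        fix y assume "y \<in> {y. f2 y \<noteq> 0}"
        thus "y \<in> {y. f y \<noteq> 0}" using le[of y] by auto
      qed
    qed auto
    also have "\<dots> < (\<Sum>y | f y \<noteq> 0. nat \<bar>f y\<bar>)"
    proof (rule sum_strict_mono_ex1[OF fin])
      show "\<forall>y\<in>{y. f y \<noteq> 0}. nat \<bar>f2 y\<bar> \<le> nat \<bar>f y\<bar>" using le by (intro ballI nat_mono)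
      show "\<exists>y\<in>{y. f y \<noteq> 0}. nat \<bar>f2 y\<bar> < nat \<bar>f y\<bar>"
        by (rule bexI[of _ g]) (use lt \<open>f g \<noteq> 0\<close> in simp_all)
    qed
    finally have smaller: "(\<Sum>y | f2 y \<noteq> 0. nat \<bar>f2 y\<bar>) < (\<Sum>y | f y \<noteq> 0. nat \<bar>f y\<bar>)" .
    have "f2 y \<noteq> 0 \<longleftrightarrow> sym_count A2 y \<noteq> sym_count B y" for y by (simp add: f2_def)
    with smaller have "(\<Sum>y | sym_count A2 y \<noteq> sym_count B y. nat \<bar>int (sym_count A2 y) - int (sym_count B y)\<bar>)
        < (\<Sum>y | sym_count A y \<noteq> sym_count B y. nat \<bar>int (sym_count A y) - int (sym_count B y)\<bar>)"
      unfolding f_iff by (simp only: f_def f2_def)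
    hence "move\<^sup>*\<^sup>* A2 B" by (rule less.hyps[OF _ V2])
    with A_A2 show ?thesis by (rule rtranclp_trans)
  qed
qed

theorem theorem1p5:
  fixes A B :: "'a::ab_group_add multiset" and \<mu> :: "'a \<Rightarrow> int"
  assumes "no_order_two TYPE('a)"
    and "\<mu> = (\<lambda>g. int (count A g) - int (count B g))"
  shows "((\<exists>s. FS A = translate (FS B) s) \<longleftrightarrow> \<mu> \<in> V) \<and>
         (\<mu> \<in> V \<longleftrightarrow>
           (\<exists>(m::nat) (E :: nat \<Rightarrow> 'a multiset). E 0 = A \<and> E m = B \<and>
              (\<forall>i<m. (move1 (E i) (E (Suc i)) \<or> move2 (E i) (E (Suc i))) \<and>
                     (\<exists>s. FS (E (Suc i)) = translate (FS (E i)) s))))"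
    (is "(?i \<longleftrightarrow> ?ii) \<and> (?ii \<longleftrightarrow> ?iii)")
proof -
  have i_ii: "?ii" if "?i"
  proof -
    from that obtain s where "FS A = translate (FS B) s" by (rule exE)
    thus ?thesis unfolding assms(2) by (rule FS_translate_imp_V[OF assms(1)])
  qed
  have ii_iii: "?iii" if "?ii"
  proof -
    have "move\<^sup>*\<^sup>* A B" by (rule moves_if_V[OF assms(1)]) (use that assms(2) in simp)
    then obtain m where "(move ^^ m) A B" by (auto dest: rtranclp_imp_relpowp)
    then obtain E where E: "E 0 = A" "E m = B" "\<forall>i<m. move (E i) (E (Suc i))"
      unfolding relpowp_fun_conv by (elim exE conjE)
    have "\<forall>i<m. (move1 (E i) (E (Suc i)) \<or> move2 (E i) (E (Suc i))) \<and>
        (\<exists>s. FS (E (Suc i)) = translate (FS (E i)) s)"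
    proof (intro allI impI conjI)
      fix i assume "i < m"
      with E(3) have "move (E i) (E (Suc i))" by simp
      thus "move1 (E i) (E (Suc i)) \<or> move2 (E i) (E (Suc i))"
        and "\<exists>s. FS (E (Suc i)) = translate (FS (E i)) s"
        by (simp add: move_def, rule move_FS)
    qed
    with E(1,2) show ?thesis by (intro exI[of _ m] exI[of _ E] conjI)
  qed
  have iii_i: "?i" if "?iii"
  proof -
    from that obtain m E where E: "E 0 = A" "E m = B"
      "\<forall>i<m. (move1 (E i) (E (Suc i)) \<or> move2 (E i) (E (Suc i))) \<and>
        (\<exists>s. FS (E (Suc i)) = translate (FS (E i)) s)" by (elim exE conjE)
    have "\<exists>s. FS A = translate (FS (E i)) s" if "i \<le> m" for i
      using that
    proof (induction i)
      case 0
      show ?case by (intro exI[of _ 0]) (simp add: E(1) translate_zero)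
    next
      case (Suc i)
      from Suc obtain s where s: "FS A = translate (FS (E i)) s" by auto
      have "i < m" using Suc.prems by simp
      from E(3)[rule_format, OF this] obtain t where "FS (E (Suc i)) = translate (FS (E i)) t"
        by (elim conjE exE)
      \<comment> \<open>The hypothesis translates from \<open>E i\<close> to
        \<open>E (Suc i)\<close>, so its shift \<open>t\<close> is undone.\<close>
      thus ?case by (intro exI[of _ "s - t"]) (simp add: s translate_translate)
    qed
    from this[of m] show ?thesis by (simp add: E(2))
  qed
  show ?thesis using i_ii ii_iii iii_i by argo
qed

end
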